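(* Let $x,y,z$ be non-negative integers and let $\mathbf a=(a_1,\dots,a_m)$, $\mathbf b=(b_1,\dots,b_n)$ be two sequences of non-negative integers. Put $\mu=2\lfloor\frac{m+1}{2}\rfloor$, $\mu'=2\lceil\frac{m-1}{2}\rceil$, $\nu=2\lfloor\frac{n+1}{2}\rfloor$, $\nu'=2\lceil\frac{n-1}{2}\rceil$, and $$\mathbf t^{+}=(a_1,\dots,a_{\mu'},\,a_{\mu'+1}+x+y+b_{\nu},\,b_{\nu-1},\dots,b_1),\qquad \mathbf t^{-}=(0,a_1,\dots,a_{\mu-1},\,a_{\mu}+x+y+b_{\nu'+1},\,b_{\nu'},\dots,b_1,z).$$ Then $$M(R^{(1)}_{x,y,z}(\mathbf a;\mathbf b))=\frac{M(R^{(1)}_{x+y,0,z}(\mathbf a;\mathbf b))\,M(R^{(1)}_{0,y,z}(\mathbf a;\mathbf b))}{M(R^{(1)}_{y,0,z}(\mathbf a;\mathbf b))}\cdot\frac{T(x+1,2a+b+2y+z,y)\,V(2x+2a+3,b+2y+z-1,y)}{T(1,2a+b+2y+z,y)\,V(2a+3,b+2y+z-1,y)}$$ $$=2^{-y}\,Q(\mathbf t^{+})\,Q(\mathbf t^{-})\cdot\frac{H_2(2e_a+2o_b+1)\,H_2(2o_a+2e_b+2z+1)}{H_2(2e_a+2o_b+2y+1)\,H_2(2o_a+2e_b+2y+2z+1)}\cdot\frac{H(2a+b+2y+z+1)\,H(b+y+z)}{H(2a+b+y+z+1)\,H(b+z)}$$ $$\cdot\frac{T(x+1,2a+b+2y+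z,y)\,V(2x+2a+3,b+2y+z-1,y)}{T(1,2a+b+2y+z,y)\,V(2a+3,b+2y+z-1,y)}.$$
   Context: Lattice and tilings. For real $u,k$ let $[u;k]$ be the point of the plane with Cartesian coordinates $(u,\frac{\sqrt3}{2}k)$. The triangular lattice has as vertices all $[u;k]$ with $k\in\mathbb Z$, $u-k/2\in\mathbb Z$; its faces are unit equilateral triangles, up-pointing or down-pointing. A region is a finite union of unit triangles. A lozenge is the union of two unit triangles sharing an edge; it is vertical if that edge is horizontal. A tiling of a region is a covering of it by lozenges contained in it, without gaps or overlaps. $M(R)$ is the number of tilings of $R$; $M(\emptyset)=1$. Sequences. $a=\sum a_i$, $b=\sum b_j$; $o_a,e_a$ are the sums of the $a_i$ with $i$ odd, resp. even; $o_b,e_b$ likewise. $a_i=0$ for $i>m$, $b_j=0$ for $j>n$; an empty sequence is treated as the one-term sequence $(0)$. Functions. $H(n)=\prod_{i=0}^{n-1}i!$; $H_2(n)=\prod_{i=1}^{\lfloor n/2\rfloor}(n-2i)!$; for $n\ge0$, $(x)_n=x(x+1)\cdots(x+n-1)$ and $[x]_n=x(x+2)\cdots(x+2n-2)$ (both $1$ for $n=0$); $T(x,n,m)=\prod_{i=0}^{m-1}(x+i)_{n-2i}$, $V(x,n,m)=\prod_{i=0}^{m-1}[x+2i]_{n-2i}$. Empty products are $1$. Quartered hexagons. For a sequence $\mathbf t=(t_1,\dots,t_{2l})$ of non-negative integers let $s_k=t_1+\dots+t_k$, $o_t=\sum_{i\text{ odd}}t_i$, $e_t=\sum_{i\text{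 even}}t_i$. Take the region bounded by the base from $[0;0]$ to $[o_t+e_t;0]$, the segment from $[o_t+e_t;0]$ to $[o_t;2e_t]$, the north side from $[o_t;2e_t]$ to $[0;2e_t]$, and the west zigzag through $[0;0],[-\frac12;1],[0;2],[-\frac12;3],\dots,[0;2e_t]$; remove from it, for each $1\le i\le l$, the up-pointing triangle with base from $[s_{2i-1};0]$ to $[s_{2i};0]$. $Q(\mathbf t)$ is the number of tilings of the resulting region. The region $R^{(1)}_{x,y,z}(\mathbf a;\mathbf b)$. Let $L=x+y+a+b$, $A=2(y+e_a+o_b)$, $B=2(y+z+o_a+e_b)$, and let $\ell$ be the line $k=0$. Upper part: bounded by $\ell$ between $[0;0]$ and $[L;0]$, the segment from $[L;0]$ to $[L-\frac A2;A]$, the horizontal north side at height $k=A$, and the west zigzag through the points $[\alpha(k);k]$, $0\le k\le A$, with $\alpha(k)=0$ for $k$ even and $-\frac12$ for $k$ odd. Lower part: bounded by $\ell$ between $[0;0]$ and $[L;0]$, the segments from $[L;0]$ to $[L+\frac z2;-z]$ and from there to $[L+z-\frac B2;-B]$, the horizontal south side at $k=-B$, and the west zigzag through $[\beta(k);-k]$, $0\le k\le B$, with $\beta(k)=0$ for $k$ even and $-\frac12$ for $k$ odd. The region is the union of the two parts (lozenges may cross $\ell$) after removing: (i) from the lower part, everything at points $[u;-k]$ with $u<a_1-k/2$ (a down-pointing half triangle of side $2a_1$); (ii) for $2\le i\le m$, the triangle of side $a_i$ having a side on $\ell$ from $[a_1+\dots+a_{i-1};0]$ to $[a_1+\dots+a_i;0]$,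 up-pointing (above $\ell$) if $i$ is even, down-pointing (below $\ell$) if $i$ is odd; (iii) for $1\le j\le n$, the triangle of side $b_j$ having a side on $\ell$ from $[L-b_1-\dots-b_j;0]$ to $[L-b_1-\dots-b_{j-1};0]$, up-pointing (above $\ell$) if $j$ is odd, down-pointing (below $\ell$) if $j$ is even. (The underlying halved hexagon has north, northeast, southeast, south sides $x+o_a+e_b$, $2y+z+2e_a+2o_b$, $2y+z+2o_a+2e_b$, $x+e_a+o_b$.) *)

theory Defs
  imports Complex_Main "HOL-Library.Disjoint_Sets"
begin

section \<open>Triangular lattice, regions and tilings\<close>

text \<open>
  The pair \<open>(u, k)\<close> stands for the point [u;k] of the plane, whose Cartesian coordinates are
  \<open>(u, sqrt 3 / 2 * k)\<close>.  A unit triangle is represented by the set of its three vertices, and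
  a region (a finite union of unit triangles) by the set of the unit triangles it consists of.
\<close>

type_synonym point = "real \<times> int"
type_synonym triangle = "point set"
type_synonym region = "triangle set"

definition lattice :: "point set" where
  "lattice = {(u, k). u - of_int k / 2 \<in> \<int>}"

definition up_triangle :: "point \<Rightarrow> triangle" where
  "up_triangle = (\<lambda>(u, k). {(u, k), (u + 1, k), (u + 1/2, k + 1)})"

definition down_triangle :: "point \<Rightarrow> triangle" where
  "down_triangle = (\<lambda>(u, k). {(u, k), (u + 1, k), (u + 1/2, k - 1)})"

definition unit_triangles :: "triangle set" where
  "unit_triangles = up_triangle ` lattice \<union> down_triangle ` lattice"

text \<open>Two distinct unit triangles share an edge iff they have exactly two vertices in common.\<close>

definition is_lozenge :: "region \<Rightarrow> bool" where
  "is_lozenge d \<longleftrightarrow>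
     (\<exists>s\<in>unit_triangles. \<exists>t\<in>unit_triangles. card (s \<inter> t) = 2 \<and> d = {s, t})"

definition is_tiling :: "region \<Rightarrow> region set \<Rightarrow> bool" where
  "is_tiling R D \<longleftrightarrow> partition_on R D \<and> (\<forall>d\<in>D. is_lozenge d)"

definition num_tilings :: "region \<Rightarrow> nat" where
  "num_tilings R = card {D. is_tiling R D}"

text \<open>
  The set \<open>P\<close> below is always given by the inequalities of a (closed) polygon whose sides are
  lattice lines, possibly with a zigzag of lattice edges on the west.  For these polygons a unit
  triangle is contained in the polygon iff its three vertices are.
\<close>

definition triangles_in :: "point set \<Rightarrow> region" where
  "triangles_in P = {t \<in> unit_triangles. t \<subseteq> P}"

definition zigzag :: "int \<Rightarrow> real" where
  "zigzag k = (if even k then 0 else - 1/2)"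

text \<open>Up- and down-pointing triangles with horizontal side from [p;0] to [q;0].\<close>

definition up_hole :: "nat \<Rightarrow> nat \<Rightarrow> region" where
  "up_hole p q = triangles_in
     {(u, k) | u k. 0 \<le> k \<and> real p + of_int k / 2 \<le> u \<and> u \<le> real q - of_int k / 2}"

definition down_hole :: "nat \<Rightarrow> nat \<Rightarrow> region" where
  "down_hole p q = triangles_in
     {(u, - k) | u k. 0 \<le> k \<and> real p + of_int k / 2 \<le> u \<and> u \<le> real q - of_int k / 2}"

section \<open>Sequences\<close>

text \<open>Terms are numbered from 1; terms with other indices are 0.\<close>

definition term_of :: "nat list \<Rightarrow> nat \<Rightarrow> nat" where
  "term_of s i = (if 1 \<le> i \<and> i \<le> length s then s ! (i - 1) else 0)"

definition partial_sum :: "nat list \<Rightarrow> nat \<Rightarrow> nat" where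
  "partial_sum s k = (\<Sum>i=1..k. term_of s i)"

definition odd_sum :: "nat list \<Rightarrow> nat" where
  "odd_sum s = (\<Sum>i\<in>{i\<in>{1..length s}. odd i}. term_of s i)"

definition even_sum :: "nat list \<Rightarrow> nat" where
  "even_sum s = (\<Sum>i\<in>{i\<in>{1..length s}. even i}. term_of s i)"

text \<open>The empty sequence counts as the one-term sequence (0).\<close>

definition seq_length :: "nat list \<Rightarrow> nat" where
  "seq_length s = (if s = [] then 1 else length s)"

section \<open>Quartered hexagons with dents\<close>

definition quartered_hexagon :: "nat list \<Rightarrow> region" where
  "quartered_hexagon t =
     triangles_in {(u, k) | u k. 0 \<le> k \<and> k \<le> 2 * int (even_sum t) \<and>
        zigzag k \<le> u \<and> u \<le> real (odd_sum t + even_sum t) - of_int k / 2}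
     - (\<Union>i\<in>{1..length t div 2}. up_hole (partial_sum t (2*i - 1)) (partial_sum t (2*i)))"

definition Q :: "nat list \<Rightarrow> nat" where
  "Q t = num_tilings (quartered_hexagon t)"

section \<open>The halved hexagons with ferns removed\<close>

definition R1_L :: "nat \<Rightarrow> nat \<Rightarrow> nat list \<Rightarrow> nat list \<Rightarrow> nat" where
  "R1_L x y a b = x + y + sum_list a + sum_list b"

definition R1_upper :: "nat \<Rightarrow> nat \<Rightarrow> nat list \<Rightarrow> nat list \<Rightarrow> region" where
  "R1_upper x y a b = triangles_in
     {(u, k) | u k. 0 \<le> k \<and> k \<le> 2 * int (y + even_sum a + odd_sum b) \<and>
        zigzag k \<le> u \<and> u \<le> real (R1_L x y a b) - of_int k / 2}"

text \<open>
  The two upper bounds on \<open>u\<close> are the lines through the two segments of the eastern boundary,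
  which meet at depth \<open>k = z\<close>; the left half triangle of side \<open>2 a\<^sub>1\<close> is cut off along the
  lattice line \<open>u = a\<^sub>1 - k/2\<close>.
\<close>

definition R1_lower :: "nat \<Rightarrow> nat \<Rightarrow> nat \<Rightarrow> nat list \<Rightarrow> nat list \<Rightarrow> region" where
  "R1_lower x y z a b =
     triangles_in
       {(u, - k) | u k. 0 \<le> k \<and> k \<le> 2 * int (y + z + odd_sum a + even_sum b) \<and>
          zigzag k \<le> u \<and> u \<le> real (R1_L x y a b) + of_int k / 2 \<and>
          u \<le> real (R1_L x y a b + z) - of_int k / 2}
     - triangles_in {(u, - k) | u k. 0 \<le> k \<and> u \<le> real (term_of a 1) - of_int k / 2}"

definition R1 :: "nat \<Rightarrow> nat \<Rightarrow> nat \<Rightarrow> nat list \<Rightarrow> nat list \<Rightarrow> region" where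
  "R1 x y z a b =
     (R1_upper x y a b \<union> R1_lower x y z a b)
     - (\<Union>i\<in>{2..length a}.
          (if even i then up_hole else down_hole) (partial_sum a (i - 1)) (partial_sum a i))
     - (\<Union>j\<in>{1..length b}.
          (if odd j then up_hole else down_hole)
            (R1_L x y a b - partial_sum b j) (R1_L x y a b - partial_sum b (j - 1)))"

section \<open>The sequences \<open>t\<^sup>+\<close> and \<open>t\<^sup>-\<close>\<close>

definition floor_idx :: "nat \<Rightarrow> nat" where
  "floor_idx m = nat (2 * \<lfloor>(real m + 1) / 2\<rfloor>)"

definition ceil_idx :: "nat \<Rightarrow> nat" where
  "ceil_idx m = nat (2 * \<lceil>(real m - 1) / 2\<rceil>)"

definition t_plus :: "nat \<Rightarrow> nat \<Rightarrow> nat list \<Rightarrow> nat list \<Rightarrow> nat list" where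
  "t_plus x y a b =
     (let \<mu>' = ceil_idx (seq_length a); \<nu> = floor_idx (seq_length b) in
        map (term_of a) [1..<\<mu>' + 1]
        @ [term_of a (\<mu>' + 1) + x + y + term_of b \<nu>]
        @ map (term_of b) (rev [1..<\<nu>]))"

definition t_minus :: "nat \<Rightarrow> nat \<Rightarrow> nat \<Rightarrow> nat list \<Rightarrow> nat list \<Rightarrow> nat list" where
  "t_minus x y z a b =
     (let \<mu> = floor_idx (seq_length a); \<nu>' = ceil_idx (seq_length b) in
        [0] @ map (term_of a) [1..<\<mu>]
        @ [term_of a \<mu> + x + y + term_of b (\<nu>' + 1)]
        @ map (term_of b) (rev [1..<\<nu>' + 1])
        @ [z])"

section \<open>Product functions\<close>

definition H :: "nat \<Rightarrow> real" where
  "H n = (\<Prod>i<n. fact i)"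

definition H2 :: "nat \<Rightarrow> real" where
  "H2 n = (\<Prod>i=1..n div 2. fact (n - 2 * i))"

definition skip_pochhammer :: "real \<Rightarrow> nat \<Rightarrow> real" where
  "skip_pochhammer x n = (\<Prod>j<n. x + 2 * real j)"

text \<open>
  The length \<open>n\<close> is an integer because \<open>n = -1\<close> occurs below, but only with \<open>m = 0\<close>; wherever the
  products are used, all lengths \<open>n - 2 * i\<close> with \<open>i < m\<close> are non-negative.
\<close>

definition Tprod :: "real \<Rightarrow> int \<Rightarrow> nat \<Rightarrow> real" where
  "Tprod x n m = (\<Prod>i<m. pochhammer (x + real i) (nat (n - 2 * int i)))"

definition Vprod :: "real \<Rightarrow> int \<Rightarrow> nat \<Rightarrow> real" where
  "Vprod x n m = (\<Prod>i<m. skip_pochhammer (x + 2 * real i) (nat (n - 2 * int i)))"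

end

theory Submission
  imports "Jordan_Normal_Form.Determinant" Defs
begin

text \<open>
  Cutting the region along \<open>\<ell>\<close> leaves two dented half hexagons, and the lozenges crossing \<open>\<ell>\<close>
  occupy a \<open>y\<close>-subset \<open>S\<close> of the gap between the two ferns.  A half hexagon with dents at the
  positions \<open>D\<close> has a number of tilings proportional to the symplectic Weyl product
  \<open>Delta D\<close> = product of all \<open>s\<close> and of all \<open>s\<^sup>2 - t\<^sup>2\<close>; this follows row by row, a row of lozenges
  acting on binomial determinants by Pascal's rule.  The upper and the lower dents together fill the
  complement of the gap, so the factors of the product of the two Weyl products that
  involve \<open>S\<close> depend only on the sums of the two sequences and on \<open>x, y, z\<close>, and both formulas
  reduce to one evaluation:
  the sum over all \<open>S\<close> is the partition function of a Racah ensemble in \<open>s\<^sup>2\<close>.  Andreief's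
  identity turns it into a determinant of moments, each moment is a summable very-well-poised sum, and
  a polynomial basis adapted to finite differences makes the determinant triangular.
\<close>

section \<open>Determinants\<close>

text \<open>Why \<open>s^2\<close>: the determinant entry of a dent s is, up to a constant, the
  product of the consecutive numbers from s - j to s + j, that is s times a monic polynomial in s^2.
  Why a Racah weight: for a fixed set S the cross factors of the two Weyl products run exactly once
  over all positions outside the gap. These form two full intervals, one at each end, so the factors
  collapse to a quotient of factorials depending on s. Two polynomial bases serve the moment
  determinant: one shifts the lower parameter of the weight, the other its upper parameter. Every
  mixed moment is then again a Racah sum, and only one factor of its closed form couples row and
  column. The factor 1/2 in that closed form is the origin of 2^(-y). Moving y into x leaves all
  dents in place, and for y = 0 no lozenge crosses the line. Hence the product and quotient of the
  three auxiliary counts replaces the sum for x by the sum for x = 0, and the ratio of these two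
  sums is the quotient of the products T and V.\<close>

definition det_rows :: "(nat \<Rightarrow> real) list \<Rightarrow> real" where
  "det_rows vs = det (mat (length vs) (length vs) (\<lambda>(i, j). (vs ! i) j))"

lemma det_rows_Nil [simp]: "det_rows [] = 1"
  by (simp add: det_rows_def)

lemma det_mat_leibniz:
  fixes f :: "nat \<Rightarrow> nat \<Rightarrow> real"
  shows "det (mat n n (\<lambda>(i, j). f i j)) = (\<Sum>p | p permutes {0..<n}. signof p * (\<Prod>i=0..<n. f i (p i)))"
proof -
  have "det (mat n n (\<lambda>(i, j). f i j)) = (\<Sum>p | p permutes {0..<n}. signof p *
      (\<Prod>i=0..<n. mat n n (\<lambda>(i, j). f i j) $$ (i, p i)))"
    by (rule det_def') simp
  also have "\<dots> = (\<Sum>p | p permutes {0..<n}. signof p * (\<Prod>i=0..<n. f i (p i)))"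
  proof (intro sum.cong refl arg_cong2[where f = "(*)"] prod.cong)
    fix p i assume "p \<in> {p. p permutes {0..<n}}" "i \<in> {0..<n}"
    then show "mat n n (\<lambda>(i, j). f i j) $$ (i, p i) = f i (p i)"
      using permutes_in_image[of p "{0..<n}" i] by simp
  qed
  finally show ?thesis .
qed

lemma det_rows_leibniz:
  "det_rows vs = (\<Sum>p | p permutes {0..<length vs}. signof p * (\<Prod>i=0..<length vs. (vs ! i) (p i)))"
  unfolding det_rows_def by (rule det_mat_leibniz)

lemma det_rows_expand_row:
  \<comment> \<open>Each summand of Leibniz' formula contains one entry of the row \<open>w\<close>,
    and its other factors come from the other rows. A single \<open>c\<close> for all
    \<open>w\<close> makes additivity in that row immediate.\<close>
  "\<exists>c. \<forall>w. det_rows (xs @ w # ys) = (\<Sum>p | p permutes {0..<length xs + Suc (length ys)}. w (p (length xs)) * c p)"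
proof -
  let ?n = "length xs + Suc (length ys)"
  let ?m = "length xs"
  let ?z = "xs @ (\<lambda>_. 0) # ys"
  define c where "c p = signof p * (\<Prod>i\<in>{0..<?n} - {?m}. (?z ! i) (p i))" for p
  have "det_rows (xs @ w # ys) = (\<Sum>p | p permutes {0..<?n}. w (p ?m) * c p)" for w
  proof -
    have "(\<Prod>i=0..<?n. ((xs @ w # ys) ! i) (p i)) = w (p ?m) * (\<Prod>i\<in>{0..<?n} - {?m}. (?z ! i) (p i))"
      for p :: "nat \<Rightarrow> nat"
    proof -
      have "(\<Prod>i=0..<?n. ((xs @ w # ys) ! i) (p i)) =
        w (p ?m) * (\<Prod>i\<in>{0..<?n} - {?m}. ((xs @ w # ys) ! i) (p i))"
        by (subst prod.remove[of _ ?m]) (auto simp: nth_append)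
      also have "(\<Prod>i\<in>{0..<?n} - {?m}. ((xs @ w # ys) ! i) (p i)) = (\<Prod>i\<in>{0..<?n} - {?m}. (?z ! i) (p i))"
        by (intro prod.cong refl) (auto simp: nth_append nth_Cons')
      finally show ?thesis .
    qed
    then show ?thesis unfolding det_rows_leibniz c_def by (simp add: mult_ac)
  qed
  then show ?thesis by blast
qed

lemma det_rows_add:
  "det_rows (xs @ (\<lambda>j. u j + v j) # ys) = det_rows (xs @ u # ys) + det_rows (xs @ v # ys)"
proof -
  obtain c where "\<And>w. det_rows (xs @ w # ys) = (\<Sum>p | p permutes {0..<length xs + Suc (length ys)}. w (p (length xs)) * c p)"
    using det_rows_expand_row by blast
  then show ?thesis by (simp add: distrib_right sum.distrib)
qed

lemma det_rows_zero_row: "det_rows (xs @ (\<lambda>_. 0) # ys) = 0"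
  using det_rows_add[of xs "\<lambda>_. 0" "\<lambda>_. 0" ys] by simp

lemma det_rows_equal_rows:
  assumes "i < length vs" "j < length vs" "i \<noteq> j" "vs ! i = vs ! j"
  shows "det_rows vs = 0"
  unfolding det_rows_def
  by (rule det_identical_rows[of _ "length vs" i j]) (use assms in \<open>auto intro!: eq_vecI\<close>)

lemma det_rows_repeat: "det_rows (xs @ u # u # ys) = 0"
  by (rule det_rows_equal_rows[of "length xs" _ "Suc (length xs)"]) (auto simp: nth_append)

lemma det_rows_zero_col:
  assumes "\<And>v. v \<in> set vs \<Longrightarrow> v 0 = 0" "vs \<noteq> []"
  shows "det_rows vs = 0"
  unfolding det_rows_leibniz
proof (intro sum.neutral ballI)
  fix p assume "p \<in> {p. p permutes {0..<length vs}}"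
  then have p: "p permutes {0..<length vs}" by simp
  have "0 \<in> {0..<length vs}" using assms(2) by simp
  then have "0 \<in> p ` {0..<length vs}" using p by (simp add: permutes_image)
  then obtain i where i: "i \<in> {0..<length vs}" "p i = 0" by auto
  then have "(vs ! i) (p i) = 0" using assms(1) by simp
  then show "signof p * (\<Prod>i=0..<length vs. (vs ! i) (p i)) = 0" using i by (auto intro!: prod_zero bexI[of _ i])
qed

text \<open>The first column is a unit vector, so the matrix is block triangular. Rows with a zero
  put in front arise from Pascal's rule at odd lines; the extra column is dropped here once the
  strip is used up.\<close>

lemma det_rows_block:
  assumes "w 0 = 1"
  shows "det_rows (w # map (\<lambda>r j. case j of 0 \<Rightarrow> 0 | Suc j \<Rightarrow> r j) vs) = det_rows vs"
proof -
  let ?n = "length vs"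
  let ?A1 = "mat 1 1 (\<lambda>_. 1) :: real mat" and ?A2 = "mat 1 ?n (\<lambda>(_, j). w (Suc j))"
  let ?A4 = "mat ?n ?n (\<lambda>(i, j). (vs ! i) j)"
  have "mat (Suc ?n) (Suc ?n) (\<lambda>(i, j). ((w # map (\<lambda>r j. case j of 0 \<Rightarrow> 0 | Suc j \<Rightarrow> r j) vs) ! i) j)
     = four_block_mat ?A1 ?A2 (0\<^sub>m ?n 1) ?A4"
    using assms by (intro eq_matI) (auto simp: nth_Cons' split: nat.splits)
  moreover have "det (four_block_mat ?A1 ?A2 (0\<^sub>m ?n 1) ?A4) = det ?A1 * det ?A4"
    by (rule det_four_block_mat_lower_left_zero_col) auto
  moreover have "det ?A1 = 1" by (subst det_single) auto
  ultimately show ?thesis by (simp add: det_rows_def)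
qed

text \<open>The last point is made a variable t. Expansion along its row gives a polynomial in t of
  degree at most n that vanishes at the other points and has the determinant of size n as
  coefficient of t^n. If the other points are distinct this determines it; if two of them coincide,
  both sides are 0.\<close>

lemma det_monic_polys:
  fixes p :: "nat \<Rightarrow> real poly" and x :: "nat \<Rightarrow> real"
  assumes p: "\<And>j. degree (p j) \<le> j" "\<And>j. coeff (p j) j = 1"
  shows "det (mat n n (\<lambda>(i, j). poly (p j) (x i))) = (\<Prod>j<n. \<Prod>i<j. x j - x i)"
proof (induction n)
  case 0
  then show ?case by simp
next
  case (Suc n)
  let ?V = "det (mat n n (\<lambda>(i, j). poly (p j) (x i)))"
  define B where "B t = mat (Suc n) (Suc n) (\<lambda>(i, j). poly (p j) (if i = n then t else x i))" for t
  have B: "B t \<in> carrier_mat (Suc n) (Suc n)" for t by (simp add: B_def)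
  \<comment> \<open>Deleting row n removes every occurrence of t, so the cofactors along that row
    are constants.\<close>
  have del: "mat_delete (B t) n j = mat_delete (B 0) n j" for t j
    by (intro eq_matI) (auto simp: B_def mat_delete_def)
  define q where "q = (\<Sum>j<Suc n. smult (cofactor (B 0) n j) (p j))"
  have det_B: "det (B t) = poly q t" for t
  proof -
    have "det (B t) = (\<Sum>j<Suc n. B t $$ (n, j) * cofactor (B t) n j)"
      by (rule laplace_expansion_row[OF B]) simp
    also have "\<dots> = (\<Sum>j<Suc n. poly (p j) t * cofactor (B 0) n j)"
    proof (intro sum.cong refl arg_cong2[where f = "(*)"])
      show "B t $$ (n, j) = poly (p j) t" if "j \<in> {..<Suc n}" for j
        using that by (simp add: B_def)
      show "cofactor (B t) n j = cofactor (B 0) n j" for j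
        unfolding cofactor_def by (simp only: del[of t])
    qed
    finally show ?thesis by (simp add: q_def poly_sum mult.commute)
  qed
  have "mat_delete (B 0) n n = mat n n (\<lambda>(i, j). poly (p j) (x i))"
    by (intro eq_matI) (auto simp: B_def mat_delete_def)
  then have cof: "cofactor (B 0) n n = ?V" by (simp add: cofactor_def)
  have deg_q: "degree q \<le> n" unfolding q_def
  proof (rule degree_sum_le)
    show "degree (smult (cofactor (B 0) n j) (p j)) \<le> n" if "j \<in> {..<Suc n}" for j
      using that p(1)[of j] by (meson degree_smult_le lessThan_iff less_Suc_eq_le order_trans)
  qed simp
  have "coeff q n = (\<Sum>j<Suc n. cofactor (B 0) n j * coeff (p j) n)"
    by (simp add: q_def coeff_sum)
  also have "\<dots> = cofactor (B 0) n n"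
  proof -
    have "coeff (p j) n = 0" if "j < n" for j
      using that p(1)[of j] by (intro coeff_eq_0) simp
    then show ?thesis by (simp add: p(2))
  qed
  finally have coeff_q: "coeff q n = ?V" using cof by simp
  have goal: "det (mat (Suc n) (Suc n) (\<lambda>(i, j). poly (p j) (x i))) = poly q (x n)"
  proof -
    have "mat (Suc n) (Suc n) (\<lambda>(i, j). poly (p j) (x i)) = B (x n)"
      by (intro eq_matI) (auto simp: B_def)
    then show ?thesis using det_B by simp
  qed
  show ?case
  proof (cases "inj_on x {..<n}")
    case True
    let ?r = "smult ?V (\<Prod>i<n. [:- x i, 1:])"
    have deg: "degree (\<Prod>i<n. [:- x i, 1:]) = n"
      by (subst degree_prod_eq_sum_degree) auto
    have "coeff (\<Prod>i<n. [:- x i, 1:]) n = 1"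
      using lead_coeff_prod[of "\<lambda>i. [:- x i, 1:]" "{..<n}"] deg by simp
    moreover have "poly q z = poly ?r z" if z: "z \<in> x ` {..<n}" for z
    proof -
      obtain i where i: "i < n" "z = x i" using z by auto
      have "det (B z) = 0"
        by (rule det_identical_rows[OF B, of i n]) (use i in \<open>auto simp: B_def intro!: eq_vecI\<close>)
      moreover have "poly ?r z = 0" using i by (auto simp: poly_prod)
      ultimately show ?thesis using det_B by simp
    qed
    ultimately have "q = ?r"
      using coeff_q deg_q deg True
      by (intro poly_eqI_degree_lead_coeff[where n = n and A = "x ` {..<n}"])
        (auto simp: card_image intro: order_trans[OF degree_smult_le])
    then have "poly q (x n) = ?V * (\<Prod>i<n. x n - x i)" by (simp add: poly_prod)
    then show ?thesis using Suc goal by simp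
  next
    case False
    then obtain i j where ij: "i < j" "j < n" "x i = x j"
      unfolding inj_on_def by (metis lessThan_iff linorder_neqE_nat)
    have "det (mat (Suc n) (Suc n) (\<lambda>(i, j). poly (p j) (x i))) = 0"
      by (rule det_identical_rows[of _ "Suc n" i j]) (use ij in \<open>auto intro!: eq_vecI\<close>)
    moreover have "(\<Prod>i<j. x j - x i) = 0" using ij by (intro prod_zero bexI[of _ i]) auto
    then have "(\<Prod>j<Suc n. \<Prod>i<j. x j - x i) = 0" using ij(2) by (intro prod_zero) auto
    ultimately show ?thesis by simp
  qed
qed

text \<open>Andreief's identity; the symmetrisation over permutations is what produces the factorial.\<close>

lemma sum_det_mult_det:
  fixes \<phi> \<psi> :: "nat \<Rightarrow> 'a \<Rightarrow> real"
  assumes fin: "finite G"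
  shows "(\<Sum>f\<in>{0..<n} \<rightarrow>\<^sub>E G. det (mat n n (\<lambda>(i, j). \<phi> j (f i))) * det (mat n n (\<lambda>(i, j). \<psi> j (f i)))
            * (\<Prod>i=0..<n. w (f i)))
    = fact n * det (mat n n (\<lambda>(i, j). \<Sum>s\<in>G. \<phi> i s * \<psi> j s * w s))"
proof -
  let ?F = "{0..<n} \<rightarrow>\<^sub>E G" and ?P = "{p. p permutes {0..<n}}"
  define B where "B f = det (mat n n (\<lambda>(i, j). \<psi> j (f i)))" for f
  define D where "D = (\<Sum>f\<in>?F. (\<Prod>i=0..<n. \<phi> i (f i) * w (f i)) * B f)"
  have B_perm: "B (g \<circ> p) = signof p * B g" if "p permutes {0..<n}" for p g
  proof -
    have "mat n n (\<lambda>(i, j). \<psi> j ((g \<circ> p) i)) = mat n n (\<lambda>(i, j). mat n n (\<lambda>(i, j). \<psi> j (g i)) $$ (p i, j))"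
      using permutes_in_image[OF that] by (intro eq_matI) auto
    then show ?thesis unfolding B_def
      using det_permute_rows[of "mat n n (\<lambda>(i, j). \<psi> j (g i))" n p] that by simp
  qed
  \<comment> \<open>Composing f with p permutes the rows of the second determinant, and the
    resulting sign cancels \<open>signof p\<close>. All n! summands therefore equal the one of the
    identity.\<close>
  have summand: "(\<Sum>f\<in>?F. signof p * (\<Prod>i=0..<n. \<phi> (p i) (f i)) * B f * (\<Prod>i=0..<n. w (f i))) = D"
    if p: "p permutes {0..<n}" for p
  proof -
    define q where "q = inv_into UNIV p"
    have q: "q permutes {0..<n}" unfolding q_def by (rule permutes_inv[OF p])
    have pq: "p (q i) = i" "q (p i) = i" for i
      unfolding q_def using p by (simp_all add: permutes_inverses)
    have comp: "g \<circ> r \<in> ?F" if "r permutes {0..<n}" "g \<in> ?F" for r g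
      using that permutes_in_image[OF that(1)] by (auto simp: PiE_iff extensional_def)
    have "(\<Sum>f\<in>?F. signof p * (\<Prod>i=0..<n. \<phi> (p i) (f i)) * B f * (\<Prod>i=0..<n. w (f i))) =
       (\<Sum>g\<in>?F. signof p * (\<Prod>i=0..<n. \<phi> (p i) ((g \<circ> p) i)) * B (g \<circ> p) * (\<Prod>i=0..<n. w ((g \<circ> p) i)))"
      by (rule sum.reindex_bij_witness[of _ "\<lambda>g. g \<circ> p" "\<lambda>f. f \<circ> q"])
        (use comp p q pq in \<open>auto simp: o_def\<close>)
    also have "\<dots> = D" unfolding D_def
    proof (rule sum.cong[OF refl])
      fix g
      have sg: "signof p * signof p = (1::real)"
        by (simp add: sign_def)
      have "(\<Prod>i=0..<n. \<phi> (p i) (g (p i)) * w (g (p i))) = (\<Prod>i=0..<n. \<phi> i (g i) * w (g i))"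
        using prod.permute[OF p, of "\<lambda>i. \<phi> i (g i) * w (g i)"] by (simp add: o_def)
      then show "signof p * (\<Prod>i=0..<n. \<phi> (p i) ((g \<circ> p) i)) * B (g \<circ> p) * (\<Prod>i=0..<n. w ((g \<circ> p) i))
         = (\<Prod>i=0..<n. \<phi> i (g i) * w (g i)) * B g"
        using sg by (simp add: B_perm[OF p] prod.distrib[symmetric] mult_ac)
    qed
    finally show ?thesis .
  qed
  have "(\<Sum>f\<in>?F. det (mat n n (\<lambda>(i, j). \<phi> j (f i))) * B f * (\<Prod>i=0..<n. w (f i))) =
    (\<Sum>p\<in>?P. \<Sum>f\<in>?F. signof p * (\<Prod>i=0..<n. \<phi> (p i) (f i)) * B f * (\<Prod>i=0..<n. w (f i)))"
    unfolding det_mat_leibniz[of n "\<lambda>i j. \<phi> j (f i)" for f] by (subst sum.swap) (simp add: sum_distrib_right)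
  also have "\<dots> = (\<Sum>p\<in>?P. D)" using summand by (intro sum.cong refl) auto
  also have "\<dots> = fact n * D" by (simp add: card_permutations)
  also have "D = (\<Sum>p\<in>?P. signof p * (\<Sum>f\<in>?F. \<Prod>i=0..<n. \<phi> i (f i) * \<psi> (p i) (f i) * w (f i)))"
    unfolding D_def B_def det_mat_leibniz[of n "\<lambda>i j. \<psi> j (f i)" for f] sum_distrib_left
    by (subst sum.swap) (auto intro!: sum.cong simp: prod.distrib mult_ac)
  also have "\<dots> = (\<Sum>p\<in>?P. signof p * (\<Prod>i=0..<n. \<Sum>s\<in>G. \<phi> i s * \<psi> (p i) s * w s))"
    using fin by (simp add: prod_sum_PiE)
  also have "\<dots> = det (mat n n (\<lambda>(i, j). \<Sum>s\<in>G. \<phi> i s * \<psi> j s * w s))"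
    by (rule det_mat_leibniz[symmetric])
  finally show ?thesis unfolding B_def .
qed

text \<open>A product of absolute values over ordered pairs no longer depends on how the points are
  enumerated, as a sum over subsets requires. Each unordered pair occurs twice, whence the
  square.\<close>

lemma prod_diff_square:
  fixes y :: "nat \<Rightarrow> real"
  shows "(\<Prod>j<n. \<Prod>i<j. y j - y i)\<^sup>2 = (\<Prod>i<n. \<Prod>j\<in>{..<n} - {i}. \<bar>y i - y j\<bar>)"
proof (induction n)
  case 0
  then show ?case by simp
next
  case (Suc n)
  have "(\<Prod>i<n. \<Prod>j\<in>{..<Suc n} - {i}. \<bar>y i - y j\<bar>) =
     (\<Prod>i<n. (\<Prod>j\<in>{..<n} - {i}. \<bar>y i - y j\<bar>) * \<bar>y n - y i\<bar>)"
  proof (rule prod.cong[OF refl])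
    fix i assume "i \<in> {..<n}"
    then have "{..<Suc n} - {i} = insert n ({..<n} - {i})" by auto
    then show "(\<Prod>j\<in>{..<Suc n} - {i}. \<bar>y i - y j\<bar>) = (\<Prod>j\<in>{..<n} - {i}. \<bar>y i - y j\<bar>) * \<bar>y n - y i\<bar>"
      by (simp add: abs_minus_commute)
  qed
  moreover have "{..<Suc n} - {n} = {..<n}" by auto
  ultimately have "(\<Prod>i<Suc n. \<Prod>j\<in>{..<Suc n} - {i}. \<bar>y i - y j\<bar>) =
     (\<Prod>i<n. \<Prod>j\<in>{..<n} - {i}. \<bar>y i - y j\<bar>) * ((\<Prod>i<n. \<bar>y n - y i\<bar>) * (\<Prod>i<n. \<bar>y n - y i\<bar>))"
    by (simp add: prod.distrib)
  also have "(\<Prod>i<n. \<bar>y n - y i\<bar>) * (\<Prod>i<n. \<bar>y n - y i\<bar>) = (\<Prod>i<n. y n - y i)\<^sup>2"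
    by (simp add: power2_eq_square flip: prod.distrib abs_mult)
  finally show ?case using Suc by (simp add: power_mult_distrib)
qed

text \<open>These functions are the enumerations of \<open>S\<close>. One fixed enumeration
  identifies them with permutations; their number cancels the factorial in Andreief's
  identity.\<close>

lemma card_bij_extensional:
  assumes "finite S" "card S = n"
  shows "card {f \<in> {0..<n} \<rightarrow>\<^sub>E S. inj_on f {0..<n} \<and> f ` {0..<n} = S} = fact n"
proof -
  obtain g where g: "bij_betw g {0..<n} S" using ex_bij_betw_nat_finite assms by blast
  let ?h = "\<lambda>p. restrict (g \<circ> p) {0..<n}"
  have "bij_betw ?h {p. p permutes {0..<n}} {f \<in> {0..<n} \<rightarrow>\<^sub>E S. inj_on f {0..<n} \<and> f ` {0..<n} = S}"
  proof (rule bij_betw_imageI)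
    show "inj_on ?h {p. p permutes {0..<n}}"
    proof (rule inj_onI)
      fix p q assume p: "p \<in> {p. p permutes {0..<n}}" "q \<in> {p. p permutes {0..<n}}" and e: "?h p = ?h q"
      show "p = q"
      proof
        fix i
        show "p i = q i"
        proof (cases "i < n")
          case True
          then have "g (p i) = g (q i)" using fun_cong[OF e, of i] by simp
          moreover have "p i \<in> {0..<n}" "q i \<in> {0..<n}"
            using p True permutes_in_image[of _ "{0..<n}" i] by auto
          ultimately show ?thesis using g unfolding bij_betw_def inj_on_def by blast
        next
          case False
          then show ?thesis using p by (auto simp: permutes_def)
        qed
      qed
    qed
    show "?h ` {p. p permutes {0..<n}} = {f \<in> {0..<n} \<rightarrow>\<^sub>E S. inj_on f {0..<n} \<and> f ` {0..<n} = S}"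
    proof (intro equalityI subsetI)
      fix f assume "f \<in> ?h ` {p. p permutes {0..<n}}"
      then obtain p where p: "p permutes {0..<n}" "f = ?h p" by auto
      have "bij_betw (g \<circ> p) {0..<n} S"
        using bij_betw_trans[OF permutes_imp_bij[OF p(1)] g] .
      then have "bij_betw f {0..<n} S" using p(2) by (simp add: bij_betw_cong[of "{0..<n}" f "g \<circ> p"])
      then show "f \<in> {f \<in> {0..<n} \<rightarrow>\<^sub>E S. inj_on f {0..<n} \<and> f ` {0..<n} = S}"
        using p(2) by (auto simp: bij_betw_def)
    next
      fix f assume "f \<in> {f \<in> {0..<n} \<rightarrow>\<^sub>E S. inj_on f {0..<n} \<and> f ` {0..<n} = S}"
      then have f: "bij_betw f {0..<n} S" "f \<in> extensional {0..<n}"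
        by (auto simp: bij_betw_def PiE_def)
      define p where "p i = (if i \<in> {0..<n} then the_inv_into {0..<n} g (f i) else i)" for i
      have "bij_betw (the_inv_into {0..<n} g \<circ> f) {0..<n} {0..<n}"
        using bij_betw_trans[OF f(1) bij_betw_the_inv_into[OF g]] .
      moreover have "bij_betw p {0..<n} {0..<n} \<longleftrightarrow> bij_betw (the_inv_into {0..<n} g \<circ> f) {0..<n} {0..<n}"
        by (rule bij_betw_cong) (simp add: p_def)
      ultimately have "bij_betw p {0..<n} {0..<n}" by simp
      then have "p permutes {0..<n}" by (rule bij_imp_permutes) (auto simp: p_def)
      moreover have "f = ?h p"
      proof
        fix i
        show "f i = ?h p i"
        proof (cases "i < n")
          case True
          then have "f i \<in> S" using f(1) by (auto simp: bij_betw_def)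
          then show ?thesis using True g by (simp add: p_def f_the_inv_into_f_bij_betw)
        next
          case False
          then show ?thesis using f(2) by (simp add: extensional_def)
        qed
      qed
      ultimately show "f \<in> ?h ` {p. p permutes {0..<n}}" by blast
    qed
  qed
  then show ?thesis using bij_betw_same_card card_permutations[of "{0..<n}" n] by fastforce
qed

text \<open>Both determinants are Vandermonde products at the values of f, so functions that are not
  injective contribute 0 and the others depend only on their image. The monic bases on the two sides
  can be chosen independently, a freedom that makes the determinant triangular later.\<close>

lemma sum_subsets_eq_det:
  fixes x w :: "'a \<Rightarrow> real"
  assumes fin: "finite G"
    and \<phi>: "\<And>j. degree (\<phi> j) \<le> j" "\<And>j. coeff (\<phi> j) j = 1"
    and \<psi>: "\<And>j. degree (\<psi> j) \<le> j" "\<And>j. coeff (\<psi> j) j = 1"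
  shows "(\<Sum>S | S \<subseteq> G \<and> card S = n. (\<Prod>s\<in>S. \<Prod>t\<in>S - {s}. \<bar>x s - x t\<bar>) * (\<Prod>s\<in>S. w s))
    = det (mat n n (\<lambda>(i, j). \<Sum>s\<in>G. poly (\<phi> i) (x s) * poly (\<psi> j) (x s) * w s))"
proof -
  let ?F = "{0..<n} \<rightarrow>\<^sub>E G"
  let ?T = "{S. S \<subseteq> G \<and> card S = n}"
  define h where "h S = (\<Prod>s\<in>S. \<Prod>t\<in>S - {s}. \<bar>x s - x t\<bar>) * (\<Prod>s\<in>S. w s)" for S
  define F where "F f = det (mat n n (\<lambda>(i, j). poly (\<phi> j) (x (f i)))) *
     det (mat n n (\<lambda>(i, j). poly (\<psi> j) (x (f i)))) * (\<Prod>i=0..<n. w (f i))" for f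
  have F: "F f = (\<Prod>i<n. \<Prod>j\<in>{..<n} - {i}. \<bar>x (f i) - x (f j)\<bar>) * (\<Prod>i=0..<n. w (f i))" for f
    unfolding F_def det_monic_polys[OF \<phi>, where x = "\<lambda>i. x (f i)"]
      det_monic_polys[OF \<psi>, where x = "\<lambda>i. x (f i)"]
    using prod_diff_square[of "\<lambda>i. x (f i)" n] by (simp add: power2_eq_square)
  have F_inj: "F f = h (f ` {0..<n})" if f: "inj_on f {0..<n}" for f
  proof -
    have "(\<Prod>t\<in>f ` {0..<n} - {f i}. \<bar>x (f i) - x t\<bar>) = (\<Prod>j\<in>{..<n} - {i}. \<bar>x (f i) - x (f j)\<bar>)"
      if "i < n" for i
    proof -
      have "f ` {0..<n} - {f i} = f ` ({..<n} - {i})"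
        using f that by (auto simp: inj_on_def)
      moreover have "inj_on f ({..<n} - {i})" using f by (auto simp: inj_on_def)
      ultimately show ?thesis by (simp add: prod.reindex)
    qed
    then have "(\<Prod>s\<in>f ` {0..<n}. \<Prod>t\<in>f ` {0..<n} - {s}. \<bar>x s - x t\<bar>) =
       (\<Prod>i<n. \<Prod>j\<in>{..<n} - {i}. \<bar>x (f i) - x (f j)\<bar>)"
      using f by (simp add: prod.reindex atLeast0LessThan)
    then show ?thesis using f by (simp add: F h_def prod.reindex)
  qed
  have F_noninj: "F f = 0" if noninj: "\<not> inj_on f {0..<n}" for f
  proof -
    obtain i j where "i < n" "j < n" "i \<noteq> j" "f i = f j"
      using noninj by (auto simp: inj_on_def)
    moreover from this have "(\<Prod>j\<in>{..<n} - {i}. \<bar>x (f i) - x (f j)\<bar>) = 0"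
      by (intro prod_zero bexI[of _ j]) auto
    ultimately have "\<exists>i\<in>{..<n}. (\<Prod>j\<in>{..<n} - {i}. \<bar>x (f i) - x (f j)\<bar>) = 0" by blast
    then have "(\<Prod>i<n. \<Prod>j\<in>{..<n} - {i}. \<bar>x (f i) - x (f j)\<bar>) = 0"
      by (rule prod_zero[OF finite_lessThan])
    then show ?thesis by (simp add: F)
  qed
  have finF: "finite ?F" using fin by (simp add: finite_PiE)
  have finT: "finite ?T" using fin by simp
  have "fact n * det (mat n n (\<lambda>(i, j). \<Sum>s\<in>G. poly (\<phi> i) (x s) * poly (\<psi> j) (x s) * w s)) = (\<Sum>f\<in>?F. F f)"
    unfolding F_def by (rule sum_det_mult_det[OF fin, symmetric])
  also have "\<dots> = (\<Sum>f\<in>{f\<in>?F. inj_on f {0..<n}}. F f)"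
    by (rule sum.mono_neutral_right) (use finF F_noninj in auto)
  also have "\<dots> = (\<Sum>S\<in>?T. \<Sum>f\<in>{f\<in>{f\<in>?F. inj_on f {0..<n}}. f ` {0..<n} = S}. F f)"
    by (rule sum.group[symmetric]) (use finF finT in \<open>auto simp: card_image\<close>)
  also have "\<dots> = (\<Sum>S\<in>?T. fact n * h S)"
  proof (rule sum.cong[OF refl])
    fix S assume S: "S \<in> ?T"
    then have "{f\<in>{f\<in>?F. inj_on f {0..<n}}. f ` {0..<n} = S} =
      {f \<in> {0..<n} \<rightarrow>\<^sub>E S. inj_on f {0..<n} \<and> f ` {0..<n} = S}" by (auto simp: PiE_def)
    moreover have "card {f \<in> {0..<n} \<rightarrow>\<^sub>E S. inj_on f {0..<n} \<and> f ` {0..<n} = S} = fact n"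
      using S fin finite_subset by (intro card_bij_extensional) auto
    ultimately show "(\<Sum>f\<in>{f\<in>{f\<in>?F. inj_on f {0..<n}}. f ` {0..<n} = S}. F f) = fact n * h S"
      using F_inj by simp
  qed
  finally show ?thesis unfolding h_def by (simp flip: sum_distrib_left)
qed

section \<open>A closed form for Racah sums\<close>

text \<open>This is (2n - 1)!!. It replaces the Gamma values at half-integers that the parameter 1/2
  of the weight brings in.\<close>

definition odd_fact :: "nat \<Rightarrow> real" where
  "odd_fact n = (\<Prod>i<n. 2 * real i + 1)"

lemma odd_fact_Suc [simp]: "odd_fact (Suc n) = odd_fact n * (2 * real n + 1)"
  by (simp add: odd_fact_def)

lemma odd_fact_pos [simp]: "odd_fact n > 0"
  by (auto simp: odd_fact_def intro!: prod_pos)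

lemma odd_fact_nonzero [simp]: "odd_fact n \<noteq> 0"
  using odd_fact_pos[of n] by linarith

text \<open>
  The Racah weight (with one parameter 1/2) on the quadratic lattice \<open>s\<^sup>2\<close>; all natural subtractions
  are exact for \<open>a < s \<le> g \<le> N\<close>.
\<close>

definition racah_weight :: "nat \<Rightarrow> nat \<Rightarrow> nat \<Rightarrow> nat \<Rightarrow> real" where
  "racah_weight a g N s = real s * fact (s + a) * fact (N - s) * fact (N + s) /
     (fact (s - a - 1) * fact (g - s) * fact (g + s))"

text \<open>The strict bound matters: at s = a + 1 the right side is 0, while truncated subtraction
  gives \<open>fact 0\<close> in the denominator on the left and a nonzero weight.\<close>

lemma racah_weight_lower:
  assumes "a + 1 < s"
  shows "racah_weight (a + 1) g N s = (real s ^ 2 - real (a + 1) ^ 2) * racah_weight a g N s"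
proof -
  obtain r where s: "s = a + 2 + r" using assms less_iff_Suc_add[of "a + 1" s] by auto
  define R P where "R = real r + 1" and "P = real s + real a + 1"
  have 1: "(fact (s + (a + 1)) :: real) = P * fact (s + a)"
    by (simp add: P_def algebra_simps)
  have 2: "(fact (s - a - 1) :: real) = R * fact r" "s - (a + 1) - 1 = r"
    by (simp_all add: s R_def)
  have 3: "real s ^ 2 - real (a + 1) ^ 2 = R * P"
    by (simp add: s R_def P_def power2_eq_square algebra_simps)
  have "R \<noteq> 0" unfolding R_def by linarith
  then show ?thesis
    unfolding racah_weight_def 1 2 3 by (simp add: field_simps)
qed

lemma racah_weight_top:
  assumes "s \<le> N"
  shows "racah_weight a g (N + 1) s = (real (N + 1) ^ 2 - real s ^ 2) * racah_weight a g N s"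
proof -
  obtain r where N: "N = s + r" using assms le_Suc_ex by blast
  have "N + 1 - s = Suc r" "N - s = r" "N + 1 + s = Suc (N + s)" using N by auto
  moreover have "real (N + 1) ^ 2 - real s ^ 2 = real (Suc r) * real (Suc (N + s))"
    by (simp add: N power2_eq_square algebra_simps)
  ultimately show ?thesis
    unfolding racah_weight_def by (simp only: fact_Suc) (simp add: field_simps)
qed

lemma racah_weight_gap:
  assumes "s \<le> g"
  shows "racah_weight a g N s = (real (g + 1) ^ 2 - real s ^ 2) * racah_weight a (g + 1) N s"
proof -
  obtain r where g: "g = s + r" using assms le_Suc_ex by blast
  have "g + 1 - s = Suc r" "g - s = r" "g + 1 + s = Suc (g + s)" using g by auto
  moreover have "real (g + 1) ^ 2 - real s ^ 2 = real (Suc r) * real (Suc (g + s))"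
    by (simp add: g power2_eq_square algebra_simps)
  moreover have "real (Suc r) \<noteq> 0" "real (Suc (g + s)) \<noteq> 0" by simp_all
  ultimately show ?thesis
    unfolding racah_weight_def by (simp only: fact_Suc) (simp add: field_simps del: of_nat_Suc)
qed

definition racah_sum :: "nat \<Rightarrow> nat \<Rightarrow> nat \<Rightarrow> real" where
  "racah_sum a g N = (\<Sum>s\<in>{a<..g}. racah_weight a g N s)"

text \<open>Contiguity: \<open>(N + 1)\<^sup>2 - s\<^sup>2\<close> is the sum of \<open>(g + 1)\<^sup>2 - s\<^sup>2\<close> and a constant.\<close>

lemma racah_sum_rec:
  assumes "a \<le> g" "g + 1 \<le> N"
  shows "racah_sum a (g + 1) (N + 1) =
    racah_sum a g N + (real (N + 1) ^ 2 - real (g + 1) ^ 2) * racah_sum a (g + 1) N"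
proof -
  have "racah_sum a (g + 1) (N + 1) =
    (\<Sum>s\<in>{a<..g + 1}. (real (g + 1) ^ 2 - real s ^ 2) * racah_weight a (g + 1) N s
      + (real (N + 1) ^ 2 - real (g + 1) ^ 2) * racah_weight a (g + 1) N s)"
    unfolding racah_sum_def
  proof (rule sum.cong[OF refl])
    fix s assume "s \<in> {a<..g + 1}"
    then have "racah_weight a (g + 1) (N + 1) s = (real (N + 1) ^ 2 - real s ^ 2) * racah_weight a (g + 1) N s"
      using assms by (intro racah_weight_top) auto
    then show "racah_weight a (g + 1) (N + 1) s = (real (g + 1) ^ 2 - real s ^ 2) * racah_weight a (g + 1) N s
      + (real (N + 1) ^ 2 - real (g + 1) ^ 2) * racah_weight a (g + 1) N s"
      by (simp only:) (simp only: left_diff_distrib)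
  qed
  also have "\<dots> = (\<Sum>s\<in>{a<..g + 1}. (real (g + 1) ^ 2 - real s ^ 2) * racah_weight a (g + 1) N s)
      + (real (N + 1) ^ 2 - real (g + 1) ^ 2) * racah_sum a (g + 1) N"
    by (simp only: sum.distrib racah_sum_def sum_distrib_left)
  also have "(\<Sum>s\<in>{a<..g + 1}. (real (g + 1) ^ 2 - real s ^ 2) * racah_weight a (g + 1) N s) = racah_sum a g N"
  proof -
    have "{a<..g + 1} = insert (g + 1) {a<..g}" using assms by auto
    then have "(\<Sum>s\<in>{a<..g + 1}. (real (g + 1) ^ 2 - real s ^ 2) * racah_weight a (g + 1) N s) =
      (\<Sum>s\<in>{a<..g}. (real (g + 1) ^ 2 - real s ^ 2) * racah_weight a (g + 1) N s)"
      by simp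
    then show ?thesis 
      unfolding racah_sum_def by (simp only:) (intro sum.cong refl, rule racah_weight_gap[symmetric], simp)
  qed
  finally show ?thesis .
qed

text \<open>The value of \<open>racah_sum a (a + 1 + t) (a + 1 + t + d)\<close>.\<close>

definition racah_closed :: "nat \<Rightarrow> nat \<Rightarrow> nat \<Rightarrow> real" where
  "racah_closed a t d = fact (2 * a + t + d + 2) * fact d * odd_fact (a + t + d + 2) * odd_fact (a + 1) /
     (2 * fact t * odd_fact (a + t + 1) * odd_fact (a + d + 2))"

lemma racah_closed_0:
  "racah_closed a t 0 = fact (2 * a + t + 2) * real (2 * a + 2 * t + 3) / (2 * real (2 * a + 3) * fact t)"
proof -
  have 1: "2 * a + t + 0 + 2 = 2 * a + t + 2" "a + t + 0 + 2 = Suc (a + t + 1)" "a + 0 + 2 = Suc (a + 1)"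
    by auto
  define X Y where "X = real (2 * a + 2 * t + 3)" and "Y = real (2 * a + 3)"
  have 2: "2 * real (a + t + 1) + 1 = X" "2 * real (a + 1) + 1 = Y" "Y \<noteq> 0"
    by (simp_all add: X_def Y_def)
  show ?thesis unfolding racah_closed_def 1 odd_fact_Suc 2 X_def[symmetric] Y_def[symmetric]
    using 2(3) by (simp add: field_simps del: fact_Suc odd_fact_Suc add_2_eq_Suc')
qed

text \<open>For N = g the factorials containing g and N cancel, so the summands do not change with
  g, and extending the range only adds the weight at s = a + t + 2. That weight is the last term
  here.\<close>

lemma racah_closed_base:
  "racah_closed a (Suc t) 0 = racah_closed a t 0 + real (a + t + 2) * fact (2 * a + t + 2) / fact (Suc t)"
proof -
  define F f T Y where "F = (fact (2 * a + t + 2) :: real)" and "f = (fact t :: real)"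
    and "T = real (Suc t)" and "Y = real (2 * a + 3)"
  have 1: "2 * a + Suc t + 2 = Suc (2 * a + t + 2)" by simp
  have nz: "f \<noteq> 0" "T \<noteq> 0" "Y \<noteq> 0" by (simp_all add: f_def T_def Y_def)
  have key: "real (Suc (2 * a + t + 2)) * real (2 * a + 2 * Suc t + 3) =
    real (2 * a + 2 * t + 3) * T + 2 * Y * real (a + t + 2)"
    by (simp add: T_def Y_def algebra_simps)
  have "racah_closed a (Suc t) 0 = F * (real (Suc (2 * a + t + 2)) * real (2 * a + 2 * Suc t + 3)) / (2 * Y * (T * f))"
    unfolding racah_closed_0 1 fact_Suc F_def[symmetric] f_def[symmetric] T_def[symmetric] Y_def[symmetric]
    by simp
  also have "\<dots> = F * real (2 * a + 2 * t + 3) / (2 * Y * f) + real (a + t + 2) * F / (T * f)"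
    unfolding key using nz by (simp add: field_simps)
  finally show ?thesis
    unfolding racah_closed_0 fact_Suc F_def[symmetric] f_def[symmetric] T_def[symmetric] Y_def[symmetric] .
qed

text \<open>This is the recursion of \<open>racah_sum_rec\<close> with g = a + t + 1 and N = a + t +
  d + 2; the product in front of the last term is (N + 1)^2 - (g + 1)^2. Once the common part
  \<open>K\<close> is taken out, the quadratic identity \<open>key\<close> remains.\<close>

lemma racah_closed_rec:
  "racah_closed a (Suc t) (Suc d) = racah_closed a t (Suc d)
     + real (Suc d) * real (2 * a + 2 * t + d + 5) * racah_closed a (Suc t) d"
proof -
  define p where "p = 2 * a + t + d + 2"
  define q where "q = a + t + d + 2"
  define r where "r = a + t + 1"
  define u where "u = a + d + 2"
  have 1: "2 * a + Suc t + Suc d + 2 = Suc (Suc p)" "a + Suc t + Suc d + 2 = Suc (Suc q)"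
    "a + Suc t + 1 = Suc r" "a + Suc d + 2 = Suc u" "2 * a + t + Suc d + 2 = Suc p"
    "a + t + Suc d + 2 = Suc q" "2 * a + Suc t + d + 2 = Suc p" "a + Suc t + d + 2 = Suc q"
    "a + t + 1 = r" "a + d + 2 = u"
    unfolding p_def q_def r_def u_def by auto
  define U R Q0 Q1 P1 P2 T D where defs: "U = 2 * real u + 1" "R = 2 * real r + 1"
    "Q0 = 2 * real q + 1" "Q1 = 2 * real (Suc q) + 1" "P1 = real (Suc p)" "P2 = real (Suc (Suc p))"
    "T = real (Suc t)" "D = real (Suc d)"
  have nz: "T \<noteq> 0" "U \<noteq> 0" "R \<noteq> 0" unfolding defs by linarith+
  define f1 f2 f3 o1 o2 o3 o4 where fs: "f1 = (fact p :: real)" "f2 = (fact d :: real)" "f3 = (fact t :: real)"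
    "o1 = odd_fact q" "o2 = odd_fact (a + 1)" "o3 = odd_fact r" "o4 = odd_fact u"
  have fnz: "f3 \<noteq> 0" "o3 \<noteq> 0" "o4 \<noteq> 0" unfolding fs by simp_all
  define K where "K = f1 * f2 * o1 * o2 * P1 * D * Q0 / (2 * f3 * o3 * o4)"
  have A: "racah_closed a (Suc t) (Suc d) = K * (P2 * Q1) / (T * R * U)"
    unfolding racah_closed_def 1 odd_fact_Suc fact_Suc defs[symmetric] fs[symmetric] K_def
    using nz fnz by (simp add: field_simps)
  have B: "racah_closed a t (Suc d) = K / U"
    unfolding racah_closed_def 1 odd_fact_Suc fact_Suc defs[symmetric] fs[symmetric] K_def
    using nz fnz by (simp add: field_simps)
  have C: "D * X * racah_closed a (Suc t) d = K * X / (T * R)" for X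
    unfolding racah_closed_def 1 odd_fact_Suc fact_Suc defs[symmetric] fs[symmetric] K_def
    using nz fnz by (simp add: field_simps)
  have key: "P2 * Q1 = T * R + real (2 * a + 2 * t + d + 5) * U"
    unfolding defs p_def q_def r_def u_def by (simp add: algebra_simps)
  show ?thesis unfolding A B C key defs(8)[symmetric] using nz by (simp add: field_simps)
qed

text \<open>The outer induction is on d = N - g, the inner one on t = g - a - 1. Contiguity
  expresses the pair (t + 1, d + 1) by (t, d + 1) and (t + 1, d). For d = 0 the sum grows by single
  terms; for t = 0 the first of the two sums has an empty range.\<close>

lemma racah_sum_closed: "racah_sum a (a + 1 + t) (a + 1 + t + d) = racah_closed a t d"
proof (induction d arbitrary: t)
  case 0
  have summand: "racah_weight a g g s = real s * fact (s + a) / fact (s - a - 1)" if "s \<le> g" for g s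
    by (simp add: racah_weight_def)
  show ?case
  proof (induction t)
    case 0
    have "{a<..a + 1} = {a + 1}" by auto
    moreover have "racah_weight a (a + 1) (a + 1) (a + 1) = real (a + 1) * fact (2 * a + 1)"
    proof -
      have "a + 1 + a = 2 * a + 1" "a + 1 - a - 1 = 0" by auto
      then show ?thesis by (simp only: summand[OF order_refl]) simp
    qed
    moreover have "racah_closed a 0 0 = real (a + 1) * fact (2 * a + 1)"
    proof -
      define Y f where "Y = real (2 * a + 3)" and "f = (fact (2 * a + 1) :: real)"
      have "Y \<noteq> 0" by (simp add: Y_def)
      moreover have "2 * a + 0 + 2 = Suc (2 * a + 1)" "2 * a + 2 * 0 + 3 = 2 * a + 3"
        "real (Suc (2 * a + 1)) = 2 * real (a + 1)" by simp_all
      ultimately show ?thesis unfolding racah_closed_0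
        by (simp only: fact_Suc Y_def[symmetric] f_def[symmetric]) (simp add: field_simps)
    qed
    ultimately show ?case unfolding racah_sum_def by simp
  next
    case (Suc t)
    have "{a<..a + 1 + Suc t} = insert (a + t + 2) {a<..a + 1 + t}" by auto
    then have "racah_sum a (a + 1 + Suc t) (a + 1 + Suc t + 0) = racah_weight a (a + t + 2) (a + t + 2) (a + t + 2)
       + (\<Sum>s\<in>{a<..a + 1 + t}. racah_weight a (a + 1 + Suc t) (a + 1 + Suc t) s)"
      unfolding racah_sum_def by simp
    also have "(\<Sum>s\<in>{a<..a + 1 + t}. racah_weight a (a + 1 + Suc t) (a + 1 + Suc t) s) = racah_sum a (a + 1 + t) (a + 1 + t)"
      unfolding racah_sum_def by (rule sum.cong) (simp_all add: racah_weight_def)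
    also have "\<dots> = racah_closed a t 0" using Suc by simp
    also have "racah_weight a (a + t + 2) (a + t + 2) (a + t + 2) = real (a + t + 2) * fact (2 * a + t + 2) / fact (Suc t)"
    proof -
      have "a + t + 2 + a = 2 * a + t + 2" "a + t + 2 - a - 1 = Suc t" by auto
      then show ?thesis unfolding racah_weight_def by (simp only:) simp
    qed
    finally show ?case by (simp add: racah_closed_base)
  qed
next
  case (Suc d)
  note outer = Suc.IH
  show ?case
  proof (induction t)
    case 0
    have "racah_sum a (a + 1) (a + 1 + d + 1) = racah_sum a a (a + 1 + d) +
      (real (a + 1 + d + 1) ^ 2 - real (a + 1) ^ 2) * racah_sum a (a + 1) (a + 1 + d)"
      by (rule racah_sum_rec) auto
    also have "racah_sum a a (a + 1 + d) = 0" by (simp add: racah_sum_def)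
    also have "racah_sum a (a + 1) (a + 1 + d) = racah_closed a 0 d" using outer[of 0] by simp
    also have "0 + (real (a + 1 + d + 1) ^ 2 - real (a + 1) ^ 2) * racah_closed a 0 d = racah_closed a 0 (Suc d)"
    proof -
      have 1: "2 * a + 0 + Suc d + 2 = Suc (2 * a + d + 2)" "a + 0 + Suc d + 2 = Suc (a + d + 2)"
        "a + Suc d + 2 = Suc (a + d + 2)" "2 * a + 0 + d + 2 = 2 * a + d + 2" "a + 0 + d + 2 = a + d + 2" by auto
      have 2: "real (a + 1 + d + 1) ^ 2 - real (a + 1) ^ 2 = real (Suc d) * real (Suc (2 * a + d + 2))"
        by (simp add: power2_eq_square algebra_simps)
      define U P D where defs: "U = 2 * real (a + d + 2) + 1" "P = real (Suc (2 * a + d + 2))" "D = real (Suc d)"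
      define f1 f2 o1 o2 o3 where fs: "f1 = (fact (2 * a + d + 2) :: real)" "f2 = (fact d :: real)"
        "o1 = odd_fact (a + d + 2)" "o2 = odd_fact (a + 1)" "o3 = odd_fact (a + 0 + 1)"
      have "U \<noteq> 0" "o1 \<noteq> 0" "o3 \<noteq> 0" unfolding defs fs by (linarith, simp_all)
      then show ?thesis unfolding racah_closed_def 1 2 odd_fact_Suc fact_Suc defs[symmetric] fs[symmetric]
        by (simp add: field_simps)
    qed
    finally show ?case by simp
  next
    case (Suc t)
    let ?N = "a + 1 + Suc t + d"
    have "racah_sum a (a + 1 + t + 1) (?N + 1) = racah_sum a (a + 1 + t) ?N +
      (real (?N + 1) ^ 2 - real (a + 1 + t + 1) ^ 2) * racah_sum a (a + 1 + t + 1) ?N"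
      by (rule racah_sum_rec) auto
    also have "racah_sum a (a + 1 + t) ?N = racah_closed a t (Suc d)" using Suc by simp
    also have "racah_sum a (a + 1 + t + 1) ?N = racah_closed a (Suc t) d" using outer[of "Suc t"] by simp
    also have "real (?N + 1) ^ 2 - real (a + 1 + t + 1) ^ 2 = real (Suc d) * real (2 * a + 2 * t + d + 5)"
      by (simp add: power2_eq_square algebra_simps)
    finally show ?case by (simp add: racah_closed_rec)
  qed
qed

section \<open>The Selberg-type Racah sum\<close>

lemma alternating_binomial_Suc:
  fixes f :: "nat \<Rightarrow> real"
  shows "(\<Sum>k\<le>Suc j. (- 1) ^ k * real (Suc j choose k) * f k) =
    (\<Sum>k\<le>j. (- 1) ^ k * real (j choose k) * (f k - f (Suc k)))"
proof -
  have "(\<Sum>k\<le>Suc j. (- 1) ^ k * real (Suc j choose k) * f k) =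
     f 0 + (\<Sum>k\<le>j. (- 1) ^ Suc k * real (j choose Suc k) * f (Suc k))
       - (\<Sum>k\<le>j. (- 1) ^ k * real (j choose k) * f (Suc k))"
    by (subst sum.atMost_Suc_shift) (simp add: algebra_simps sum.distrib sum_negf sum_subtractf)
  also have "f 0 + (\<Sum>k\<le>j. (- 1) ^ Suc k * real (j choose Suc k) * f (Suc k)) =
     (\<Sum>k\<le>Suc j. (- 1) ^ k * real (j choose k) * f k)"
    by (subst sum.atMost_Suc_shift) simp
  also have "\<dots> = (\<Sum>k\<le>j. (- 1) ^ k * real (j choose k) * f k)" by simp
  finally show ?thesis by (simp add: right_diff_distrib sum_subtractf)
qed

text \<open>A difference cancels the leading coefficient, so each of the j differences lowers the
  degree, and a constant becomes 0.\<close>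

lemma alternating_sum_poly:
  fixes p :: "real poly"
  assumes "degree p < j"
  shows "(\<Sum>k\<le>j. (- 1) ^ k * real (j choose k) * poly p (real k)) = 0"
  using assms
proof (induction j arbitrary: p)
  case 0
  then show ?case by simp
next
  case (Suc j)
  define q where "q = p - pcompose p [:1, 1:]"
  have q: "poly q (real k) = poly p (real k) - poly p (real (Suc k))" for k
    by (simp add: q_def poly_pcompose)
  have "(\<Sum>k\<le>j. (- 1) ^ k * real (j choose k) * poly q (real k)) = 0"
  proof (cases "degree p = 0")
    case True
    then have "q = 0" unfolding q_def by (metis degree_eq_zeroE pcompose_const diff_self)
    then show ?thesis by simp
  next
    case False
    have "degree q \<le> degree p"
      unfolding q_def using degree_diff_le_max[of p "pcompose p [:1, 1:]"] by (simp add: degree_pcompose)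
    moreover have "coeff q (degree p) = 0"
      using lead_coeff_comp[of "[:1, 1:]" p] by (simp add: q_def degree_pcompose)
    ultimately have "q = 0 \<or> degree q < degree p" by (simp add: eq_zero_or_degree_less)
    then show ?thesis using Suc by auto
  qed
  then show ?case unfolding alternating_binomial_Suc q by simp
qed

text \<open>A partial fraction expansion read backwards. The induction varies \<open>c\<close>
  because the difference of 1/(c + k) in k involves c + 1.\<close>

lemma alternating_sum_inverse:
  fixes c :: real
  assumes "c > 0"
  shows "(\<Sum>k\<le>j. (- 1) ^ k * real (j choose k) * (1 / (c + real k))) = fact j / pochhammer c (Suc j)"
  using assms
proof (induction j arbitrary: c)
  case 0
  then show ?case by simp
next
  case (Suc j)
  have "(\<Sum>k\<le>Suc j. (- 1) ^ k * real (Suc j choose k) * (1 / (c + real k))) =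
    (\<Sum>k\<le>j. (- 1) ^ k * real (j choose k) * (1 / (c + real k))) -
    (\<Sum>k\<le>j. (- 1) ^ k * real (j choose k) * (1 / ((c + 1) + real k)))"
    unfolding alternating_binomial_Suc by (simp add: right_diff_distrib sum_subtractf add_ac)
  also have "\<dots> = fact j / pochhammer c (Suc j) - fact j / pochhammer (c + 1) (Suc j)"
    using Suc.IH[of c] Suc.IH[of "c + 1"] Suc.prems by simp
  also have "\<dots> = fact (Suc j) / pochhammer c (Suc (Suc j))"
  proof -
    define P where "P = pochhammer (c + 1) j"
    have P: "P > 0" unfolding P_def using Suc.prems by (intro pochhammer_pos) simp
    have 1: "pochhammer c (Suc j) = c * P" "pochhammer (c + 1) (Suc j) = P * (c + 1 + real j)"
      unfolding P_def by (rule pochhammer_rec) (simp only: pochhammer_rec' mult.commute)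
    have 2: "pochhammer c (Suc (Suc j)) = c * P * (c + 1 + real j)"
      unfolding pochhammer_rec[of c "Suc j"] 1 by simp
    have nz: "c \<noteq> 0" "P \<noteq> 0" "c + 1 + real j \<noteq> 0" using P Suc.prems by auto
    show ?thesis unfolding 1 2 fact_Suc using nz by (simp add: divide_simps) (simp add: algebra_simps)
  qed
  finally show ?case .
qed

text \<open>Division of p by X + c leaves the remainder p(-c) and a quotient of degree below j,
  which the j differences annihilate. Only the simple fraction survives.\<close>

lemma alternating_sum_frac:
  fixes p :: "real poly"
  assumes c: "c > 0" and deg: "degree p \<le> j"
  shows "(\<Sum>k\<le>j. (- 1) ^ k * real (j choose k) * (poly p (real k) / (c + real k))) =
    poly p (- c) * fact j / pochhammer c (Suc j)"
proof -
  have "poly (p - [:poly p (- c):]) (- c) = 0" by simp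
  then have "[:- (- c), 1:] dvd p - [:poly p (- c):]" by (simp only: poly_eq_0_iff_dvd)
  then obtain r where r: "p - [:poly p (- c):] = [:c, 1:] * r" by (auto elim: dvdE)
  have p_eq: "poly p (real k) / (c + real k) = poly p (- c) * (1 / (c + real k)) + poly r (real k)" for k
  proof -
    have "poly p (real k) - poly p (- c) = (c + real k) * poly r (real k)"
      using arg_cong[OF r, of "\<lambda>q. poly q (real k)"] by (simp add: algebra_simps)
    moreover have "c + real k \<noteq> 0" using c by (simp add: add_pos_nonneg less_imp_neq[symmetric])
    ultimately show ?thesis by (simp add: field_simps)
  qed
  have "(\<Sum>k\<le>j. (- 1) ^ k * real (j choose k) * poly r (real k)) = 0"
  proof (cases "r = 0")
    case False
    have "Suc (degree r) = degree ([:c, 1:] * r)" using False by (subst degree_mult_eq) auto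
    also have "\<dots> \<le> j" unfolding r[symmetric] using deg by (intro degree_diff_le) auto
    finally show ?thesis by (intro alternating_sum_poly) simp
  qed simp
  then have "(\<Sum>k\<le>j. (- 1) ^ k * real (j choose k) * (poly p (real k) / (c + real k))) =
    poly p (- c) * (\<Sum>k\<le>j. (- 1) ^ k * real (j choose k) * (1 / (c + real k)))"
    unfolding p_eq by (simp add: distrib_left sum.distrib sum_distrib_left mult_ac)
  then show ?thesis by (simp only: alternating_sum_inverse[OF c]) simp
qed

section \<open>Newton bases in s^2 and the triangular moment matrix\<close>

definition lower_poly :: "nat \<Rightarrow> nat \<Rightarrow> real poly" where
  "lower_poly a i = (\<Prod>l<i. [:- (real (a + 1 + l) ^ 2), 1:])"

text \<open>In the variable s^2, \<open>lower_poly a i\<close> raises the parameter a of the weight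
  by i and \<open>top_poly N k\<close> raises N by k, so all mixed moments stay Racah sums. The
  orientation of the factors keeps them positive for s at most N, at the price of the leading
  coefficient (-1)^k.\<close>

definition top_poly :: "nat \<Rightarrow> nat \<Rightarrow> real poly" where
  "top_poly N k = (\<Prod>l<k. [:real (N + 1 + l) ^ 2, - 1:])"

lemma poly_lower_poly_Suc:
  "poly (lower_poly a (Suc i)) X = poly (lower_poly a i) X * (X - real (a + i + 1) ^ 2)"
proof -
  have "lower_poly a (Suc i) = lower_poly a i * [:- (real (a + i + 1) ^ 2), 1:]"
    by (simp only: lower_poly_def prod.lessThan_Suc add_ac)
  then show ?thesis by (simp only: poly_mult) (simp add: algebra_simps)
qed

lemma poly_top_poly_Suc:
  "poly (top_poly N (Suc k)) X = poly (top_poly N k) X * (real (N + k + 1) ^ 2 - X)"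
proof -
  have "top_poly N (Suc k) = top_poly N k * [:real (N + k + 1) ^ 2, - 1:]"
    by (simp only: top_poly_def prod.lessThan_Suc add_ac)
  then show ?thesis by (simp only: poly_mult) (simp add: algebra_simps)
qed

lemma degree_prod_linear:
  fixes c :: "nat \<Rightarrow> real"
  assumes "d \<noteq> 0"
  shows "degree (\<Prod>l<n. [:c l, d:]) = n" "coeff (\<Prod>l<n. [:c l, d:]) n = d ^ n"
proof -
  show deg: "degree (\<Prod>l<n. [:c l, d:]) = n"
    using assms by (subst degree_prod_eq_sum_degree) auto
  have "lead_coeff (\<Prod>l<n. [:c l, d:]) = d ^ n" using assms by (simp add: lead_coeff_prod)
  then show "coeff (\<Prod>l<n. [:c l, d:]) n = d ^ n" using deg by simp
qed

text \<open>Each factor raises the lower parameter by one. At s = a + i + 1, the one point where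
  \<open>racah_weight_lower\<close> does not apply, the factor itself is 0; so the range shrinks
  along with the parameter.\<close>

lemma sum_lower_poly:
  "(\<Sum>s\<in>{a<..g}. poly (lower_poly a i) (real s ^ 2) * h s * racah_weight a g N s) =
   (\<Sum>s\<in>{a + i<..g}. h s * racah_weight (a + i) g N s)"
proof (induction i arbitrary: h)
  case 0
  then show ?case by (simp add: lower_poly_def)
next
  case (Suc i)
  have "(\<Sum>s\<in>{a<..g}. poly (lower_poly a (Suc i)) (real s ^ 2) * h s * racah_weight a g N s) =
    (\<Sum>s\<in>{a<..g}. poly (lower_poly a i) (real s ^ 2) * ((real s ^ 2 - real (a + i + 1) ^ 2) * h s) * racah_weight a g N s)"
    by (intro sum.cong refl) (simp only: poly_lower_poly_Suc mult_ac)
  also have "\<dots> = (\<Sum>s\<in>{a + i<..g}. ((real s ^ 2 - real (a + i + 1) ^ 2) * h s) * racah_weight (a + i) g N s)"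
    by (rule Suc.IH)
  also have "\<dots> = (\<Sum>s\<in>{a + i + 1<..g}. h s * racah_weight (a + i + 1) g N s)"
  proof (rule sum.mono_neutral_cong_right)
    show "\<forall>s\<in>{a + i<..g} - {a + i + 1<..g}. (real s ^ 2 - real (a + i + 1) ^ 2) * h s * racah_weight (a + i) g N s = 0"
    proof
      fix s assume "s \<in> {a + i<..g} - {a + i + 1<..g}"
      then have "s = a + i + 1" by auto
      then show "(real s ^ 2 - real (a + i + 1) ^ 2) * h s * racah_weight (a + i) g N s = 0" by simp
    qed
    show "(real s ^ 2 - real (a + i + 1) ^ 2) * h s * racah_weight (a + i) g N s = h s * racah_weight (a + i + 1) g N s"
      if "s \<in> {a + i + 1<..g}" for s
      using that by (subst racah_weight_lower) (simp_all add: mult_ac)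
  qed auto
  finally show ?case by simp
qed

lemma racah_weight_top_poly:
  assumes "s \<le> N"
  shows "poly (top_poly N k) (real s ^ 2) * racah_weight a g N s = racah_weight a g (N + k) s"
proof (induction k)
  case 0
  then show ?case by (simp add: top_poly_def)
next
  case (Suc k)
  have "racah_weight a g (N + k + 1) s = (real (N + k + 1) ^ 2 - real s ^ 2) * racah_weight a g (N + k) s"
    by (rule racah_weight_top) (use assms in simp)
  then show ?case using Suc by (simp add: poly_top_poly_Suc mult_ac)
qed

lemma racah_moment:
  assumes "g \<le> N"
  shows "(\<Sum>s\<in>{a<..g}. poly (lower_poly a i) (real s ^ 2) * poly (top_poly N k) (real s ^ 2) * racah_weight a g N s) =
    racah_sum (a + i) g (N + k)"
  unfolding sum_lower_poly racah_sum_def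
  by (rule sum.cong[OF refl]) (use assms in \<open>simp add: racah_weight_top_poly\<close>)

lemma odd_fact_add: "odd_fact (n + m) = odd_fact n * (\<Prod>l<m. 2 * real (n + l) + 1)"
  by (induction m) (simp_all add: mult_ac)

lemma fact_add_prod: "(fact (n + m) :: real) = fact n * (\<Prod>l<m. real (n + 1 + l))"
  by (induction m) (simp_all add: mult_ac)

text \<open>The j-th diagonal entry of the triangular moment matrix. \<open>M\<close> is the number
  of positions east of the gap, later b + z, and the 2 in the denominator is that of
  \<open>racah_closed\<close>.\<close>

definition selberg_factor :: "nat \<Rightarrow> nat \<Rightarrow> nat \<Rightarrow> nat \<Rightarrow> nat \<Rightarrow> real" where
  "selberg_factor a x y M j = odd_fact (a + j + 1) * fact (M + j) * odd_fact (a + x + y + M + j + 1)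
     * fact (2 * a + x + y + M + 1 + j) * fact j * odd_fact (a + M + j + 1)
     / (2 * fact (x + y - 1 - j) * odd_fact (a + x + y - j) * odd_fact (a + M + 2 * j + 1) * odd_fact (a + M + 2 * j + 2))"

lemma racah_selberg:
  fixes a x y M :: nat
  defines "g \<equiv> a + x + y"
  defines "N \<equiv> g + M"
  shows "(\<Sum>S | S \<subseteq> {a<..g} \<and> card S = y. (\<Prod>s\<in>S. \<Prod>t\<in>S - {s}. \<bar>real s ^ 2 - real t ^ 2\<bar>)
      * (\<Prod>s\<in>S. racah_weight a g N s)) = (\<Prod>j<y. selberg_factor a x y M j)"
proof -
  define A where "A = a + N + 1"
  define b where "b = a + M + 1"
  define q where "q k = fact (M + k) * odd_fact (N + k + 1)" for k
  define r where "r i = odd_fact (a + i + 1) / (2 * fact (x + y - 1 - i) * odd_fact g)" for i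
  define \<theta> where "\<theta> j k = odd_fact (b + j + k) / fact (A + k)" for j k
  define e where "e i k = fact (A + i + k) / odd_fact (b + 1 + i + k)" for i k
  define \<psi> where "\<psi> j = smult (q j / \<theta> j j)
     (\<Sum>k\<le>j. smult ((- 1) ^ k * real (j choose k) * \<theta> j k / q k) (top_poly N k))" for j
  have q_nz: "q k \<noteq> 0" and \<theta>_nz: "\<theta> j k \<noteq> 0" for j k by (simp_all add: q_def \<theta>_def)
  \<comment> \<open>The coefficients of \<open>\<psi> j\<close> make the moments against \<open>lower_poly a i\<close> an alternating binomial sum of
    a polynomial of degree \<open>j - 1\<close> if \<open>i < j\<close>.\<close>
  have top: "degree (top_poly N k) = k" "coeff (top_poly N k) k = (- 1) ^ k" for k
    unfolding top_poly_def using degree_prod_linear[of "- 1"] by auto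
  have \<psi>1: "degree (\<psi> j) \<le> j" for j
    unfolding \<psi>_def
    by (intro order_trans[OF degree_smult_le] degree_sum_le) (use top in \<open>auto intro: order_trans[OF degree_smult_le]\<close>)
  \<comment> \<open>The sign (-1)^j of the last coefficient meets the leading coefficient (-1)^j of
    \<open>top_poly N j\<close>, so the normalisation needs no sign.\<close>
  have \<psi>2: "coeff (\<psi> j) j = 1" for j
  proof -
    have "coeff (\<Sum>k\<le>j. smult ((- 1) ^ k * real (j choose k) * \<theta> j k / q k) (top_poly N k)) j =
       (\<Sum>k\<le>j. (- 1) ^ k * real (j choose k) * \<theta> j k / q k * coeff (top_poly N k) j)"
      by (simp add: coeff_sum)
    also have "\<dots> = (- 1) ^ j * real (j choose j) * \<theta> j j / q j * coeff (top_poly N j) j"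
    proof -
      have "coeff (top_poly N k) j = 0" if "k < j" for k using that top(1)[of k] by (intro coeff_eq_0) simp
      then show ?thesis by (subst sum.remove[of _ j]) (auto intro!: sum.neutral)
    qed
    also have "\<dots> = \<theta> j j / q j" by (simp add: top(2) flip: power_mult_distrib)
    finally show ?thesis using q_nz \<theta>_nz by (simp add: \<psi>_def)
  qed
  have \<phi>: "degree (lower_poly a j) \<le> j" "coeff (lower_poly a j) j = 1" for j
    unfolding lower_poly_def using degree_prod_linear[of 1] by auto
  \<comment> \<open>The closed form is taken at t = x + y - 1 - i and d = M + k; i < y keeps the
    subtraction exact. Of the three resulting factors only \<open>e\<close> involves both
    indices.\<close>
  have moment: "racah_sum (a + i) g (N + k) = r i * q k * e i k" if "i < y" for i k
  proof -
    have 1: "g = a + i + 1 + (x + y - 1 - i)" "N + k = a + i + 1 + (x + y - 1 - i) + (M + k)"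
      using that by (auto simp: g_def N_def)
    have 2: "2 * (a + i) + (x + y - 1 - i) + (M + k) + 2 = A + i + k" "a + i + (x + y - 1 - i) + (M + k) + 2 = N + k + 1"
      "a + i + (x + y - 1 - i) + 1 = g" "a + i + (M + k) + 2 = b + 1 + i + k"
      using that by (auto simp: g_def N_def A_def b_def)
    have "racah_sum (a + i) g (N + k) = racah_closed (a + i) (x + y - 1 - i) (M + k)"
      unfolding 1(2) by (subst 1(1)) (rule racah_sum_closed)
    then show ?thesis unfolding racah_closed_def 2 by (simp add: r_def q_def e_def)
  qed
  define m where "m i j = (\<Sum>s\<in>{a<..g}. poly (lower_poly a i) (real s ^ 2) * poly (\<psi> j) (real s ^ 2) * racah_weight a g N s)" for i j
  have m: "m i j = q j / \<theta> j j * r i * (\<Sum>k\<le>j. (- 1) ^ k * real (j choose k) * (\<theta> j k * e i k))" if "i < y" for i j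
  proof -
    have "m i j = q j / \<theta> j j * (\<Sum>k\<le>j. (- 1) ^ k * real (j choose k) * \<theta> j k / q k *
       (\<Sum>s\<in>{a<..g}. poly (lower_poly a i) (real s ^ 2) * poly (top_poly N k) (real s ^ 2) * racah_weight a g N s))"
      unfolding m_def \<psi>_def sum_distrib_left
      by (subst sum.swap) (simp add: poly_sum sum_distrib_left sum_distrib_right mult_ac)
    also have "\<dots> = q j / \<theta> j j * (\<Sum>k\<le>j. (- 1) ^ k * real (j choose k) * \<theta> j k / q k * (r i * q k * e i k))"
      by (subst racah_moment) (simp_all add: N_def moment[OF that, unfolded N_def])
    also have "\<dots> = q j / \<theta> j j * r i * (\<Sum>k\<le>j. (- 1) ^ k * real (j choose k) * (\<theta> j k * e i k))"
      using q_nz by (simp add: sum_distrib_left mult_ac)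
    finally show ?thesis .
  qed
  have off: "m i j = 0" if ij: "i < j" "j < y" for i j
  proof -
    \<comment> \<open>The first product is the quotient of the two factorials, the second that of
      the two double factorials. The total degree is j - 1, which j differences annihilate.\<close>
    define P where "P = (\<Prod>l<i. [:real (A + 1 + l), 1:]) * (\<Prod>l<j - 1 - i. [:2 * real (b + 1 + i + l) + 1, 2:])"
    have "degree P \<le> i + (j - 1 - i)"
      unfolding P_def using degree_prod_linear(1)[of 1 "\<lambda>l. real (A + 1 + l)" i]
        degree_prod_linear(1)[of 2 "\<lambda>l. 2 * real (b + 1 + i + l) + 1" "j - 1 - i"]
      by (intro order_trans[OF degree_mult_le]) auto
    then have "degree P < j" using ij by linarith
    have "\<theta> j k * e i k = poly P (real k)" for k
    proof -
      have 1: "b + j + k = b + 1 + i + k + (j - 1 - i)" "A + i + k = A + k + i" using ij by auto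
      have "odd_fact (b + j + k) = odd_fact (b + 1 + i + k) * poly (\<Prod>l<j - 1 - i. [:2 * real (b + 1 + i + l) + 1, 2:]) (real k)"
        unfolding 1(1) odd_fact_add by (simp add: poly_prod algebra_simps)
      moreover have "fact (A + i + k) = fact (A + k) * poly (\<Prod>l<i. [:real (A + 1 + l), 1:]) (real k)"
        unfolding 1(2) fact_add_prod by (simp add: poly_prod algebra_simps)
      ultimately show ?thesis unfolding \<theta>_def e_def P_def poly_mult by simp
    qed
    then show ?thesis using m[of i j] ij alternating_sum_poly[OF \<open>degree P < j\<close>] by simp
  qed
  have diag: "m j j = selberg_factor a x y M j" if j: "j < y" for j
  proof -
    define P where "P = (\<Prod>l<j. [:real (A + 1 + l), 1:])"
    \<comment> \<open>On the diagonal the double factorials differ by one factor, 2(b + j + k) + 1 =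
      2(c + k), in the denominator. This is the simple fraction of
      \<open>alternating_sum_frac\<close>.\<close>
    define c where "c = (2 * real (b + j) + 1) / 2"
    have c: "c > 0" by (simp add: c_def add_nonneg_pos)
    have "degree P \<le> j" unfolding P_def using degree_prod_linear(1)[of 1 "\<lambda>l. real (A + 1 + l)" j] by simp
    note frac = alternating_sum_frac[OF c this]
    have "\<theta> j k * e j k = 1 / 2 * (poly P (real k) / (c + real k))" for k
    proof -
      have 1: "A + j + k = A + k + j" "b + 1 + j + k = Suc (b + j + k)" by auto
      have "fact (A + j + k) = fact (A + k) * poly P (real k)"
        unfolding 1(1) fact_add_prod P_def by (simp add: poly_prod algebra_simps)
      moreover have "odd_fact (b + 1 + j + k) = odd_fact (b + j + k) * (2 * (c + real k))"
        unfolding 1(2) odd_fact_Suc by (simp add: c_def algebra_simps)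
      ultimately show ?thesis unfolding \<theta>_def e_def by simp
    qed
    then have "(\<Sum>k\<le>j. (- 1) ^ k * real (j choose k) * (\<theta> j k * e j k)) =
       1 / 2 * (\<Sum>k\<le>j. (- 1) ^ k * real (j choose k) * (poly P (real k) / (c + real k)))"
      by (simp add: sum_distrib_left mult_ac)
    also have "\<dots> = 1 / 2 * (poly P (- c) * fact j / pochhammer c (Suc j))" unfolding frac ..
    \<comment> \<open>As A - b = a + x + y = g, the value A + 1 + l - c equals half the odd number
      2(g - j + l) + 1.\<close>
    also have "poly P (- c) = odd_fact g / odd_fact (g - j) / 2 ^ j"
    proof -
      have "odd_fact g = odd_fact (g - j) * (\<Prod>l<j. 2 * real (g - j + l) + 1)"
        using odd_fact_add[of "g - j" j] j by (simp add: g_def)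
      moreover have "poly P (- c) = (\<Prod>l<j. (2 * real (g - j + l) + 1) / 2)"
        unfolding P_def poly_prod using j
        by (intro prod.cong refl) (simp add: c_def A_def N_def b_def g_def of_nat_diff field_simps)
      ultimately show ?thesis by (simp add: prod_dividef)
    qed
    also have "pochhammer c (Suc j) = odd_fact (b + 2 * j + 1) / odd_fact (b + j) / 2 ^ Suc j"
    proof -
      have "odd_fact (b + 2 * j + 1) = odd_fact (b + j) * (\<Prod>l<Suc j. 2 * real (b + j + l) + 1)"
      proof -
        have "b + 2 * j + 1 = b + j + Suc j" by simp
        then show ?thesis by (simp only: odd_fact_add)
      qed
      moreover have "pochhammer c (Suc j) = (\<Prod>l<Suc j. (2 * real (b + j + l) + 1) / 2)"
        unfolding pochhammer_prod atLeast0LessThan by (intro prod.cong refl) (simp add: c_def field_simps)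
      ultimately show ?thesis by (simp add: prod_dividef del: prod.lessThan_Suc odd_fact_Suc)
    qed
    finally have sum: "(\<Sum>k\<le>j. (- 1) ^ k * real (j choose k) * (\<theta> j k * e j k)) =
       odd_fact g * fact j * odd_fact (b + j) / (odd_fact (g - j) * odd_fact (b + 2 * j + 1))"
      by (simp add: field_simps)
    have idx: "b + j = a + M + j + 1" "a + M + j + 1 + j = a + M + 2 * j + 1" "b + 2 * j + 1 = a + M + 2 * j + 2"
      "A + j = 2 * a + x + y + M + 1 + j" "N + j + 1 = a + x + y + M + j + 1"
      by (auto simp: b_def A_def N_def g_def)
    have alg: "f2 * o3 / (o4 / f5) * (o1 / (2 * f1 * og)) * (og * fj * ob / (ogj * o5)) =
       o1 * f2 * o3 * f5 * fj * ob / (2 * f1 * ogj * o4 * o5)" if "og \<noteq> 0"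
      for f1 f2 f5 fj o1 o3 o4 o5 ob og ogj :: real
      using that by (simp add: mult_ac)
    show ?thesis
      unfolding m[OF j] sum unfolding selberg_factor_def q_def r_def \<theta>_def unfolding idx unfolding g_def by (rule alg) simp
  qed
  let ?mat = "mat y y (\<lambda>(i, j). m i j)"
  have "det ?mat = prod_list (diag_mat ?mat)"
    by (rule det_lower_triangular[where n = y]) (use off in auto)
  also have "\<dots> = (\<Prod>j<y. selberg_factor a x y M j)"
    unfolding prod_list_diag_prod by (simp add: diag atLeast0LessThan)
  finally have det: "det ?mat = (\<Prod>j<y. selberg_factor a x y M j)" .
  show ?thesis
    using sum_subsets_eq_det[where G = "{a<..g}" and \<phi> = "lower_poly a" and \<psi> = \<psi> and n = y
        and x = "\<lambda>s. real s ^ 2" and w = "racah_weight a g N"] \<phi> \<psi>1 \<psi>2 det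
    by (simp add: m_def)
qed

section \<open>The product functions\<close>

lemma H_quotient: "H (p + y) = H p * (\<Prod>i<y. fact (p + i))"
  by (induction y) (simp_all add: H_def mult_ac)

lemma H_pos [simp]: "H n > 0"
  by (auto simp: H_def intro!: prod_pos)

lemma H_nonzero [simp]: "H n \<noteq> 0"
  using H_pos[of n] by linarith

text \<open>At odd arguments \<open>H2\<close> is the denominator of the symplectic Weyl formula,
  which is how it enters the tiling counts.\<close>

lemma H2_odd: "H2 (2 * n + 1) = (\<Prod>i<n. fact (2 * i + 1))"
proof -
  have "H2 (2 * n + 1) = (\<Prod>i=1..n. fact (2 * n + 1 - 2 * i))" by (simp add: H2_def)
  also have "\<dots> = (\<Prod>i<n. fact (2 * i + 1))"
    by (rule prod.reindex_bij_witness[of _ "\<lambda>i. n - i" "\<lambda>i. n - i"]) (auto simp del: fact_Suc intro!: arg_cong[where f = fact])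
  finally show ?thesis .
qed

lemma skip_pochhammer_odd: "skip_pochhammer (2 * real p + 1) n = odd_fact (p + n) / odd_fact p"
  unfolding skip_pochhammer_def odd_fact_add by (simp add: algebra_simps)

lemma Vprod_odd:
  assumes "2 * y \<le> M + 1"
  shows "Vprod (2 * real p + 1) (int M) y = (\<Prod>i<y. odd_fact (p + M - i) / odd_fact (p + i))"
  unfolding Vprod_def
proof (rule prod.cong[OF refl])
  fix i assume i: "i \<in> {..<y}"
  have "2 * real p + 1 + 2 * real i = 2 * real (p + i) + 1" by simp
  moreover have "nat (int M - 2 * int i) = M - 2 * i" by auto
  moreover have "p + i + (M - 2 * i) = p + M - i" using i assms by auto
  ultimately show "skip_pochhammer (2 * real p + 1 + 2 * real i) (nat (int M - 2 * int i)) =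
      odd_fact (p + M - i) / odd_fact (p + i)" by (simp only: skip_pochhammer_odd)
qed

lemma Tprod_fact:
  assumes "2 * y \<le> n + 1"
  shows "Tprod (real x + 1) (int n) y = (\<Prod>i<y. fact (x + n - i) / fact (x + i))"
  unfolding Tprod_def
proof (rule prod.cong[OF refl])
  fix i assume i: "i \<in> {..<y}"
  have poch: "pochhammer (real p + 1) m = fact (p + m) / fact p" for p m
    unfolding fact_add_prod pochhammer_prod by (simp add: atLeast0LessThan add_ac)
  have "real x + 1 + real i = real (x + i) + 1" by simp
  moreover have "nat (int n - 2 * int i) = n - 2 * i" by auto
  moreover have "x + i + (n - 2 * i) = x + n - i" using i assms by auto
  ultimately show "pochhammer (real x + 1 + real i) (nat (int n - 2 * int i)) = fact (x + n - i) / fact (x + i)"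
    by (simp only: poch)
qed

lemma prod_rev: "(\<Prod>j<y. f (y - 1 - j)) = (\<Prod>i<y. (f i :: real))" for y :: nat
  by (rule prod.reindex_bij_witness[of _ "\<lambda>i. y - 1 - i" "\<lambda>i. y - 1 - i"]) auto

text \<open>Both sides run over 0, ..., 2y - 1, once in two halves and once in consecutive pairs. It
  trades the pair of double factorials in the denominator of \<open>selberg_factor\<close> for one
  run that cancels and one run that belongs to V.\<close>

lemma prod_pairs:
  fixes f :: "nat \<Rightarrow> real"
  shows "(\<Prod>j<y. f j) * (\<Prod>i<y. f (2 * y - 1 - i)) = (\<Prod>j<y. f (2 * j) * f (2 * j + 1))"
proof -
  have "(\<Prod>j<y. f (2 * j) * f (2 * j + 1)) = (\<Prod>k<2 * y. f k)"
    by (induction y) (simp_all add: mult_ac)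
  also have "{..<2 * y} = {..<y} \<union> {y..<2 * y}" by auto
  also have "(\<Prod>k\<in>{..<y} \<union> {y..<2 * y}. f k) = (\<Prod>k<y. f k) * (\<Prod>k\<in>{y..<2 * y}. f k)"
    by (rule prod.union_disjoint) auto
  also have "(\<Prod>k\<in>{y..<2 * y}. f k) = (\<Prod>i<y. f (2 * y - 1 - i))"
    by (rule prod.reindex_bij_witness[of _ "\<lambda>i. 2 * y - 1 - i" "\<lambda>i. 2 * y - 1 - i"]) auto
  finally show ?thesis by simp
qed

text \<open>The constant of the theorem; b and z enter it only through M = b + z.\<close>

definition TV_ratio :: "nat \<Rightarrow> nat \<Rightarrow> nat \<Rightarrow> nat \<Rightarrow> real" where
  "TV_ratio a x y M =
     (Tprod (real x + 1) (int (2 * a + M + 2 * y)) y * Vprod (real (2 * x + 2 * a + 3)) (int (M + 2 * y) - 1) y)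
     / (Tprod 1 (int (2 * a + M + 2 * y)) y * Vprod (real (2 * a + 3)) (int (M + 2 * y) - 1) y)"

lemma TV_ratio_eq:
  "TV_ratio a x y M = (\<Prod>i<y. fact (x + (2 * a + M + 2 * y) - i) * fact i * odd_fact (x + a + M + 2 * y - i) * odd_fact (a + 1 + i)
     / (fact (2 * a + M + 2 * y - i) * fact (x + i) * odd_fact (a + M + 2 * y - i) * odd_fact (x + a + 1 + i)))"
\<comment> \<open>For y = 0 the length M + 2y - 1 can be -1, but then all products are empty;
  otherwise it is a natural number.\<close>
proof (cases "y = 0")
  case True
  then show ?thesis by (simp add: TV_ratio_def Tprod_def Vprod_def)
next
  case False
  have V: "Vprod (real (2 * x + 2 * a + 3)) (int (M + 2 * y) - 1) y =
     (\<Prod>i<y. odd_fact (x + a + M + 2 * y - i) / odd_fact (x + a + 1 + i))" for x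
  proof -
    have e: "int (M + 2 * y) - 1 = int (M + 2 * y - 1)" "real (2 * x + 2 * a + 3) = 2 * real (x + a + 1) + 1"
      "x + a + 1 + (M + 2 * y - 1) = x + a + M + 2 * y" using False by auto
    have "Vprod (2 * real (x + a + 1) + 1) (int (M + 2 * y - 1)) y =
       (\<Prod>i<y. odd_fact (x + a + 1 + (M + 2 * y - 1) - i) / odd_fact (x + a + 1 + i))"
      by (rule Vprod_odd) simp
    then show ?thesis unfolding e .
  qed
  have T: "Tprod (real x + 1) (int (2 * a + M + 2 * y)) y = (\<Prod>i<y. fact (x + (2 * a + M + 2 * y) - i) / fact (x + i))" for x
    by (rule Tprod_fact) simp
  show ?thesis
    unfolding TV_ratio_def V T using V[of 0] T[of 0]
    by (simp add: mult_ac flip: prod_dividef prod.distrib)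
qed

text \<open>Every factor contributes 1/2. Since \<open>TV_ratio\<close> is 1 at x = 0, the power of
  2 and the quotient of values of \<open>H\<close> are the value at x = 0, and
  \<open>TV_ratio\<close> measures the change with x.\<close>

lemma prod_selberg_factor:
  "(\<Prod>j<y. selberg_factor a x y M j) = 2 powi (- int y) *
     (H (2 * a + M + 2 * y + 1) * H (M + y) / (H (2 * a + M + y + 1) * H M)) * TV_ratio a x y M"
proof -
  have H: "H (2 * a + M + 2 * y + 1) * H (M + y) / (H (2 * a + M + y + 1) * H M) =
    (\<Prod>i<y. fact (2 * a + M + 2 * y - i)) * (\<Prod>i<y. fact (M + i))"
  proof -
    have e: "2 * a + M + 2 * y + 1 = 2 * a + M + y + 1 + y" by simp
    have "(\<Prod>i<y. fact (2 * a + M + y + 1 + i)) = (\<Prod>j<y. fact (2 * a + M + y + 1 + (y - 1 - j)) :: real)"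
      by (rule prod_rev[symmetric])
    also have "\<dots> = (\<Prod>i<y. fact (2 * a + M + 2 * y - i))"
      by (intro prod.cong refl arg_cong[where f = fact]) auto
    finally have "(\<Prod>i<y. fact (2 * a + M + y + 1 + i)) = (\<Prod>i<y. fact (2 * a + M + 2 * y - i) :: real)" .
    then show ?thesis unfolding e H_quotient
      by (simp del: fact_Suc)
  qed
  have pow: "2 powi (- int y) = (1 / 2 :: real) ^ y" by (simp add: power_int_minus power_divide inverse_eq_divide)
  define e where "e = a + M + 1"
  have pairs: "(\<Prod>j<y. odd_fact (e + j)) * (\<Prod>i<y. odd_fact (a + M + 2 * y - i)) =
     (\<Prod>j<y. odd_fact (a + M + 2 * j + 1) * odd_fact (a + M + 2 * j + 2))"
  proof -
    have "(\<Prod>i<y. odd_fact (a + M + 2 * y - i)) = (\<Prod>i<y. odd_fact (e + (2 * y - 1 - i)))"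
      by (intro prod.cong refl arg_cong[where f = odd_fact]) (auto simp: e_def)
    then show ?thesis using prod_pairs[of "\<lambda>k. odd_fact (e + k)" y] by (simp add: e_def add_ac)
  qed
  have R1: "(\<Prod>j<y. odd_fact (a + x + y + M + j + 1)) = (\<Prod>i<y. odd_fact (x + a + M + 2 * y - i))"
    by (subst prod_rev[symmetric], intro prod.cong refl arg_cong[where f = odd_fact]) auto
  have R2: "(\<Prod>j<y. fact (2 * a + x + y + M + 1 + j)) = (\<Prod>i<y. fact (x + (2 * a + M + 2 * y) - i) :: real)"
    by (subst prod_rev[symmetric], intro prod.cong refl arg_cong[where f = fact]) auto
  have R3: "(\<Prod>j<y. fact (x + y - 1 - j)) = (\<Prod>i<y. fact (x + i) :: real)"
    by (subst prod_rev[symmetric], intro prod.cong refl arg_cong[where f = fact]) auto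
  have R4: "(\<Prod>j<y. odd_fact (a + x + y - j)) = (\<Prod>i<y. odd_fact (x + a + 1 + i))"
    by (subst prod_rev[symmetric], intro prod.cong refl arg_cong[where f = odd_fact]) auto
  have R5: "(\<Prod>j<y. odd_fact (a + j + 1)) = (\<Prod>i<y. odd_fact (a + 1 + i))" by simp
  have R6: "(\<Prod>j<y. odd_fact (a + M + j + 1)) = (\<Prod>j<y. odd_fact (e + j))"
    by (simp add: e_def add_ac)
  define p1 p2 p3 p4 p5 p6 p7 p8 p9 p10 where p: "p1 = (\<Prod>i<y. odd_fact (a + 1 + i))"
    "p2 = (\<Prod>i<y. fact (M + i) :: real)" "p3 = (\<Prod>i<y. odd_fact (x + a + M + 2 * y - i))"
    "p4 = (\<Prod>i<y. fact (x + (2 * a + M + 2 * y) - i) :: real)" "p5 = (\<Prod>i<y. fact i :: real)"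
    "p6 = (\<Prod>j<y. odd_fact (e + j))" "p7 = (\<Prod>i<y. fact (x + i) :: real)"
    "p8 = (\<Prod>i<y. odd_fact (x + a + 1 + i))" "p9 = (\<Prod>i<y. odd_fact (a + M + 2 * y - i))"
    "p10 = (\<Prod>i<y. fact (2 * a + M + 2 * y - i) :: real)"
  have nz: "p6 \<noteq> 0" "p7 \<noteq> 0" "p8 \<noteq> 0" "p9 \<noteq> 0" "p10 \<noteq> 0" unfolding p by simp_all
  have "(\<Prod>j<y. selberg_factor a x y M j) = (\<Prod>j<y. odd_fact (a + j + 1)) * (\<Prod>j<y. fact (M + j))
     * (\<Prod>j<y. odd_fact (a + x + y + M + j + 1)) * (\<Prod>j<y. fact (2 * a + x + y + M + 1 + j)) * (\<Prod>j<y. fact j)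
     * (\<Prod>j<y. odd_fact (a + M + j + 1)) / (2 ^ y * (\<Prod>j<y. fact (x + y - 1 - j)) * (\<Prod>j<y. odd_fact (a + x + y - j))
     * (\<Prod>j<y. odd_fact (a + M + 2 * j + 1) * odd_fact (a + M + 2 * j + 2)))"
    unfolding selberg_factor_def prod_dividef prod.distrib by (simp add: mult_ac)
  also have "\<dots> = p1 * p2 * p3 * p4 * p5 * p6 / (2 ^ y * p7 * p8 * (p6 * p9))"
    unfolding pairs[symmetric] R1 R2 R3 R4 R5 R6 p ..
  also have "\<dots> = (1 / 2) ^ y * (p10 * p2) * (p4 * p5 * p3 * p1 / (p10 * p7 * p9 * p8))"
    using nz by (simp add: field_simps power_divide)
  also have "\<dots> = 2 powi (- int y) * (H (2 * a + M + 2 * y + 1) * H (M + y) / (H (2 * a + M + y + 1) * H M)) * TV_ratio a x y M"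
    unfolding H pow TV_ratio_eq prod_dividef prod.distrib p ..
  finally show ?thesis .
qed

lemma TV_ratio_0: "TV_ratio a 0 y M = 1"
proof -
  have "TV_ratio a 0 y M = (\<Prod>i<y. 1)" unfolding TV_ratio_eq by (rule prod.cong) simp_all
  then show ?thesis by simp
qed

section \<open>Perfect matchings\<close>

text \<open>Tilings are perfect matchings of the dual graph, here given by the set \<open>E\<close>
  of its edges. Abstract vertices separate the counting arguments from the geometry.\<close>

definition perfect_matchings :: "'v set set \<Rightarrow> 'v set \<Rightarrow> 'v set set set" where
  "perfect_matchings E R = {D. partition_on R D \<and> D \<subseteq> E}"

lemma num_tilings_eq: "num_tilings R = card (perfect_matchings {d. is_lozenge d} R)"
  unfolding num_tilings_def perfect_matchings_def is_tiling_def
  by (rule arg_cong[where f = card]) auto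

lemma finite_perfect_matchings:
  assumes "finite R" shows "finite (perfect_matchings E R)"
proof (rule finite_subset)
  show "perfect_matchings E R \<subseteq> Pow (Pow R)"
    unfolding perfect_matchings_def partition_on_def by auto
qed (use assms in auto)

lemma partition_on_remove:
  assumes "partition_on R D" "d \<in> D"
  shows "partition_on (R - d) (D - {d})"
proof (rule partition_onI)
  show "\<Union>(D - {d}) = R - d"
    using assms by (force simp: partition_on_def disjoint_def)
  show "disjnt p q" if "p \<in> D - {d}" "q \<in> D - {d}" "p \<noteq> q" for p q
    using assms that by (auto simp: partition_on_def disjoint_def disjnt_def)
  show "{} \<notin> D - {d}" using assms by (auto simp: partition_on_def)
qed

lemma partition_on_add:
  assumes "partition_on (R - d) D" "d \<subseteq> R" "d \<noteq> {}"
  shows "partition_on R (insert d D)"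
proof (rule partition_onI)
  have D: "\<Union>D = R - d" using assms by (auto simp: partition_on_def)
  show "\<Union>(insert d D) = R" using D assms by auto
  show "disjnt p q" if "p \<in> insert d D" "q \<in> insert d D" "p \<noteq> q" for p q
  proof -
    have "disjnt p q" if "p \<in> D" "q \<in> D"
      using assms that \<open>p \<noteq> q\<close> by (auto simp: partition_on_def disjoint_def disjnt_def)
    moreover have "disjnt r d" if "r \<in> D" for r using D that by (auto simp: disjnt_def)
    ultimately show ?thesis using that by (auto simp: disjnt_sym)
  qed
  show "{} \<notin> insert d D" using assms by (auto simp: partition_on_def)
qed

lemma card_perfect_matchings_expand:
  assumes fin: "finite R" and v: "v \<in> R"
    and E: "\<And>e. e \<in> E \<Longrightarrow> v \<in> e \<Longrightarrow> \<exists>w. w \<noteq> v \<and> e = {v, w}"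
  shows "card (perfect_matchings E R) =
    (\<Sum>w\<in>{w\<in>R. w \<noteq> v \<and> {v, w} \<in> E}. card (perfect_matchings E (R - {v, w})))"
proof -
  let ?W = "{w\<in>R. w \<noteq> v \<and> {v, w} \<in> E}"
  let ?A = "\<lambda>w. insert {v, w} ` perfect_matchings E (R - {v, w})"
  have "perfect_matchings E R = (\<Union>w\<in>?W. ?A w)"
  proof (intro equalityI subsetI)
    fix D assume D: "D \<in> perfect_matchings E R"
    then have p: "partition_on R D" and DE: "D \<subseteq> E" by (auto simp: perfect_matchings_def)
    obtain d where d: "d \<in> D" "v \<in> d" using p v by (auto simp: partition_on_def)
    obtain w where w: "w \<noteq> v" "d = {v, w}" using E d DE by blast
    have wR: "w \<in> R" using p d w by (auto simp: partition_on_def)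
    have "D - {d} \<in> perfect_matchings E (R - {v, w})"
      using partition_on_remove[OF p d(1)] DE w by (auto simp: perfect_matchings_def)
    moreover have "D = insert {v, w} (D - {d})" using d w by auto
    ultimately have "D \<in> ?A w" by blast
    moreover have "w \<in> ?W" using w wR d DE by auto
    ultimately show "D \<in> (\<Union>w\<in>?W. ?A w)" by blast
  next
    fix D assume "D \<in> (\<Union>w\<in>?W. ?A w)"
    then obtain w D' where w: "w \<in> R" "w \<noteq> v" "{v, w} \<in> E"
      and D': "D' \<in> perfect_matchings E (R - {v, w})" "D = insert {v, w} D'" by blast
    then show "D \<in> perfect_matchings E R"
      using partition_on_add[of R "{v, w}" D'] v by (auto simp: perfect_matchings_def)
  qed
  moreover have "card (\<Union>w\<in>?W. ?A w) = (\<Sum>w\<in>?W. card (?A w))"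
  proof (rule card_UN_disjoint)
    show "finite ?W" using fin by auto
    show "\<forall>w\<in>?W. finite (?A w)" using fin finite_perfect_matchings by blast
    show "\<forall>w\<in>?W. \<forall>w'\<in>?W. w \<noteq> w' \<longrightarrow> ?A w \<inter> ?A w' = {}"
    proof (intro ballI impI)
      fix w w' assume w: "w \<in> ?W" "w' \<in> ?W" "w \<noteq> w'"
      show "?A w \<inter> ?A w' = {}"
      proof (rule ccontr)
        assume "?A w \<inter> ?A w' \<noteq> {}"
        then obtain D1 D2 where D: "D1 \<in> perfect_matchings E (R - {v, w})"
          "D2 \<in> perfect_matchings E (R - {v, w'})" "insert {v, w} D1 = insert {v, w'} D2"
          by blast
        have "{v, w} \<in> insert {v, w'} D2" using D(3) by blast
        then have "{v, w} \<in> D2" using w by (simp add: doubleton_eq_iff)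
        moreover have "\<Union>D2 = R - {v, w'}"
          using D(2) by (simp add: perfect_matchings_def partition_on_def)
        ultimately show False by blast
      qed
    qed
  qed
  moreover have "card (?A w) = card (perfect_matchings E (R - {v, w}))" for w
  proof (rule card_image, rule inj_onI)
    fix D1 D2 assume D: "D1 \<in> perfect_matchings E (R - {v, w})"
      "D2 \<in> perfect_matchings E (R - {v, w})" "insert {v, w} D1 = insert {v, w} D2"
    have "\<Union>D1 = R - {v, w}" "\<Union>D2 = R - {v, w}"
      using D by (simp_all add: perfect_matchings_def partition_on_def)
    then have "{v, w} \<notin> D1" "{v, w} \<notin> D2" by blast+
    then show "D1 = D2" using D(3) by (metis insert_ident)
  qed
  ultimately show ?thesis by simp
qed

text \<open>A matching amounts to the set of crossing edges it uses together with matchings of the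
  two sides without the vertices these edges cover. Disjointness of \<open>C\<close> lets every
  subset of it occur.\<close>

lemma card_perfect_matchings_cut:
  assumes fin: "finite A" "finite B" and AB: "A \<inter> B = {}" and ne: "{} \<notin> E"
    and C: "C \<subseteq> E" "disjoint C" "\<And>e. e \<in> C \<Longrightarrow> e \<subseteq> A \<union> B \<and> e \<inter> A \<noteq> {} \<and> e \<inter> B \<noteq> {}"
    and E: "\<And>e. e \<in> E \<Longrightarrow> e \<subseteq> A \<union> B \<Longrightarrow> e \<subseteq> A \<or> e \<subseteq> B \<or> e \<in> C"
  shows "card (perfect_matchings E (A \<union> B)) =
    (\<Sum>S\<in>Pow C. card (perfect_matchings E (A - \<Union>S)) * card (perfect_matchings E (B - \<Union>S)))"
proof -
  let ?P = "\<lambda>S. perfect_matchings E (A - \<Union>S) \<times> perfect_matchings E (B - \<Union>S)"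
  have finC: "finite C"
    by (rule finite_subset[of _ "Pow (A \<union> B)"]) (use C(3) fin in auto)
  have key: "bij_betw (\<lambda>(S, D1, D2). S \<union> D1 \<union> D2) (Sigma (Pow C) ?P)
     (perfect_matchings E (A \<union> B))"
  proof (rule bij_betw_byWitness[where f' = "\<lambda>D. (D \<inter> C, {d\<in>D. d \<subseteq> A}, {d\<in>D. d \<subseteq> B})"])
    show "\<forall>p\<in>Sigma (Pow C) ?P. (\<lambda>D. (D \<inter> C, {d\<in>D. d \<subseteq> A}, {d\<in>D. d \<subseteq> B}))
        ((\<lambda>(S, D1, D2). S \<union> D1 \<union> D2) p) = p"
    proof
      fix p assume "p \<in> Sigma (Pow C) ?P"
      then obtain S D1 D2 where p: "p = (S, D1, D2)" "S \<subseteq> C" "D1 \<in> perfect_matchings E (A - \<Union>S)"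
        "D2 \<in> perfect_matchings E (B - \<Union>S)" by auto
      have 1: "\<And>d. d \<in> D1 \<Longrightarrow> d \<subseteq> A \<and> d \<noteq> {}" "\<And>d. d \<in> D2 \<Longrightarrow> d \<subseteq> B \<and> d \<noteq> {}"
        using p unfolding perfect_matchings_def partition_on_def by auto
      have 2: "\<not> d \<subseteq> A" "\<not> d \<subseteq> B" if "d \<in> C" for d
        using C(3)[OF that] AB by auto
      have 3: "d \<subseteq> A \<Longrightarrow> d \<subseteq> B \<Longrightarrow> d = {}" for d using AB by blast
      have S: "\<And>d. d \<in> S \<Longrightarrow> d \<in> C \<and> \<not> d \<subseteq> A \<and> \<not> d \<subseteq> B" using p(2) 2 by blast
      have D1: "\<And>d. d \<in> D1 \<Longrightarrow> d \<notin> C \<and> d \<subseteq> A \<and> \<not> d \<subseteq> B" using 1(1) 2(1) 3 by blast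
      have D2: "\<And>d. d \<in> D2 \<Longrightarrow> d \<notin> C \<and> d \<subseteq> B \<and> \<not> d \<subseteq> A" using 1(2) 2(2) 3 by blast
      have "(S \<union> D1 \<union> D2) \<inter> C = S"
        by (intro Set.set_eqI) (metis S D1 D2 Int_iff Un_iff)
      moreover have "{d \<in> S \<union> D1 \<union> D2. d \<subseteq> A} = D1"
        by (intro Set.set_eqI) (metis (no_types, lifting) S D1 D2 mem_Collect_eq Un_iff)
      moreover have "{d \<in> S \<union> D1 \<union> D2. d \<subseteq> B} = D2"
        by (intro Set.set_eqI) (metis (no_types, lifting) S D1 D2 mem_Collect_eq Un_iff)
      ultimately show "(\<lambda>D. (D \<inter> C, {d\<in>D. d \<subseteq> A}, {d\<in>D. d \<subseteq> B}))
        ((\<lambda>(S, D1, D2). S \<union> D1 \<union> D2) p) = p" using p(1) by simp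
    qed
    have DE: "d \<subseteq> A \<or> d \<subseteq> B \<or> d \<in> C" if "D \<in> perfect_matchings E (A \<union> B)" "d \<in> D" for D d
    proof (rule E)
      show "d \<in> E" "d \<subseteq> A \<union> B" using that by (auto simp: perfect_matchings_def partition_on_def)
    qed
    show "\<forall>D\<in>perfect_matchings E (A \<union> B). (\<lambda>(S, D1, D2). S \<union> D1 \<union> D2)
        (D \<inter> C, {d\<in>D. d \<subseteq> A}, {d\<in>D. d \<subseteq> B}) = D"
      using DE by auto
    show "(\<lambda>(S, D1, D2). S \<union> D1 \<union> D2) ` Sigma (Pow C) ?P \<subseteq> perfect_matchings E (A \<union> B)"
    proof
      fix D assume "D \<in> (\<lambda>(S, D1, D2). S \<union> D1 \<union> D2) ` Sigma (Pow C) ?P"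
      then obtain S D1 D2 where p: "D = S \<union> D1 \<union> D2" "S \<subseteq> C" "D1 \<in> perfect_matchings E (A - \<Union>S)"
        "D2 \<in> perfect_matchings E (B - \<Union>S)" by auto
      have U1: "\<Union>D1 = A - \<Union>S" "\<Union>D2 = B - \<Union>S" and d1: "disjoint D1" "disjoint D2" "{} \<notin> D1" "{} \<notin> D2"
         and sub: "D1 \<subseteq> E" "D2 \<subseteq> E"
        using p unfolding perfect_matchings_def partition_on_def by auto
      have US: "\<Union>S \<subseteq> A \<union> B" using C(3) p(2) by blast
      have dS: "disjoint S" using C(2) p(2) unfolding disjoint_def by blast
      have "disjoint (S \<union> D1)"
        by (rule disjoint_union[OF dS d1(1)]) (use U1 in auto)
      then have "disjoint (S \<union> D1 \<union> D2)"
        by (rule disjoint_union[OF _ d1(2)]) (use U1 AB in auto)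
      moreover have "\<Union>(S \<union> D1 \<union> D2) = A \<union> B" using U1 US by auto
      moreover have "{} \<notin> S \<union> D1 \<union> D2" using d1 ne C(1) p(2) by blast
      moreover have "S \<union> D1 \<union> D2 \<subseteq> E" using sub p(2) C(1) by blast
      ultimately show "D \<in> perfect_matchings E (A \<union> B)"
        using p(1) by (auto simp: perfect_matchings_def partition_on_def)
    qed
    show "(\<lambda>D. (D \<inter> C, {d\<in>D. d \<subseteq> A}, {d\<in>D. d \<subseteq> B})) ` perfect_matchings E (A \<union> B)
       \<subseteq> Sigma (Pow C) ?P"
    proof
      fix p assume "p \<in> (\<lambda>D. (D \<inter> C, {d\<in>D. d \<subseteq> A}, {d\<in>D. d \<subseteq> B})) ` perfect_matchings E (A \<union> B)"
      then obtain D where D: "D \<in> perfect_matchings E (A \<union> B)"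
        and p: "p = (D \<inter> C, {d\<in>D. d \<subseteq> A}, {d\<in>D. d \<subseteq> B})" by auto
      have U: "\<Union>D = A \<union> B" and dj: "disjoint D" and sub: "D \<subseteq> E" and nD: "{} \<notin> D"
        using D unfolding perfect_matchings_def partition_on_def by auto
      have part: "{d\<in>D. d \<subseteq> X} \<in> perfect_matchings E (X - \<Union>(D \<inter> C))"
        if X: "X = A \<and> Y = B \<or> X = B \<and> Y = A" for X Y
      proof -
        have nC: "\<not> d \<subseteq> X" if "d \<in> C" for d using C(3)[OF that] AB X by auto
        have "\<Union>{d\<in>D. d \<subseteq> X} = X - \<Union>(D \<inter> C)"
        proof (intro equalityI subsetI)
          fix v assume "v \<in> \<Union>{d\<in>D. d \<subseteq> X}"
          then obtain d where d: "d \<in> D" "d \<subseteq> X" "v \<in> d" by auto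
          have "v \<notin> e" if "e \<in> D \<inter> C" for e
          proof -
            have "e \<noteq> d" using nC that d by auto
            then show ?thesis using dj d that unfolding disjoint_def by blast
          qed
          then show "v \<in> X - \<Union>(D \<inter> C)" using d by blast
        next
          fix v assume v: "v \<in> X - \<Union>(D \<inter> C)"
          then have "v \<in> \<Union>D" using U X by auto
          then obtain d where d: "d \<in> D" "v \<in> d" by auto
          then have "d \<notin> C" using v by auto
          then have "d \<subseteq> X" using DE[OF D d(1)] d(2) v X AB by auto
          then show "v \<in> \<Union>{d\<in>D. d \<subseteq> X}" using d by auto
        qed
        moreover have "disjoint {d\<in>D. d \<subseteq> X}" using dj unfolding disjoint_def by auto
        ultimately show ?thesis using sub nD
          by (auto simp: perfect_matchings_def partition_on_def)
      qed
      show "p \<in> Sigma (Pow C) ?P" using p part[of A B] part[of B A] by auto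
    qed
  qed
  have "card (perfect_matchings E (A \<union> B)) = card (Sigma (Pow C) ?P)"
    using bij_betw_same_card[OF key] by simp
  also have "\<dots> = (\<Sum>S\<in>Pow C. card (?P S))"
    by (rule card_SigmaI) (use finC fin in \<open>auto intro!: finite_cartesian_product finite_perfect_matchings\<close>)
  finally show ?thesis by (simp add: card_cartesian_product)
qed

lemma card_perfect_matchings_image:
  assumes inj: "inj f" and E: "\<And>e. f ` e \<in> E \<longleftrightarrow> e \<in> E" and surj: "\<And>e. e \<in> E \<Longrightarrow> e \<subseteq> range f"
  shows "card (perfect_matchings E (f ` R)) = card (perfect_matchings E R)"
proof -
  have "perfect_matchings E (f ` R) = (\<lambda>D. (`) f ` D) ` perfect_matchings E R"
  proof (intro equalityI subsetI)
    fix D assume D: "D \<in> perfect_matchings E (f ` R)"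
    then have p: "partition_on (f ` R) D" and DE: "D \<subseteq> E" by (auto simp: perfect_matchings_def)
    let ?D = "(\<lambda>d. f -` d) ` D"
    have fd: "f ` (f -` d) = d" if "d \<in> D" for d
      using that DE surj by (simp add: image_vimage_eq Int_absorb2 subsetD)
    have "partition_on R ?D"
    proof (rule partition_onI)
      have "\<Union>?D = f -` \<Union>D" by blast
      also have "\<dots> = f -` (f ` R)" using p by (simp add: partition_on_def)
      also have "\<dots> = R" using inj by (simp add: inj_vimage_image_eq)
      finally show "\<Union>?D = R" .
      show "disjnt p q" if pq: "p \<in> ?D" "q \<in> ?D" "p \<noteq> q" for p q
      proof -
        obtain p' q' where "p = f -` p'" "q = f -` q'" "p' \<in> D" "q' \<in> D"
          using pq(1,2) by blast
        moreover from this have "p' \<inter> q' = {}"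
          using p pq(3) unfolding partition_on_def disjoint_def by blast
        ultimately show ?thesis by (auto simp: disjnt_def)
      qed
      show "{} \<notin> ?D"
      proof
        assume "{} \<in> ?D"
        then obtain d where "d \<in> D" "f -` d = {}" by auto
        then have "d = {}" using fd by (metis image_empty)
        then show False using p \<open>d \<in> D\<close> by (auto simp: partition_on_def)
      qed
    qed
    moreover have "?D \<subseteq> E" using fd DE E by (metis image_subsetI subsetD)
    moreover have "D = (`) f ` ?D" using fd by (force simp: image_image)
    ultimately show "D \<in> (\<lambda>D. (`) f ` D) ` perfect_matchings E R"
      by (auto simp: perfect_matchings_def)
  next
    fix D assume "D \<in> (\<lambda>D. (`) f ` D) ` perfect_matchings E R"
    then obtain D' where D': "partition_on R D'" "D' \<subseteq> E" "D = (`) f ` D'"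
      by (auto simp: perfect_matchings_def)
    have "partition_on (f ` R) D"
    proof (rule partition_onI)
      show "\<Union>D = f ` R" using D' by (auto simp: partition_on_def)
      show "disjnt p q" if dd: "p \<in> D" "q \<in> D" "p \<noteq> q" for p q
      proof -
        obtain p' q' where pq: "p = f ` p'" "q = f ` q'" "p' \<in> D'" "q' \<in> D'"
          using dd(1,2) unfolding D'(3) by blast
        then have "p' \<inter> q' = {}"
          using D'(1) dd(3) pq unfolding partition_on_def disjoint_def by blast
        then show ?thesis using pq inj by (simp add: disjnt_def flip: image_Int)
      qed
      show "{} \<notin> D" using D' by (auto simp: partition_on_def)
    qed
    moreover have "D \<subseteq> E" using D' E by auto
    ultimately show "D \<in> perfect_matchings E (f ` R)" by (simp add: perfect_matchings_def)
  qed
  moreover have "inj ((`) f)" using inj by (intro injI) (simp add: inj_image_eq_iff)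
  then have "inj (\<lambda>D. (`) f ` D)" by (intro injI) (simp add: inj_image_eq_iff)
  ultimately show ?thesis by (simp add: card_image inj_on_subset)
qed

section \<open>Triangles and lozenges\<close>

text \<open>
  The triangles \<open>up i k\<close> and \<open>dn i k\<close> share the \<open>i\<close>-th horizontal edge on line \<open>k\<close>, counted from the
  west zigzag; with this numbering the lozenge condition depends only on the parity of \<open>k\<close>.
\<close>

definition up :: "int \<Rightarrow> int \<Rightarrow> triangle" where
  "up i k = up_triangle (of_int i + zigzag k, k)"

definition dn :: "int \<Rightarrow> int \<Rightarrow> triangle" where
  "dn i k = down_triangle (of_int i + zigzag k, k)"

text \<open>For l = k the lozenge is vertical. For l = k + 1 the triangles share a slanted edge; the
  zigzag moves by half an edge between the lines, so the two candidates have the index i and its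
  successor or predecessor, according to the parity of k.\<close>

definition nbr :: "int \<Rightarrow> int \<Rightarrow> int \<Rightarrow> int \<Rightarrow> bool" where
  "nbr i k j l \<longleftrightarrow> l = k \<and> j = i \<or> l = k + 1 \<and> (j = i \<or> j = i + (if even k then 1 else - 1))"

lemma lattice_iff: "(u, k) \<in> Defs.lattice \<longleftrightarrow> (\<exists>i. u = of_int i + zigzag k)"
proof
  assume "(u, k) \<in> Defs.lattice"
  then obtain m where m: "u - of_int k / 2 = of_int m" by (auto simp: lattice_def Ints_def)
  show "\<exists>i. u = of_int i + zigzag k"
  proof (cases "even k")
    case True
    then obtain r where "k = 2 * r" by blast
    then show ?thesis using m by (intro exI[of _ "m + r"]) (auto simp: zigzag_def)
  next
    case False
    then obtain r where "k = 2 * r + 1" by (auto elim: oddE)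
    then show ?thesis using m by (intro exI[of _ "m + r + 1"]) (auto simp: zigzag_def field_simps)
  qed
next
  assume "\<exists>i. u = of_int i + zigzag k"
  then obtain i where i: "u = of_int i + zigzag k" by auto
  have "\<exists>m::int. u - of_int k / 2 = of_int m"
  proof (cases "even k")
    case True
    then obtain r where "k = 2 * r" by blast
    then show ?thesis using i by (intro exI[of _ "i - r"]) (auto simp: zigzag_def)
  next
    case False
    then obtain r where "k = 2 * r + 1" by (auto elim: oddE)
    then show ?thesis using i by (intro exI[of _ "i - r - 1"]) (auto simp: zigzag_def field_simps)
  qed
  then show "(u, k) \<in> Defs.lattice" by (auto simp: lattice_def)
qed

lemma unit_triangles_eq: "unit_triangles = {up i k |i k. True} \<union> {dn i k |i k. True}"
  unfolding unit_triangles_def up_def dn_def using lattice_iff by fastforce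

lemma up_in_unit [simp]: "up i k \<in> unit_triangles" and dn_in_unit [simp]: "dn i k \<in> unit_triangles"
  by (auto simp: unit_triangles_eq)

lemma card_up_triangle: "card (up_triangle p) = 3" and card_down_triangle: "card (down_triangle p) = 3"
  by (cases p; simp add: up_triangle_def down_triangle_def)+

text \<open>Two vertices of an up-pointing triangle determine it, so two common vertices would make
  the triangles equal and give three.\<close>

lemma up_up_inter: "card (up_triangle (u, k) \<inter> up_triangle (v, l)) \<noteq> 2"
proof
  assume *: "card (up_triangle (u, k) \<inter> up_triangle (v, l)) = 2"
  then obtain p q where "p \<noteq> q" "{p, q} \<subseteq> up_triangle (u, k)" "{p, q} \<subseteq> up_triangle (v, l)"
    unfolding card_2_iff by blast
  then have "u = v \<and> k = l" by (auto simp: up_triangle_def)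
  with * show False by (simp add: card_up_triangle)
qed

lemma down_down_inter: "card (down_triangle (u, k) \<inter> down_triangle (v, l)) \<noteq> 2"
proof
  assume *: "card (down_triangle (u, k) \<inter> down_triangle (v, l)) = 2"
  then obtain p q where "p \<noteq> q" "{p, q} \<subseteq> down_triangle (u, k)" "{p, q} \<subseteq> down_triangle (v, l)"
    unfolding card_2_iff by blast
  then have "u = v \<and> k = l" by (auto simp: down_triangle_def)
  with * show False by (simp add: card_down_triangle)
qed

lemma up_down_inter: "card (up_triangle (u, k) \<inter> down_triangle (v, l)) = 2 \<longleftrightarrow>
  l = k \<and> v = u \<or> l = k + 1 \<and> (v = u + 1/2 \<or> v = u - 1/2)" (is "?L \<longleftrightarrow> ?R")
proof
  assume ?L
  then obtain p q where "p \<noteq> q" "{p, q} \<subseteq> up_triangle (u, k)" "{p, q} \<subseteq> down_triangle (v, l)"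
    unfolding card_2_iff by blast
  then show ?R by (auto simp: up_triangle_def down_triangle_def)
next
  assume ?R
  then consider "l = k" "v = u" | "l = k + 1" "v = u + 1/2" | "l = k + 1" "v = u - 1/2" by blast
  then show ?L
  proof cases
    case 1
    then have "up_triangle (u, k) \<inter> down_triangle (v, l) = {(u, k), (u + 1, k)}"
      by (auto simp: up_triangle_def down_triangle_def)
    then show ?thesis by simp
  next
    case 2
    then have "up_triangle (u, k) \<inter> down_triangle (v, l) = {(u + 1, k), (u + 1/2, k + 1)}"
      by (auto simp: up_triangle_def down_triangle_def)
    then show ?thesis by simp
  next
    case 3
    then have "up_triangle (u, k) \<inter> down_triangle (v, l) = {(u, k), (u + 1/2, k + 1)}"
      by (auto simp: up_triangle_def down_triangle_def)
    then show ?thesis by simp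
  qed
qed

lemma up_dn_inter: "card (up i k \<inter> dn j l) = 2 \<longleftrightarrow> nbr i k j l"
proof -
  have "of_int j + zigzag (k + 1) = of_int i + zigzag k + 1/2 \<or>
      of_int j + zigzag (k + 1) = of_int i + zigzag k - 1/2 \<longleftrightarrow>
      j = i \<or> j = i + (if even k then 1 else - 1)"
  proof (cases "even k")
    case True
    then have "of_int j + zigzag (k + 1) = of_int i + zigzag k + 1/2 \<longleftrightarrow> j = i + 1"
      "of_int j + zigzag (k + 1) = of_int i + zigzag k - 1/2 \<longleftrightarrow> j = i"
      by (simp_all add: zigzag_def) linarith
    then show ?thesis using True by auto
  next
    case False
    then have "of_int j + zigzag (k + 1) = of_int i + zigzag k + 1/2 \<longleftrightarrow> j = i"
      "of_int j + zigzag (k + 1) = of_int i + zigzag k - 1/2 \<longleftrightarrow> j = i - 1"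
      by (simp_all add: zigzag_def) linarith
    then show ?thesis using False by auto
  qed
  then show ?thesis unfolding up_def dn_def up_down_inter nbr_def by auto
qed

lemma is_lozenge_iff: "is_lozenge d \<longleftrightarrow> (\<exists>i k j l. d = {up i k, dn j l} \<and> nbr i k j l)"
proof
  assume "is_lozenge d"
  then obtain s t where st: "s \<in> unit_triangles" "t \<in> unit_triangles" "card (s \<inter> t) = 2" "d = {s, t}"
    by (auto simp: is_lozenge_def)
  have uu: "card (up i k \<inter> up j l) \<noteq> 2" "card (dn i k \<inter> dn j l) \<noteq> 2" for i j k l
    unfolding up_def dn_def using up_up_inter down_down_inter by auto
  from st(1,2) consider i k j l where "s = up i k" "t = up j l" | i k j l where "s = dn i k" "t = dn j l"
    | i k j l where "s = up i k" "t = dn j l" | i k j l where "s = dn i k" "t = up j l"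
    unfolding unit_triangles_eq by blast
  then show "\<exists>i k j l. d = {up i k, dn j l} \<and> nbr i k j l"
  proof cases
    case (3 i k j l)
    then show ?thesis using st up_dn_inter by blast
  next
    case (4 i k j l)
    then have "card (up j l \<inter> dn i k) = 2" using st(3) by (simp add: Int_commute)
    moreover have "d = {up j l, dn i k}" using st(4) 4 by auto
    ultimately show ?thesis using up_dn_inter by blast
  qed (use st uu in auto)
next
  assume "\<exists>i k j l. d = {up i k, dn j l} \<and> nbr i k j l"
  then show "is_lozenge d" unfolding is_lozenge_def using up_dn_inter up_in_unit dn_in_unit by blast
qed

lemma up_inject [simp]: "up i k = up j l \<longleftrightarrow> i = j \<and> k = l"
proof
  assume e: "up i k = up j l"
  have "of_int i + zigzag k = of_int j + zigzag l \<and> k = l"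
    using e unfolding up_def up_triangle_def by (auto simp: set_eq_iff) smt+
  then show "i = j \<and> k = l" by auto
qed auto

lemma reflect_up_triangle: "(\<lambda>(u, k). (u, - k)) ` up_triangle (u, k) = down_triangle (u, - k)"
  and reflect_down_triangle: "(\<lambda>(u, k). (u, - k)) ` down_triangle (u, k) = up_triangle (u, - k)"
  by (auto simp: up_triangle_def down_triangle_def)

lemma zigzag_minus [simp]: "zigzag (- k) = zigzag k" by (simp add: zigzag_def)

text \<open>Reflection in the line k = 0 exchanges the two orientations and carries the part below
  the line to one above it.\<close>

definition reflect :: "triangle \<Rightarrow> triangle" where
  "reflect = (`) (\<lambda>(u, k). (u, - k))"

lemma reflect_up [simp]: "reflect (up i k) = dn i (- k)"
  and reflect_dn [simp]: "reflect (dn i k) = up i (- k)"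
  by (simp_all add: reflect_def up_def dn_def reflect_up_triangle reflect_down_triangle)

lemma reflect_reflect [simp]: "reflect (reflect t) = t"
  by (force simp: reflect_def image_image)

lemma dn_inject [simp]: "dn i k = dn j l \<longleftrightarrow> i = j \<and> k = l"
  by (metis reflect_dn up_inject neg_equal_iff_equal)

lemma up_neq_dn [simp]: "up i k \<noteq> dn j l" "dn j l \<noteq> up i k"
proof -
  show "up i k \<noteq> dn j l"
  proof
    assume e: "up i k = dn j l"
    then have "{(of_int i + zigzag k, k), (of_int i + zigzag k + 1, k), (of_int i + zigzag k + 1/2, k + 1)} \<subseteq> dn j l"
      by (auto simp: up_def up_triangle_def)
    then show False by (auto simp: dn_def down_triangle_def)
  qed
  then show "dn j l \<noteq> up i k" by metis
qed

section \<open>Regions encoded by the index sets of their up-pointing and down-pointing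
  triangles\<close>

definition reg :: "(int \<times> int) set \<Rightarrow> (int \<times> int) set \<Rightarrow> region" where
  "reg I J = (\<lambda>(i, k). up i k) ` I \<union> (\<lambda>(i, k). dn i k) ` J"

lemma up_mem_reg [simp]: "up i k \<in> reg I J \<longleftrightarrow> (i, k) \<in> I"
  and dn_mem_reg [simp]: "dn i k \<in> reg I J \<longleftrightarrow> (i, k) \<in> J"
  by (auto simp: reg_def)

lemma reg_cases:
  assumes "t \<in> reg I J"
  obtains i k where "t = up i k" "(i, k) \<in> I" | i k where "t = dn i k" "(i, k) \<in> J"
  using assms by (auto simp: reg_def)

lemma reg_diff: "reg I J - reg I' J' = reg (I - I') (J - J')"
  by (auto elim!: reg_cases)

lemma reg_Un: "reg I J \<union> reg I' J' = reg (I \<union> I') (J \<union> J')"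
  by (auto simp: reg_def)

lemma reg_eqI:
  assumes "R \<subseteq> unit_triangles" "\<And>i k. up i k \<in> R \<longleftrightarrow> (i, k) \<in> I" "\<And>i k. dn i k \<in> R \<longleftrightarrow> (i, k) \<in> J"
  shows "R = reg I J"
  using assms by (auto simp: unit_triangles_eq elim!: reg_cases)

lemma finite_reg [simp]: "finite I \<Longrightarrow> finite J \<Longrightarrow> finite (reg I J)"
  by (simp add: reg_def)

definition num_tilings_reg :: "(int \<times> int) set \<Rightarrow> (int \<times> int) set \<Rightarrow> nat" where
  "num_tilings_reg I J = num_tilings (reg I J)"

lemma num_tilings_empty [simp]: "num_tilings_reg {} {} = 1"
proof -
  have "perfect_matchings E {} = {{}}" for E :: "'a set set"
    by (auto simp: perfect_matchings_def partition_on_def)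
  from this[of "{d. is_lozenge d}"] show ?thesis by (simp add: num_tilings_reg_def num_tilings_eq reg_def)
qed

lemma lozenge_up: "is_lozenge e \<Longrightarrow> up i k \<in> e \<Longrightarrow> \<exists>j l. e = {up i k, dn j l} \<and> nbr i k j l"
  and lozenge_dn: "is_lozenge e \<Longrightarrow> dn j l \<in> e \<Longrightarrow> \<exists>i k. e = {up i k, dn j l} \<and> nbr i k j l"
  unfolding is_lozenge_iff by force+

lemma num_tilings_expand_up:
  assumes "finite I" "finite J" "(i, k) \<in> I"
  shows "num_tilings_reg I J = (\<Sum>(j, l)\<in>{(j, l)\<in>J. nbr i k j l}. num_tilings_reg (I - {(i, k)}) (J - {(j, l)}))"
proof -
  have "num_tilings_reg I J = (\<Sum>w\<in>{w\<in>reg I J. w \<noteq> up i k \<and> {up i k, w} \<in> {d. is_lozenge d}}.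
     card (perfect_matchings {d. is_lozenge d} (reg I J - {up i k, w})))"
    unfolding num_tilings_reg_def num_tilings_eq
  proof (rule card_perfect_matchings_expand)
    fix e assume "e \<in> {d. is_lozenge d}" "up i k \<in> e"
    then obtain j l where "e = {up i k, dn j l}" using lozenge_up by blast
    then show "\<exists>w. w \<noteq> up i k \<and> e = {up i k, w}" by (metis up_neq_dn(2))
  qed (use assms in auto)
  also have "{w\<in>reg I J. w \<noteq> up i k \<and> {up i k, w} \<in> {d. is_lozenge d}} = (\<lambda>(j, l). dn j l) ` {(j, l)\<in>J. nbr i k j l}"
    by (auto simp: is_lozenge_iff doubleton_eq_iff)
  also have "(\<Sum>w\<in>(\<lambda>(j, l). dn j l) ` {(j, l)\<in>J. nbr i k j l}.
     card (perfect_matchings {d. is_lozenge d} (reg I J - {up i k, w}))) =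
     (\<Sum>p\<in>{(j, l)\<in>J. nbr i k j l}. card (perfect_matchings {d. is_lozenge d} (reg I J - {up i k, (\<lambda>(j, l). dn j l) p})))"
    by (subst sum.reindex) (auto simp: inj_on_def)
  also have "\<dots> = (\<Sum>(j, l)\<in>{(j, l)\<in>J. nbr i k j l}. num_tilings_reg (I - {(i, k)}) (J - {(j, l)}))"
  proof (rule sum.cong[OF refl], clarify)
    fix j l
    have "reg I J - {up i k, dn j l} = reg I J - reg {(i, k)} {(j, l)}" by (auto simp: reg_def)
    then show "card (perfect_matchings {d. is_lozenge d} (reg I J - {up i k, dn j l})) =
       num_tilings_reg (I - {(i, k)}) (J - {(j, l)})"
      by (simp add: num_tilings_reg_def num_tilings_eq reg_diff)
  qed
  finally show ?thesis .
qed

lemma num_tilings_reflect: "num_tilings_reg I J = num_tilings_reg ((\<lambda>(i, k). (i, - k)) ` J) ((\<lambda>(i, k). (i, - k)) ` I)"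
proof -
  have inj: "inj reflect" by (metis injI reflect_reflect)
  have loz: "is_lozenge (reflect ` e)" if le: "is_lozenge e" for e
  proof -
    obtain i k j l where e: "e = {up i k, dn j l}" "nbr i k j l" using le unfolding is_lozenge_iff by blast
    then have "reflect ` e = {up j (- l), dn i (- k)}" "nbr j (- l) i (- k)"
      by (auto simp: nbr_def)
    then show ?thesis unfolding is_lozenge_iff by blast
  qed
  have loz': "is_lozenge (reflect ` e) \<longleftrightarrow> is_lozenge e" for e
    using loz[of e] loz[of "reflect ` e"] by (auto simp: image_image)
  have "num_tilings_reg I J = card (perfect_matchings {d. is_lozenge d} (reflect ` reg I J))"
    unfolding num_tilings_reg_def num_tilings_eq
    by (rule card_perfect_matchings_image[symmetric])
      (use inj loz' surjI[of reflect reflect] in auto)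
  also have "reflect ` reg I J = reg ((\<lambda>(i, k). (i, - k)) ` J) ((\<lambda>(i, k). (i, - k)) ` I)"
    by (force simp: reg_def image_Un image_image)
  finally show ?thesis by (simp add: num_tilings_reg_def num_tilings_eq)
qed

lemma num_tilings_expand_dn:
  assumes "finite I" "finite J" "(j, l) \<in> J"
  shows "num_tilings_reg I J = (\<Sum>(i, k)\<in>{(i, k)\<in>I. nbr i k j l}. num_tilings_reg (I - {(i, k)}) (J - {(j, l)}))"
proof -
  have "num_tilings_reg I J = (\<Sum>w\<in>{w\<in>reg I J. w \<noteq> dn j l \<and> {dn j l, w} \<in> {d. is_lozenge d}}.
     card (perfect_matchings {d. is_lozenge d} (reg I J - {dn j l, w})))"
    unfolding num_tilings_reg_def num_tilings_eq
  proof (rule card_perfect_matchings_expand)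
    fix e assume "e \<in> {d. is_lozenge d}" "dn j l \<in> e"
    then obtain i k where "e = {dn j l, up i k}" using lozenge_dn by blast
    then show "\<exists>w. w \<noteq> dn j l \<and> e = {dn j l, w}" by (metis up_neq_dn(1))
  qed (use assms in auto)
  also have "{w\<in>reg I J. w \<noteq> dn j l \<and> {dn j l, w} \<in> {d. is_lozenge d}} = (\<lambda>(i, k). up i k) ` {(i, k)\<in>I. nbr i k j l}"
    by (auto simp: is_lozenge_iff doubleton_eq_iff)
  also have "(\<Sum>w\<in>(\<lambda>(i, k). up i k) ` {(i, k)\<in>I. nbr i k j l}.
     card (perfect_matchings {d. is_lozenge d} (reg I J - {dn j l, w}))) =
     (\<Sum>p\<in>{(i, k)\<in>I. nbr i k j l}. card (perfect_matchings {d. is_lozenge d} (reg I J - {dn j l, (\<lambda>(i, k). up i k) p})))"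
    by (subst sum.reindex) (auto simp: inj_on_def)
  also have "\<dots> = (\<Sum>(i, k)\<in>{(i, k)\<in>I. nbr i k j l}. num_tilings_reg (I - {(i, k)}) (J - {(j, l)}))"
  proof (rule sum.cong[OF refl], clarify)
    fix i k
    have "reg I J - {dn j l, up i k} = reg I J - reg {(i, k)} {(j, l)}" by (auto simp: reg_def)
    then show "card (perfect_matchings {d. is_lozenge d} (reg I J - {dn j l, up i k})) =
       num_tilings_reg (I - {(i, k)}) (J - {(j, l)})"
      by (simp add: num_tilings_reg_def num_tilings_eq reg_diff)
  qed
  finally show ?thesis .
qed

section \<open>Tilings of half hexagons, row by row\<close>

text \<open>Solving the neighbour relation for the up-pointing triangle reverses the shift, but the
  parity is now read at l = k + 1 instead of k. The two changes cancel, hence the same sign pattern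
  as in \<open>nbr\<close>.\<close>

lemma num_tilings_dn:
  assumes fin: "finite I" "finite J" and jl: "(j, l) \<in> J"
  defines "j' \<equiv> j + (if even l then 1 else - 1)"
  shows "num_tilings_reg I J = (if (j, l) \<in> I then num_tilings_reg (I - {(j, l)}) (J - {(j, l)}) else 0)
    + (if (j, l - 1) \<in> I then num_tilings_reg (I - {(j, l - 1)}) (J - {(j, l)}) else 0)
    + (if (j', l - 1) \<in> I then num_tilings_reg (I - {(j', l - 1)}) (J - {(j, l)}) else 0)"
proof -
  have *: "nbr i k j l \<longleftrightarrow> (i, k) \<in> {(j, l), (j, l - 1), (j', l - 1)}" for i k
    unfolding nbr_def j'_def by (cases "even k") auto
  have "{(i, k)\<in>I. nbr i k j l} = I \<inter> {(j, l), (j, l - 1), (j', l - 1)}"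
    unfolding * by auto
  then have "num_tilings_reg I J = (\<Sum>p\<in>I \<inter> {(j, l), (j, l - 1), (j', l - 1)}. num_tilings_reg (I - {p}) (J - {(j, l)}))"
    using num_tilings_expand_dn[OF fin jl] by (simp add: case_prod_unfold)
  also have "\<dots> = (\<Sum>p\<in>{(j, l), (j, l - 1), (j', l - 1)}. if p \<in> I then num_tilings_reg (I - {p}) (J - {(j, l)}) else 0)"
    by (rule sum.mono_neutral_cong_left) auto
  also have "\<dots> = (if (j, l) \<in> I then num_tilings_reg (I - {(j, l)}) (J - {(j, l)}) else 0)
    + (if (j, l - 1) \<in> I then num_tilings_reg (I - {(j, l - 1)}) (J - {(j, l)}) else 0)
    + (if (j', l - 1) \<in> I then num_tilings_reg (I - {(j', l - 1)}) (J - {(j, l)}) else 0)"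
    by (simp add: j'_def)
  finally show ?thesis .
qed

lemma num_tilings_up:
  assumes fin: "finite I" "finite J" and ik: "(i, k) \<in> I"
  defines "i' \<equiv> i + (if even k then 1 else - 1)"
  shows "num_tilings_reg I J = (if (i, k) \<in> J then num_tilings_reg (I - {(i, k)}) (J - {(i, k)}) else 0)
    + (if (i, k + 1) \<in> J then num_tilings_reg (I - {(i, k)}) (J - {(i, k + 1)}) else 0)
    + (if (i', k + 1) \<in> J then num_tilings_reg (I - {(i, k)}) (J - {(i', k + 1)}) else 0)"
proof -
  have *: "nbr i k j l \<longleftrightarrow> (j, l) \<in> {(i, k), (i, k + 1), (i', k + 1)}" for j l
    unfolding nbr_def i'_def by auto
  have "{(j, l)\<in>J. nbr i k j l} = J \<inter> {(i, k), (i, k + 1), (i', k + 1)}"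
    unfolding * by auto
  then have "num_tilings_reg I J = (\<Sum>p\<in>J \<inter> {(i, k), (i, k + 1), (i', k + 1)}. num_tilings_reg (I - {(i, k)}) (J - {p}))"
    using num_tilings_expand_up[OF fin ik] by (simp add: case_prod_unfold)
  also have "\<dots> = (\<Sum>p\<in>{(i, k), (i, k + 1), (i', k + 1)}. if p \<in> J then num_tilings_reg (I - {(i, k)}) (J - {p}) else 0)"
    by (rule sum.mono_neutral_cong_left) auto
  also have "\<dots> = (if (i, k) \<in> J then num_tilings_reg (I - {(i, k)}) (J - {(i, k)}) else 0)
    + (if (i, k + 1) \<in> J then num_tilings_reg (I - {(i, k)}) (J - {(i, k + 1)}) else 0)
    + (if (i', k + 1) \<in> J then num_tilings_reg (I - {(i, k)}) (J - {(i', k + 1)}) else 0)"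
    by (simp add: i'_def)
  finally show ?thesis .
qed

lemma num_tilings_forced:
  assumes "finite X" "finite I" "finite J" "X \<subseteq> I" "X \<subseteq> J"
    and "\<And>j l. (j, l) \<in> X \<Longrightarrow> (j, l - 1) \<notin> I \<and> (j + (if even l then 1 else - 1), l - 1) \<notin> I"
  shows "num_tilings_reg I J = num_tilings_reg (I - X) (J - X)"
  using assms
proof (induction X)
  case empty
  then show ?case by simp
next
  case (insert p X)
  obtain j l where p: "p = (j, l)" by fastforce
  have "num_tilings_reg I J = num_tilings_reg (I - X) (J - X)" using insert by auto
  also have "\<dots> = num_tilings_reg (I - X - {(j, l)}) (J - X - {(j, l)})"
  proof (subst num_tilings_dn[of "I - X" "J - X" j l])
    show "(j, l) \<in> J - X" using insert p by auto
  qed (use insert p insert.prems(5)[of j l] in auto)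
  also have "I - X - {(j, l)} = I - insert p X" using p by auto
  also have "J - X - {(j, l)} = J - insert p X" using p by auto
  finally show ?case .
qed

text \<open>A down-pointing triangle whose two lower neighbours are missing must be matched with the triangle
  above it, so that the holes fill up row by row from their bases.\<close>

lemma num_tilings_fill_holes:
  fixes T :: "int \<Rightarrow> int set"
  assumes fin: "finite I" "finite J"
    and T: "\<And>i l. l \<ge> 1 \<Longrightarrow> i \<in> T l \<Longrightarrow> (i, l) \<in> I \<and> (i, l) \<in> J"
    and closed: "\<And>i l i'. l \<ge> 1 \<Longrightarrow> i \<in> T l \<Longrightarrow> i' \<in> {i, i + (if even l then 1 else - 1)} \<Longrightarrow>
       (i', l - 1) \<in> I \<Longrightarrow> i' \<in> T (l - 1)"
  shows "num_tilings_reg (I - T 0 \<times> {0}) J = num_tilings_reg (I - {(i, k). 0 \<le> k \<and> i \<in> T k}) (J - {(i, k). 1 \<le> k \<and> i \<in> T k})"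
proof -
  have *: "num_tilings_reg (I - T 0 \<times> {0}) J =
    num_tilings_reg (I - {(i, k). 0 \<le> k \<and> k \<le> int n \<and> i \<in> T k}) (J - {(i, k). 1 \<le> k \<and> k \<le> int n \<and> i \<in> T k})" for n
  proof (induction n)
    case 0
    have "{(i, k). 0 \<le> k \<and> k \<le> int 0 \<and> i \<in> T k} = T 0 \<times> {0}" by auto
    moreover have "{(i, k). 1 \<le> k \<and> k \<le> int 0 \<and> i \<in> T k} = {}" by auto
    ultimately show ?case by (simp only: Diff_empty)
  next
    case (Suc n)
    let ?X = "T (int n + 1) \<times> {int n + 1}"
    let ?I = "I - {(i, k). 0 \<le> k \<and> k \<le> int n \<and> i \<in> T k}"
    let ?J = "J - {(i, k). 1 \<le> k \<and> k \<le> int n \<and> i \<in> T k}"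
    have "num_tilings_reg ?I ?J = num_tilings_reg (?I - ?X) (?J - ?X)"
    proof (rule num_tilings_forced)
      show "?X \<subseteq> ?I" "?X \<subseteq> ?J" using T by auto
      have "?X \<subseteq> I" using T by auto
      then show "finite ?X" using fin finite_subset by blast
      fix j l assume jl: "(j, l) \<in> ?X"
      then show "(j, l - 1) \<notin> ?I \<and> (j + (if even l then 1 else - 1), l - 1) \<notin> ?I"
        using closed[of l j j] closed[of l j "j + (if even l then 1 else - 1)"] by auto
    qed (use fin in auto)
    moreover have le: "k \<le> int (Suc n) \<longleftrightarrow> k \<le> int n \<or> k = int n + 1" for k by auto
    have "?I - ?X = I - {(i, k). 0 \<le> k \<and> k \<le> int (Suc n) \<and> i \<in> T k}" unfolding le by auto
    moreover have "?J - ?X = J - {(i, k). 1 \<le> k \<and> k \<le> int (Suc n) \<and> i \<in> T k}" unfolding le by auto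
    ultimately show ?case using Suc by simp
  qed
  \<comment> \<open>Only finitely many triangles exist, so beyond some row K nothing is left to fill
    and K steps remove the whole holes.\<close>
  obtain K where K: "\<And>i k. (i, k) \<in> I \<union> J \<Longrightarrow> k \<le> int K"
  proof -
    have "finite (snd ` (I \<union> J))" using fin by simp
    then have "\<forall>k\<in>snd ` (I \<union> J). k \<le> Max (insert 0 (snd ` (I \<union> J)))" by simp
    then show ?thesis using that[of "nat (Max (insert 0 (snd ` (I \<union> J))))"] by force
  qed
  have "I - {(i, k). 0 \<le> k \<and> k \<le> int K \<and> i \<in> T k} = I - {(i, k). 0 \<le> k \<and> i \<in> T k}"
    "J - {(i, k). 1 \<le> k \<and> k \<le> int K \<and> i \<in> T k} = J - {(i, k). 1 \<le> k \<and> i \<in> T k}"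
    using K by blast+
  then show ?thesis using *[of K] by simp
qed

text \<open>
  The rows of the determinants that count the tilings above an even, respectively odd, line, one row
  for each dent.
\<close>

definition even_row :: "int \<Rightarrow> nat \<Rightarrow> real" where
  "even_row i j = (of_int i + 1 + of_nat j) gchoose (2 * j + 1)"

definition odd_row :: "int \<Rightarrow> nat \<Rightarrow> real" where
  "odd_row t j = (of_int t + of_nat j) gchoose (2 * j)"

text \<open>Pascal's rule on an odd line pairs the entry j with the entry j - 1 of an even row. The
  added zero column also reflects that the region above an odd line has one more dent to balance
  than the one above the next even line.\<close>

definition shift_row :: "(nat \<Rightarrow> real) \<Rightarrow> nat \<Rightarrow> real" where
  "shift_row r = (\<lambda>j. case j of 0 \<Rightarrow> 0 | Suc j \<Rightarrow> r j)"

text \<open>In a half hexagon of height 2n the up-pointing triangles exceed the others by n, so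
  there is a tiling only with n dents. The value 0 otherwise makes the counting formula hold for any
  number of dents.\<close>

definition det_val :: "nat \<Rightarrow> (nat \<Rightarrow> real) list \<Rightarrow> real" where
  "det_val n vs = (if length vs = n then det_rows vs else 0)"

lemma even_row_rec: "even_row i = (\<lambda>j. even_row (i - 1) j + odd_row i j)"
proof
  fix j
  show "even_row i j = even_row (i - 1) j + odd_row i j"
    using gbinomial_Suc_Suc[of "of_int i + of_nat j :: real" "2 * j"]
    by (simp add: even_row_def odd_row_def add_ac)
qed

lemma odd_row_rec: "odd_row (i + 1) = (\<lambda>j. odd_row i j + shift_row (even_row i) j)"
proof
  fix j
  show "odd_row (i + 1) j = odd_row i j + shift_row (even_row i) j"
  proof (cases j)
    case 0
    then show ?thesis by (simp add: odd_row_def shift_row_def)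
  next
    case (Suc m)
    then show ?thesis
      using gbinomial_Suc_Suc[of "of_int i + 1 + of_nat m :: real" "2 * m + 1"]
      by (simp add: even_row_def odd_row_def shift_row_def add_ac)
  qed
qed

text \<open>The boundary value for the west end: Pascal's rule produces this row where the zigzag
  leaves no room for a lozenge.\<close>

lemma even_row_minus_1: "even_row (- 1) = (\<lambda>_. 0)"
proof
  fix j
  have "(of_nat j :: real) gchoose (2 * j + 1) = of_nat (j choose (2 * j + 1))"
    by (rule binomial_gbinomial[symmetric])
  then show "even_row (- 1) j = 0" by (simp add: even_row_def)
qed

lemma odd_row_0: "odd_row 0 0 = 1"
  by (simp add: odd_row_def)

lemma det_val_add:
  "det_val n (xs @ (\<lambda>j. u j + v j) # ys) = det_val n (xs @ u # ys) + det_val n (xs @ v # ys)"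
  by (simp add: det_val_def det_rows_add)

lemma det_val_zero_row: "det_val n (xs @ (\<lambda>_. 0) # ys) = 0"
  by (simp add: det_val_def det_rows_zero_row)

lemma det_val_repeat: "det_val n (xs @ u # u # ys) = 0"
  by (simp add: det_val_def det_rows_repeat)

lemma sorted_list_of_set_snoc:
  fixes S :: "int set"
  assumes "finite S" "\<And>s. s \<in> S \<Longrightarrow> s < m"
  shows "sorted_list_of_set (insert m S) = sorted_list_of_set S @ [m]"
  by (rule sorted_distinct_set_unique)
    (use assms in \<open>auto simp: sorted_append less_imp_le simp del: sorted_list_of_set_insert_remove\<close>)

lemma sorted_list_of_set_Cons:
  fixes S :: "int set"
  assumes "finite S" "\<And>s. s \<in> S \<Longrightarrow> m < s"
  shows "sorted_list_of_set (insert m S) = m # sorted_list_of_set S"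
  by (rule sorted_distinct_set_unique)
    (use assms in \<open>auto simp: less_imp_le simp del: sorted_list_of_set_insert_remove\<close>)

text \<open>The strip between the even line k - 1 and the odd line k is tiled from its east end:
  \<open>l\<close> edges remain, \<open>S\<close> are the dents on the lower line, and
  \<open>R\<close> are the edges of the upper line already used. If the last edge is no dent, its
  up-pointing triangle has one partner left and nothing changes. If it is a dent, the down-pointing
  triangle has two candidates; they keep the dent on line k or move it one step west on line k - 1,
  which are the two terms of \<open>even_row_rec\<close>.\<close>

lemma num_tilings_even_row:
  fixes L n l :: nat
  assumes fin: "finite I" "finite J" and k: "odd k"
    and I: "\<And>i m. (i, m) \<in> I \<Longrightarrow> m \<ge> k" and J: "\<And>i m. (i, m) \<in> J \<Longrightarrow> m \<ge> k + 1"
    and row: "{0..<int L} \<times> {k} \<subseteq> I"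
    and IH: "\<And>R. R \<subseteq> {0..<int L} \<Longrightarrow>
       real (num_tilings_reg (I - R \<times> {k}) J) = det_val n (map odd_row (sorted_list_of_set R))"
    and "l \<le> L" "S \<subseteq> {0..<int l}" "R \<subseteq> {int l..<int L}"
  shows "real (num_tilings_reg (({0..<int l} - S) \<times> {k - 1} \<union> (I - R \<times> {k})) ({0..<int l} \<times> {k} \<union> J)) =
    det_val n (map even_row (sorted_list_of_set S) @ map odd_row (sorted_list_of_set R))"
  using assms(8-10)
proof (induction l arbitrary: S R)
  case 0
  then show ?case using IH[of R] by simp
next
  case (Suc l)
  let ?I = "\<lambda>l S R. ({0..<int l} - S) \<times> {k - 1} \<union> (I - R \<times> {k})"
  let ?J = "\<lambda>l. {0..<int l} \<times> {k} \<union> J"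
  have finS: "finite S" "finite R" using Suc.prems finite_subset by blast+
  define A B where "A = ?I (Suc l) S R" and "B = ?J (Suc l)"
  note AB = A_def B_def
  have R: "R \<subseteq> {int l..<int L}" using Suc.prems by auto
  have finIJ: "finite A" "finite B" using fin by (auto simp: AB)
  show ?case
  proof (cases "int l \<in> S")
    case True
    define S' where "S' = S - {int l}"
    have S': "S = insert (int l) S'" "S' \<subseteq> {0..<int l}" "finite S'"
      using True Suc.prems finS by (auto simp: S'_def)
    have LS: "sorted_list_of_set S = sorted_list_of_set S' @ [int l]"
      unfolding S'(1) by (rule sorted_list_of_set_snoc) (use S' in auto)
    have LR: "sorted_list_of_set (insert (int l) R) = int l # sorted_list_of_set R"
      by (rule sorted_list_of_set_Cons) (use finS Suc.prems in auto)
    have 1: "A - {(int l, k)} = ?I l S' (insert (int l) R)"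
      "B - {(int l, k)} = ?J l" using S' J unfolding AB by force+
    have inB: "(int l, k) \<in> B" unfolding AB by auto
    have in1: "(int l, k) \<in> A" using row Suc.prems unfolding AB by auto
    have out: "(int l, k - 1) \<notin> A" using True I unfolding AB by force
    have in2: "(int l - 1, k - 1) \<in> A \<longleftrightarrow> l \<ge> 1 \<and> int l - 1 \<notin> S'"
      using I S' unfolding AB by force
    have 2: "A - {(int l - 1, k - 1)} = ?I l (insert (int l - 1) S') R"
      using S' I unfolding AB by force
    have "real (num_tilings_reg A B) = real (num_tilings_reg (?I l S' (insert (int l) R)) (?J l))
      + (if l \<ge> 1 \<and> int l - 1 \<notin> S' then real (num_tilings_reg (?I l (insert (int l - 1) S') R) (?J l)) else 0)"
      using num_tilings_dn[OF finIJ inB] in1 out in2 k by (simp add: 1 2)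
    also have "real (num_tilings_reg (?I l S' (insert (int l) R)) (?J l)) =
      det_val n (map even_row (sorted_list_of_set S') @ odd_row (int l) # map odd_row (sorted_list_of_set R))"
      using Suc.IH[of S' "insert (int l) R"] S' Suc.prems R by (auto simp: LR)
    \<comment> \<open>An impossible second lozenge matches a vanishing determinant: a zero row at
      the west end, or a repeated row if the edge to the west is already a dent.\<close>
    also have "(if l \<ge> 1 \<and> int l - 1 \<notin> S' then real (num_tilings_reg (?I l (insert (int l - 1) S') R) (?J l)) else 0) =
      det_val n (map even_row (sorted_list_of_set S') @ even_row (int l - 1) # map odd_row (sorted_list_of_set R))"
    proof -
      consider "l = 0" | "l \<ge> 1" "int l - 1 \<in> S'" | "l \<ge> 1" "int l - 1 \<notin> S'" by linarith
      then show ?thesis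
      proof cases
        case 1
        then show ?thesis by (simp add: even_row_minus_1 det_val_zero_row)
      next
        case 2
        define S'' where "S'' = S' - {int l - 1}"
        have "S' = insert (int l - 1) S''" using 2 by (auto simp: S''_def)
        moreover have "sorted_list_of_set (insert (int l - 1) S'') = sorted_list_of_set S'' @ [int l - 1]"
          by (rule sorted_list_of_set_snoc) (use S' in \<open>force simp: S''_def\<close>)+
        ultimately show ?thesis using 2 by (simp add: det_val_repeat)
      next
        case 3
        have "s < int l - 1" if "s \<in> S'" for s
          using that S'(2) 3 by (cases "s = int l - 1") force+
        then have "sorted_list_of_set (insert (int l - 1) S') = sorted_list_of_set S' @ [int l - 1]"
          by (intro sorted_list_of_set_snoc) (use S' in auto)
        moreover have "real (num_tilings_reg (?I l (insert (int l - 1) S') R) (?J l)) =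
           det_val n (map even_row (sorted_list_of_set (insert (int l - 1) S')) @ map odd_row (sorted_list_of_set R))"
          by (rule Suc.IH) (use S' 3 Suc.prems in auto)
        ultimately show ?thesis using 3 by simp
      qed
    qed
    finally show ?thesis
      unfolding AB LS using even_row_rec[of "int l"] by (simp add: det_val_add)
  next
    case False
    have S: "S \<subseteq> {0..<int l}"
    proof
      fix s assume "s \<in> S"
      then have "s \<noteq> int l" "s \<in> {0..<int (Suc l)}" using False Suc.prems by blast+
      then show "s \<in> {0..<int l}" by auto
    qed
    have 1: "A - {(int l, k - 1)} = ?I l S R" "B - {(int l, k)} = ?J l"
      using S I J unfolding AB by force+
    have in1: "(int l, k - 1) \<in> A" using False unfolding AB by auto
    have inB: "(int l, k) \<in> B" unfolding AB by auto
    have out: "(int l, k - 1) \<notin> B" "(int l + 1, k) \<notin> B" using J unfolding AB by force+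
    have "num_tilings_reg A B = num_tilings_reg (?I l S R) (?J l)"
      using num_tilings_up[OF finIJ in1] inB out k by (simp add: 1)
    then show ?thesis using Suc.IH[of S R] S R Suc.prems unfolding AB by auto
  qed
qed

text \<open>The same sweep for an odd line under an even one, now with \<open>odd_row_rec\<close>.
  The odd line has one edge more, so at the end edge 0 is left and must be a dent; this accounts for
  the additional column. For n = 0 the even line is the north side, and no up-pointing triangle
  stands on it.\<close>

lemma num_tilings_odd_row:
  fixes L n l :: nat
  assumes fin: "finite I" "finite J" and k: "even k"
    and I: "\<And>i m. (i, m) \<in> I \<Longrightarrow> m \<ge> k" and J: "\<And>i m. (i, m) \<in> J \<Longrightarrow> m \<ge> k + 1"
    and row: "n > 0 \<Longrightarrow> {0..<int L} \<times> {k} \<subseteq> I" and row0: "n = 0 \<Longrightarrow> I = {}"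
    and IH: "\<And>R. R \<subseteq> {0..<int L} \<Longrightarrow> (n = 0 \<Longrightarrow> R = {}) \<Longrightarrow>
       real (num_tilings_reg (I - R \<times> {k}) J) = det_val n (map even_row (sorted_list_of_set R))"
    and "l \<le> L" "S \<subseteq> {0..int l}" "R \<subseteq> {int l..<int L}" "n = 0 \<Longrightarrow> R = {}"
  shows "real (num_tilings_reg (({0..int l} - S) \<times> {k - 1} \<union> (I - R \<times> {k})) ({0..<int l} \<times> {k} \<union> J)) =
    det_val (Suc n) (map odd_row (sorted_list_of_set S) @ map (\<lambda>a. shift_row (even_row a)) (sorted_list_of_set R))"
  using assms(9-12)
proof (induction l arbitrary: S R)
  case 0
  let ?I = "({0} - S) \<times> {k - 1} \<union> (I - R \<times> {k})"
  have finI: "finite ?I" using fin by auto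
  have shift: "map (\<lambda>a. shift_row (even_row a)) (sorted_list_of_set R) =
     map (\<lambda>r j. case j of 0 \<Rightarrow> 0 | Suc j \<Rightarrow> r j) (map even_row (sorted_list_of_set R))"
    by (simp add: shift_row_def)
  consider "S = {0}" | "S = {}" using 0 by auto
  then show ?case
  proof cases
    case 1
    have "det_val (Suc n) (odd_row 0 # map (\<lambda>a. shift_row (even_row a)) (sorted_list_of_set R)) =
       det_val n (map even_row (sorted_list_of_set R))"
      unfolding det_val_def shift by (subst det_rows_block) (simp_all add: odd_row_0)
    then show ?thesis using IH[of R] 0 1 by (simp add: o_def)
  next
    case 2
    \<comment> \<open>If edge 0 is not a dent, its up-pointing triangle has lost every partner, so
      there is no tiling. On the other side all remaining rows begin with 0.\<close>
    have "(0, k - 1) \<in> ?I" using 2 by simp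
    from num_tilings_up[OF finI fin(2) this] have "num_tilings_reg ?I J = 0"
      using J[of 0 "k - 1"] J[of 0 k] J[of "- 1" k] k by auto
    moreover have "det_val (Suc n) (map (\<lambda>a. shift_row (even_row a)) (sorted_list_of_set R)) = 0"
    proof (cases "sorted_list_of_set R = []")
      case False
      have "det_rows (map (\<lambda>a. shift_row (even_row a)) (sorted_list_of_set R)) = 0"
        by (rule det_rows_zero_col) (use False in \<open>auto simp: shift_row_def\<close>)
      then show ?thesis by (simp add: det_val_def)
    qed (simp add: det_val_def)
    ultimately show ?thesis using 2 by (simp add: o_def)
  qed
next
  case (Suc l)
  let ?I = "\<lambda>l S R. ({0..int l} - S) \<times> {k - 1} \<union> (I - R \<times> {k})"
  let ?J = "\<lambda>l. {0..<int l} \<times> {k} \<union> J"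
  let ?m = "int l + 1"
  have finS: "finite S" "finite R" using Suc.prems finite_subset by blast+
  define A B where "A = ?I (Suc l) S R" and "B = ?J (Suc l)"
  note AB = A_def B_def
  have R: "R \<subseteq> {int l..<int L}" using Suc.prems by auto
  have finIJ: "finite A" "finite B" using fin by (auto simp: AB)
  show ?case
  proof (cases "?m \<in> S")
    case True
    define S' where "S' = S - {?m}"
    have S': "S = insert ?m S'" "S' \<subseteq> {0..int l}" "finite S'"
      using True Suc.prems finS by (auto simp: S'_def)
    have LS: "sorted_list_of_set S = sorted_list_of_set S' @ [?m]"
      unfolding S'(1) by (rule sorted_list_of_set_snoc) (use S' in auto)
    have LR: "sorted_list_of_set (insert (int l) R) = int l # sorted_list_of_set R"
      by (rule sorted_list_of_set_Cons) (use finS Suc.prems in auto)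
    have 1: "A - {(int l, k)} = ?I l S' (insert (int l) R)"
      "B - {(int l, k)} = ?J l" using S' J unfolding AB by force+
    have inB: "(int l, k) \<in> B" unfolding AB by auto
    have in1: "(int l, k) \<in> A \<longleftrightarrow> n > 0" using row row0 Suc.prems unfolding AB by force
    have out: "(?m, k - 1) \<notin> A" using True I unfolding AB by force
    have in2: "(int l, k - 1) \<in> A \<longleftrightarrow> int l \<notin> S'"
      using I S' unfolding AB by force
    have 2: "A - {(int l, k - 1)} = ?I l (insert (int l) S') R"
      using S' I unfolding AB by force
    have "real (num_tilings_reg A B) =
        (if n > 0 then real (num_tilings_reg (?I l S' (insert (int l) R)) (?J l)) else 0)
      + (if int l \<notin> S' then real (num_tilings_reg (?I l (insert (int l) S') R) (?J l)) else 0)"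
      using num_tilings_dn[OF finIJ inB] in1 out in2 k by (simp add: 1 2)
    also have "(if n > 0 then real (num_tilings_reg (?I l S' (insert (int l) R)) (?J l)) else 0) =
      det_val (Suc n) (map odd_row (sorted_list_of_set S') @ shift_row (even_row (int l))
         # map (\<lambda>a. shift_row (even_row a)) (sorted_list_of_set R))"
    proof (cases "n > 0")
      case True
      then show ?thesis using Suc.IH[of S' "insert (int l) R"] S' Suc.prems R by (auto simp: LR)
    next
      case False
      then have "R = {}" using Suc.prems by auto
      moreover have "det_rows [shift_row (even_row (int l))] = 0"
        by (rule det_rows_zero_col) (auto simp: shift_row_def)
      ultimately show ?thesis using False S'(3) by (simp add: det_val_def)
    qed
    also have "(if int l \<notin> S' then real (num_tilings_reg (?I l (insert (int l) S') R) (?J l)) else 0) =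
      det_val (Suc n) (map odd_row (sorted_list_of_set S') @ odd_row (int l)
         # map (\<lambda>a. shift_row (even_row a)) (sorted_list_of_set R))"
    proof (cases "int l \<in> S'")
      case True
      define S'' where "S'' = S' - {int l}"
      have "S' = insert (int l) S''" using True by (auto simp: S''_def)
      moreover have "sorted_list_of_set (insert (int l) S'') = sorted_list_of_set S'' @ [int l]"
        by (rule sorted_list_of_set_snoc) (use S' in \<open>force simp: S''_def\<close>)+
      ultimately show ?thesis using True by (simp add: det_val_repeat)
    next
      case False
      have "s < int l" if "s \<in> S'" for s
        using that S'(2) False by (cases "s = int l") force+
      then have "sorted_list_of_set (insert (int l) S') = sorted_list_of_set S' @ [int l]"
        by (intro sorted_list_of_set_snoc) (use S' in auto)
      moreover have "real (num_tilings_reg (?I l (insert (int l) S') R) (?J l)) =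
         det_val (Suc n) (map odd_row (sorted_list_of_set (insert (int l) S'))
           @ map (\<lambda>a. shift_row (even_row a)) (sorted_list_of_set R))"
        by (rule Suc.IH) (use S' False Suc.prems in auto)
      ultimately show ?thesis using False by simp
    qed
    finally show ?thesis
      unfolding AB LS using odd_row_rec[of "int l"] by (simp add: det_val_add)
  next
    case False
    have S: "S \<subseteq> {0..int l}"
    proof
      fix s assume "s \<in> S"
      then have "s \<noteq> ?m" "s \<in> {0..int (Suc l)}" using False Suc.prems by blast+
      then show "s \<in> {0..int l}" by auto
    qed
    have 1: "A - {(?m, k - 1)} = ?I l S R" "B - {(int l, k)} = ?J l"
      using S I J unfolding AB by force+
    have in1: "(?m, k - 1) \<in> A" using False unfolding AB by auto
    have out: "(?m, k - 1) \<notin> B" "(?m, k) \<notin> B" using J unfolding AB by force+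
    have in2: "(int l, k) \<in> B" unfolding AB by auto
    have "num_tilings_reg A B = num_tilings_reg (?I l S R) (?J l)"
      using num_tilings_up[OF finIJ in1] in2 out k by (simp add: 1)
    then show ?thesis using Suc.IH[of S R] S R Suc.prems unfolding AB by auto
  qed
qed

text \<open>The up-pointing triangles of the half hexagon of height 2n on a base of L edges on the
  even line k0: counted from the zigzag, the east side loses one edge every two lines. The base line
  carries only these triangles and the north side only those of \<open>half_dns\<close>. A variable
  k0 allows induction by two rows.\<close>

definition half_ups :: "nat \<Rightarrow> int \<Rightarrow> nat \<Rightarrow> (int \<times> int) set" where
  "half_ups n k0 L = {(i, k). k0 \<le> k \<and> k < k0 + 2 * int n \<and> 0 \<le> i \<and> i < int L - (k - k0) div 2}"

definition half_dns :: "nat \<Rightarrow> int \<Rightarrow> nat \<Rightarrow> (int \<times> int) set" where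
  "half_dns n k0 L = {(i, k). k0 < k \<and> k \<le> k0 + 2 * int n \<and> 0 \<le> i \<and> i < int L - (k - k0) div 2}"

lemma finite_half_ups [simp]: "finite (half_ups n k0 L)"
  and finite_half_dns [simp]: "finite (half_dns n k0 L)"
proof -
  have "i < int L" if "i < int L - (k - k0) div 2" "k0 \<le> k" for i k
    using that pos_imp_zdiv_nonneg_iff[of 2 "k - k0"] by simp
  then have "half_ups n k0 L \<subseteq> {0..<int L} \<times> {k0..k0 + 2 * int n}"
    "half_dns n k0 L \<subseteq> {0..<int L} \<times> {k0..k0 + 2 * int n}"
    by (auto simp: half_ups_def half_dns_def)
  then show "finite (half_ups n k0 L)" "finite (half_dns n k0 L)"
    by (meson finite_SigmaI finite_atLeastLessThan_int finite_atLeastAtMost_int finite_subset)+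
qed

text \<open>One step removes an even and an odd strip and leaves a half hexagon with base shorter by
  one. The condition for n = 0 is due to the empty region, which has one tiling, whereas
  \<open>det_val 0\<close> is 0 on nonempty lists.\<close>

lemma num_tilings_half_hexagon:
  assumes "even k0" "n \<le> L" "S \<subseteq> {0..<int L}" "n = 0 \<Longrightarrow> S = {}"
  shows "real (num_tilings_reg (half_ups n k0 L - S \<times> {k0}) (half_dns n k0 L)) =
    det_val n (map even_row (sorted_list_of_set S))"
  using assms
proof (induction n arbitrary: k0 L S)
  case 0
  have "half_ups 0 k0 L = {}" "half_dns 0 k0 L = {}" by (auto simp: half_ups_def half_dns_def)
  then show ?case using 0 by (simp add: det_val_def)
next
  case (Suc n)
  obtain L' where L: "L = Suc L'" "n \<le> L'" using Suc.prems by (cases L) auto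
  define I2 J2 where "I2 = half_ups n (k0 + 2) L'" and "J2 = half_dns n (k0 + 2) L'"
  define I1 J1 where "I1 = {0..int L'} \<times> {k0 + 1} \<union> I2" and "J1 = {0..<int L'} \<times> {k0 + 2} \<union> J2"
  have fin: "finite I2" "finite J2" "finite I1" "finite J1" by (simp_all add: I1_def J1_def I2_def J2_def)
  have I2: "m \<ge> k0 + 2" if "(i, m) \<in> I2" for i m using that by (auto simp: I2_def half_ups_def)
  have J2: "m \<ge> k0 + 2 + 1" if "(i, m) \<in> J2" for i m using that by (auto simp: J2_def half_dns_def)
  have odd: "real (num_tilings_reg (I1 - S' \<times> {k0 + 1}) J1) = det_val (Suc n) (map odd_row (sorted_list_of_set S'))"
    if S': "S' \<subseteq> {0..int L'}" for S'
  proof -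
    have "real (num_tilings_reg (({0..int L'} - S') \<times> {k0 + 2 - 1} \<union> (I2 - {} \<times> {k0 + 2})) ({0..<int L'} \<times> {k0 + 2} \<union> J2)) =
      det_val (Suc n) (map odd_row (sorted_list_of_set S') @ map (\<lambda>a. shift_row (even_row a)) (sorted_list_of_set {}))"
    proof (rule num_tilings_odd_row[where L = L'])
      show "{0..<int L'} \<times> {k0 + 2} \<subseteq> I2" if "n > 0"
        using that by (auto simp: I2_def half_ups_def)
      show "I2 = {}" if "n = 0" using that by (auto simp: I2_def half_ups_def)
      show "real (num_tilings_reg (I2 - R \<times> {k0 + 2}) J2) = det_val n (map even_row (sorted_list_of_set R))"
        if "R \<subseteq> {0..<int L'}" "n = 0 \<Longrightarrow> R = {}" for R
        unfolding I2_def J2_def by (rule Suc.IH) (use that L Suc.prems in auto)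
    qed (use fin I2 J2 S' Suc.prems in auto)
    moreover have "({0..int L'} - S') \<times> {k0 + 2 - 1} \<union> (I2 - {} \<times> {k0 + 2}) = I1 - S' \<times> {k0 + 1}"
      using I2 by (force simp: I1_def)
    ultimately show ?thesis by (simp add: J1_def)
  qed
  have "real (num_tilings_reg (({0..<int L} - S) \<times> {k0 + 1 - 1} \<union> (I1 - {} \<times> {k0 + 1})) ({0..<int L} \<times> {k0 + 1} \<union> J1)) =
      det_val (Suc n) (map even_row (sorted_list_of_set S) @ map odd_row (sorted_list_of_set {}))"
  proof (rule num_tilings_even_row[where L = L])
    show "m \<ge> k0 + 1" if "(i, m) \<in> I1" for i m using that I2 by (force simp: I1_def)
    show "m \<ge> k0 + 1 + 1" if "(i, m) \<in> J1" for i m using that J2 by (force simp: J1_def)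
    show "{0..<int L} \<times> {k0 + 1} \<subseteq> I1" by (auto simp: I1_def L)
    show "real (num_tilings_reg (I1 - R \<times> {k0 + 1}) J1) = det_val (Suc n) (map odd_row (sorted_list_of_set R))"
      if "R \<subseteq> {0..<int L}" for R
      by (rule odd) (use that L in auto)
  qed (use fin Suc.prems in auto)
  moreover have "({0..<int L} - S) \<times> {k0 + 1 - 1} \<union> (I1 - {} \<times> {k0 + 1}) = half_ups (Suc n) k0 L - S \<times> {k0}"
  proof -
    have "half_ups (Suc n) k0 L = {0..<int L} \<times> {k0} \<union> I1"
    proof (rule Set.set_eqI, simp only: split_paired_all)
      fix i k
      consider "k < k0" | "k = k0" | "k = k0 + 1" | "k \<ge> k0 + 2" by linarith
      then show "(i, k) \<in> half_ups (Suc n) k0 L \<longleftrightarrow> (i, k) \<in> {0..<int L} \<times> {k0} \<union> I1"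
      proof cases
        case 4
        have "(k - k0) div 2 = (k - (k0 + 2)) div 2 + 1" by presburger
        then show ?thesis using 4 by (auto simp: half_ups_def I1_def I2_def L)
      qed (auto simp: half_ups_def I1_def I2_def L)
    qed
    moreover have "I1 \<inter> S \<times> {k0} = {}" using I2 by (force simp: I1_def)
    ultimately show ?thesis by auto
  qed
  moreover have "{0..<int L} \<times> {k0 + 1} \<union> J1 = half_dns (Suc n) k0 L"
  proof (rule Set.set_eqI, simp only: split_paired_all)
    fix i k
    consider "k \<le> k0" | "k = k0 + 1" | "k = k0 + 2" | "k \<ge> k0 + 3" by linarith
    then show "(i, k) \<in> {0..<int L} \<times> {k0 + 1} \<union> J1 \<longleftrightarrow> (i, k) \<in> half_dns (Suc n) k0 L"
    proof cases
      case 4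
      have "(k - k0) div 2 = (k - (k0 + 2)) div 2 + 1" by presburger
      then show ?thesis using 4 by (auto simp: half_dns_def J1_def J2_def L)
    qed (auto simp: half_dns_def J1_def J2_def L)
  qed
  ultimately show ?case by simp
qed

section \<open>The product formula for dented half hexagons\<close>

definition Delta :: "nat set \<Rightarrow> real" where
  "Delta D = (\<Prod>s\<in>D. real s) * (\<Prod>s\<in>D. \<Prod>t\<in>{t\<in>D. t < s}. real s ^ 2 - real t ^ 2)"

text \<open>Dents are numbered from 1, as in the Weyl product, but edges from 0.\<close>

definition edge :: "nat \<Rightarrow> int" where
  "edge s = int s - 1"

lemma inj_edge: "inj edge"
  by (auto simp: edge_def inj_def)

lemma Delta_pos:
  assumes "finite D" "0 \<notin> D"
  shows "Delta D > 0"
  unfolding Delta_def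
proof (intro mult_pos_pos prod_pos)
  fix s t assume "t \<in> {t\<in>D. t < s}"
  then show "0 < real s ^ 2 - real t ^ 2" by (simp add: power_strict_mono)
qed (use assms in \<open>auto intro: gr0I\<close>)

lemma det_scale:
  fixes f :: "nat \<Rightarrow> nat \<Rightarrow> real"
  shows "det (mat n n (\<lambda>(i, j). r i * c j * f i j)) = (\<Prod>i<n. r i) * (\<Prod>j<n. c j) * det (mat n n (\<lambda>(i, j). f i j))"
  unfolding det_mat_leibniz sum_distrib_left
proof (rule sum.cong[OF refl])
  fix p assume "p \<in> {p. p permutes {0..<n}}"
  then have "(\<Prod>i=0..<n. c (p i)) = (\<Prod>j<n. c j)"
    using prod.permute[of p "{0..<n}" c] by (simp add: o_def atLeast0LessThan)
  then show "signof p * (\<Prod>i=0..<n. r i * c (p i) * f i (p i)) =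
     (\<Prod>i<n. r i) * (\<Prod>j<n. c j) * (signof p * (\<Prod>i=0..<n. f i (p i)))"
    by (simp add: prod.distrib atLeast0LessThan mult_ac)
qed

text \<open>The binomial coefficient is a product of 2j + 1 consecutive integers centred at s;
  pairing s + l with s - l leaves s and the factors s^2 - l^2.\<close>

lemma even_row_edge:
  "even_row (edge s) j = real s * (1 / fact (2 * j + 1)) * poly (lower_poly 0 j) (real s ^ 2)"
proof -
  have "(\<Prod>i<2 * j + 1. real s + real j - real i) = real s * poly (lower_poly 0 j) (real s ^ 2)"
  proof (induction j)
    case 0
    then show ?case by (simp add: lower_poly_def)
  next
    case (Suc j)
    have e: "2 * Suc j + 1 = Suc (Suc (2 * j + 1))" by simp
    have "(\<Prod>i<2 * Suc j + 1. real s + real (Suc j) - real i) =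
       (real s + real (Suc j)) * ((\<Prod>i<2 * j + 1. real s + real j - real i) * (real s - real (Suc j)))"
      unfolding e prod.lessThan_Suc_shift[of _ "Suc (2 * j + 1)"] prod.lessThan_Suc[of _ "2 * j + 1"] o_def
      by (simp add: algebra_simps)
    then show ?case unfolding Suc poly_lower_poly_Suc
      by (simp add: power2_eq_square algebra_simps)
  qed
  then show ?thesis
    unfolding even_row_def gbinomial_prod_rev edge_def atLeast0LessThan
    by (simp add: algebra_simps)
qed

lemma prod_sorted_pairs:
  fixes g :: "nat \<Rightarrow> nat \<Rightarrow> real"
  assumes "finite D"
  defines "ys \<equiv> sorted_list_of_set D"
  shows "(\<Prod>j<card D. \<Prod>i<j. g (ys ! i) (ys ! j)) = (\<Prod>s\<in>D. \<Prod>t\<in>{t\<in>D. t < s}. g t s)"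
proof -
  have bij: "bij_betw ((!) ys) {..<card D} D"
    using assms by (intro bij_betw_nth) auto
  have sorted: "ys ! i < ys ! j \<longleftrightarrow> i < j" if "i < card D" "j < card D" for i j
  proof -
    have len: "length ys = card D" by (simp add: ys_def)
    have sm: "ys ! i < ys ! j" if "i < j" "j < card D" for i j
      using that sorted_wrt_nth_less[of "(<)" ys i j] strict_sorted_list_of_set[of D] len by (simp add: ys_def)
    show ?thesis using sm[of i j] sm[of j i] that by (cases i j rule: linorder_cases) auto
  qed
  have "(\<Prod>s\<in>D. \<Prod>t\<in>{t\<in>D. t < s}. g t s) = (\<Prod>j<card D. \<Prod>t\<in>{t\<in>D. t < ys ! j}. g t (ys ! j))"
    by (rule prod.reindex_bij_betw[OF bij, symmetric])
  also have "\<dots> = (\<Prod>j<card D. \<Prod>i<j. g (ys ! i) (ys ! j))"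
  proof (rule prod.cong[OF refl])
    fix j assume j: "j \<in> {..<card D}"
    have "bij_betw ((!) ys) {..<j} {t\<in>D. t < ys ! j}"
    proof (rule bij_betw_imageI)
      show "inj_on ((!) ys) {..<j}" using bij j by (auto simp: bij_betw_def inj_on_def)
      show "(!) ys ` {..<j} = {t\<in>D. t < ys ! j}"
      proof (intro equalityI subsetI)
        fix t assume t: "t \<in> {t\<in>D. t < ys ! j}"
        then obtain i where "i < card D" "t = ys ! i" using bij by (auto simp: bij_betw_def)
        then show "t \<in> (!) ys ` {..<j}" using t sorted[of i j] j by auto
      qed (use bij j sorted in \<open>auto simp: bij_betw_def\<close>)
    qed
    then show "(\<Prod>t\<in>{t\<in>D. t < ys ! j}. g t (ys ! j)) = (\<Prod>i<j. g (ys ! i) (ys ! j))"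
      by (rule prod.reindex_bij_betw[symmetric])
  qed
  finally show ?thesis ..
qed

text \<open>After s is taken out of the rows and 1/(2j + 1)! out of the columns, the entries are
  monic polynomials in s^2, and the determinant is a Vandermonde product.\<close>

lemma num_tilings_half_hexagon_product:
  assumes "n \<le> L" "D \<subseteq> {1..L}" "n = 0 \<Longrightarrow> D = {}"
  shows "real (num_tilings_reg (half_ups n 0 L - (edge ` D) \<times> {0}) (half_dns n 0 L)) =
    (if card D = n then Delta D / (\<Prod>i<n. fact (2 * i + 1)) else 0)"
proof -
  have finD: "finite D" using assms finite_subset by blast
  define ys where "ys = sorted_list_of_set D"
  have len: "length ys = card D" by (simp add: ys_def)
  have sort: "sorted_list_of_set (edge ` D) = map edge ys"
  proof (rule sorted_distinct_set_unique)
    have "sorted ys" by (simp add: ys_def)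
    then show "sorted (map edge ys)"
      by (auto simp: sorted_map edge_def elim: sorted_wrt_mono_rel[rotated])
    show "distinct (map edge ys)" by (simp add: distinct_map ys_def inj_on_subset[OF inj_edge])
  qed (use finD in \<open>auto simp: ys_def\<close>)
  have "real (num_tilings_reg (half_ups n 0 L - (edge ` D) \<times> {0}) (half_dns n 0 L)) =
     det_val n (map even_row (sorted_list_of_set (edge ` D)))"
    by (rule num_tilings_half_hexagon) (use assms in \<open>auto simp: edge_def\<close>)
  also have "\<dots> = (if card D = n then Delta D / (\<Prod>i<n. fact (2 * i + 1)) else 0)"
  proof (cases "card D = n")
    case True
    have "det_rows (map even_row (map edge ys)) = det (mat n n (\<lambda>(i, j). real (ys ! i) * (1 / fact (2 * j + 1))
        * poly (lower_poly 0 j) (real (ys ! i) ^ 2)))"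
      unfolding det_rows_def using len True
      by (intro arg_cong[where f = det] eq_matI) (auto simp: even_row_edge)
    also have "\<dots> = (\<Prod>i<n. real (ys ! i)) * (\<Prod>j<n. 1 / fact (2 * j + 1)) *
        det (mat n n (\<lambda>(i, j). poly (lower_poly 0 j) (real (ys ! i) ^ 2)))"
      by (rule det_scale)
    also have "det (mat n n (\<lambda>(i, j). poly (lower_poly 0 j) (real (ys ! i) ^ 2))) =
        (\<Prod>j<n. \<Prod>i<j. real (ys ! j) ^ 2 - real (ys ! i) ^ 2)"
      by (rule det_monic_polys) (use degree_prod_linear[of 1] in \<open>auto simp: lower_poly_def\<close>)
    also have "\<dots> = (\<Prod>s\<in>D. \<Prod>t\<in>{t\<in>D. t < s}. real s ^ 2 - real t ^ 2)"
      using prod_sorted_pairs[OF finD, of "\<lambda>t s. real s ^ 2 - real t ^ 2"] True by (simp add: ys_def)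
    also have "(\<Prod>i<n. real (ys ! i)) = (\<Prod>s\<in>D. real s)"
    proof -
      have "bij_betw ((!) ys) {..<n} D"
        using finD True unfolding ys_def by (intro bij_betw_nth) auto
      then show ?thesis by (rule prod.reindex_bij_betw)
    qed
    finally show ?thesis using True len
      by (simp add: sort det_val_def Delta_def prod_dividef)
  next
    case False
    then show ?thesis by (simp add: sort det_val_def len)
  qed
  finally show ?thesis .
qed

section \<open>How the two Weyl products depend on the crossing set\<close>

lemma Delta_Un:
  assumes "finite A" "finite B" "A \<inter> B = {}"
  shows "Delta (A \<union> B) = Delta A * Delta B * (\<Prod>s\<in>A. \<Prod>t\<in>B. \<bar>real s ^ 2 - real t ^ 2\<bar>)"
proof -
  define f where "f s t = real s ^ 2 - real t ^ 2" for s t :: nat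
  have f_abs: "t < s \<Longrightarrow> f s t = \<bar>f s t\<bar>" "\<bar>f s t\<bar> = \<bar>f t s\<bar>" for s t
    by (auto simp: f_def abs_minus_commute power_mono)
  have split: "(\<Prod>t\<in>{t\<in>A \<union> B. t < s}. f s t) = (\<Prod>t\<in>{t\<in>A. t < s}. f s t) * (\<Prod>t\<in>{t\<in>B. t < s}. f s t)" for s
  proof -
    have "{t\<in>A \<union> B. t < s} = {t\<in>A. t < s} \<union> {t\<in>B. t < s}" by auto
    then show ?thesis using assms by (simp add: prod.union_disjoint disjoint_iff)
  qed
  have "(\<Prod>s\<in>A \<union> B. \<Prod>t\<in>{t\<in>A \<union> B. t < s}. f s t) =
    (\<Prod>s\<in>A. \<Prod>t\<in>{t\<in>A. t < s}. f s t) * (\<Prod>s\<in>A. \<Prod>t\<in>{t\<in>B. t < s}. f s t)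
    * ((\<Prod>s\<in>B. \<Prod>t\<in>{t\<in>A. t < s}. f s t) * (\<Prod>s\<in>B. \<Prod>t\<in>{t\<in>B. t < s}. f s t))"
    unfolding split prod.distrib prod.union_disjoint[OF assms] by (simp only: mult_ac)
  also have "(\<Prod>s\<in>B. \<Prod>t\<in>{t\<in>A. t < s}. f s t) = (\<Prod>s\<in>B. \<Prod>t\<in>{t\<in>A. t < s}. \<bar>f s t\<bar>)"
    by (intro prod.cong refl) (auto intro: f_abs)
  also have "\<dots> = (\<Prod>t\<in>A. \<Prod>s\<in>{s\<in>B. t < s}. \<bar>f t s\<bar>)"
    using prod.swap_restrict[OF assms(2,1), of "\<lambda>s t. \<bar>f s t\<bar>" "\<lambda>s t. t < s"] f_abs(2) by simp
  also have "(\<Prod>s\<in>A. \<Prod>t\<in>{t\<in>B. t < s}. f s t) = (\<Prod>s\<in>A. \<Prod>t\<in>{t\<in>B. t < s}. \<bar>f s t\<bar>)"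
    by (intro prod.cong refl) (auto intro: f_abs)
  finally have 1: "(\<Prod>s\<in>A \<union> B. \<Prod>t\<in>{t\<in>A \<union> B. t < s}. f s t) =
    (\<Prod>s\<in>A. \<Prod>t\<in>{t\<in>A. t < s}. f s t) * (\<Prod>s\<in>B. \<Prod>t\<in>{t\<in>B. t < s}. f s t) *
    (\<Prod>s\<in>A. (\<Prod>t\<in>{t\<in>B. t < s}. \<bar>f s t\<bar>) * (\<Prod>t\<in>{t\<in>B. s < t}. \<bar>f s t\<bar>))"
    by (simp add: prod.distrib mult_ac)
  have 2: "(\<Prod>t\<in>{t\<in>B. t < s}. \<bar>f s t\<bar>) * (\<Prod>t\<in>{t\<in>B. s < t}. \<bar>f s t\<bar>) = (\<Prod>t\<in>B. \<bar>f s t\<bar>)" if "s \<in> A" for s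
  proof -
    have "t < s \<or> s < t" if "t \<in> B" for t using assms(3) \<open>s \<in> A\<close> that by (cases s t rule: linorder_cases) auto
    then have "B = {t\<in>B. t < s} \<union> {t\<in>B. s < t}" by blast
    then have "(\<Prod>t\<in>B. \<bar>f s t\<bar>) = (\<Prod>t\<in>{t\<in>B. t < s} \<union> {t\<in>B. s < t}. \<bar>f s t\<bar>)" by simp
    also have "\<dots> = (\<Prod>t\<in>{t\<in>B. t < s}. \<bar>f s t\<bar>) * (\<Prod>t\<in>{t\<in>B. s < t}. \<bar>f s t\<bar>)"
      using assms(2) by (intro prod.union_disjoint) auto
    finally show ?thesis ..
  qed
  have 3: "(\<Prod>s\<in>A. (\<Prod>t\<in>{t\<in>B. t < s}. \<bar>f s t\<bar>) * (\<Prod>t\<in>{t\<in>B. s < t}. \<bar>f s t\<bar>)) = (\<Prod>s\<in>A. \<Prod>t\<in>B. \<bar>f s t\<bar>)"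
    using 2 by (intro prod.cong refl) auto
  show ?thesis
    unfolding Delta_def 1[unfolded 3, unfolded f_def] prod.union_disjoint[OF assms] by (simp only: mult_ac)
qed

lemma Delta_square:
  assumes "finite D"
  shows "Delta D * Delta D = (\<Prod>s\<in>D. real s ^ 2) * (\<Prod>s\<in>D. \<Prod>t\<in>D - {s}. \<bar>real s ^ 2 - real t ^ 2\<bar>)"
proof -
  define f where "f s t = \<bar>real s ^ 2 - real t ^ 2\<bar>" for s t :: nat
  have sym: "f s t = f t s" for s t by (simp add: f_def abs_minus_commute)
  have "(\<Prod>t\<in>D - {s}. f s t) = (\<Prod>t\<in>{t\<in>D. t < s}. f s t) * (\<Prod>t\<in>{t\<in>D. s < t}. f s t)" for s
  proof -
    have "D - {s} = {t\<in>D. t < s} \<union> {t\<in>D. s < t}" by (auto simp: neq_iff)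
    then have "(\<Prod>t\<in>D - {s}. f s t) = (\<Prod>t\<in>{t\<in>D. t < s} \<union> {t\<in>D. s < t}. f s t)" by simp
    also have "\<dots> = (\<Prod>t\<in>{t\<in>D. t < s}. f s t) * (\<Prod>t\<in>{t\<in>D. s < t}. f s t)"
      using assms by (intro prod.union_disjoint) auto
    finally show ?thesis .
  qed
  then have "(\<Prod>s\<in>D. \<Prod>t\<in>D - {s}. f s t) =
     (\<Prod>s\<in>D. \<Prod>t\<in>{t\<in>D. t < s}. f s t) * (\<Prod>s\<in>D. \<Prod>t\<in>{t\<in>D. s < t}. f s t)"
    by (simp add: prod.distrib)
  also have "(\<Prod>s\<in>D. \<Prod>t\<in>{t\<in>D. s < t}. f s t) = (\<Prod>s\<in>D. \<Prod>t\<in>{t\<in>D. t < s}. f s t)"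
    using prod.swap_restrict[OF assms assms, of f "\<lambda>s t. s < t"] sym by simp
  finally have 1: "(\<Prod>s\<in>D. \<Prod>t\<in>D - {s}. f s t) =
     (\<Prod>s\<in>D. \<Prod>t\<in>{t\<in>D. t < s}. f s t) * (\<Prod>s\<in>D. \<Prod>t\<in>{t\<in>D. t < s}. f s t)" .
  have 2: "(\<Prod>s\<in>D. \<Prod>t\<in>{t\<in>D. t < s}. real s ^ 2 - real t ^ 2) = (\<Prod>s\<in>D. \<Prod>t\<in>{t\<in>D. t < s}. f s t)"
    by (intro prod.cong refl) (auto simp: f_def power_mono)
  show ?thesis
    using 1 unfolding Delta_def 2 by (simp add: f_def power2_eq_square prod.distrib mult_ac)
qed

text \<open>The weight is the interaction of s with all positions outside the gap; the factor s^2
  consists of one s from each Weyl product. Starting from \<open>racah_weight 0 g g s\<close>, which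
  is s^2, the shift rules add the positions of the two intervals one at a time.\<close>

lemma racah_weight_eq_prod:
  assumes s: "a < s" "s \<le> g"
  shows "racah_weight a g (g + M) s =
    real s ^ 2 * (\<Prod>t\<in>{1..a} \<union> {g<..g + M}. \<bar>real s ^ 2 - real t ^ 2\<bar>)"
proof -
  have lower: "racah_weight a g g s = real s ^ 2 * (\<Prod>t\<in>{1..a}. \<bar>real s ^ 2 - real t ^ 2\<bar>)"
    using s(1)
  proof (induction a)
    case 0
    then obtain r where "s = Suc r" by (cases s) auto
    then show ?case by (simp add: racah_weight_def power2_eq_square)
  next
    case (Suc a)
    have "{1..Suc a} = insert (Suc a) {1..a}" by auto
    moreover have "\<bar>real s ^ 2 - real (Suc a) ^ 2\<bar> = real s ^ 2 - real (Suc a) ^ 2"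
      using Suc.prems by (intro abs_of_nonneg) (simp del: of_nat_Suc add: power_mono)
    moreover have "racah_weight (a + 1) g g s = (real s ^ 2 - real (a + 1) ^ 2) * racah_weight a g g s"
      by (rule racah_weight_lower) (use Suc.prems in simp)
    ultimately show ?case using Suc by (simp del: of_nat_Suc)
  qed
  have top: "racah_weight a g (g + M) s = racah_weight a g g s * (\<Prod>t\<in>{g<..g + M}. \<bar>real s ^ 2 - real t ^ 2\<bar>)"
  proof (induction M)
    case 0
    then show ?case by simp
  next
    case (Suc M)
    have "{g<..g + Suc M} = insert (g + M + 1) {g<..g + M}" by auto
    moreover have "\<bar>real s ^ 2 - real (g + M + 1) ^ 2\<bar> = real (g + M + 1) ^ 2 - real s ^ 2"
      using s(2) by (subst abs_minus_commute, intro abs_of_nonneg) (simp del: of_nat_Suc of_nat_add add: power_mono)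
    moreover have "racah_weight a g (g + M + 1) s = (real (g + M + 1) ^ 2 - real s ^ 2) * racah_weight a g (g + M) s"
      by (rule racah_weight_top) (use s(2) in simp)
    ultimately show ?case using Suc by (simp del: of_nat_Suc of_nat_add)
  qed
  have "(\<Prod>t\<in>{1..a} \<union> {g<..g + M}. \<bar>real s ^ 2 - real t ^ 2\<bar>) =
     (\<Prod>t\<in>{1..a}. \<bar>real s ^ 2 - real t ^ 2\<bar>) * (\<Prod>t\<in>{g<..g + M}. \<bar>real s ^ 2 - real t ^ 2\<bar>)"
    using s by (intro prod.union_disjoint) auto
  then show ?thesis using lower top by simp
qed

text \<open>Each position outside the gap lies in exactly one of \<open>U\<close> and
  \<open>V\<close>, so the cross factors with S form a product over their union, that is the weight,
  while the two factors \<open>Delta S\<close> give the squared Vandermonde product. The way the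
  positions are split survives only in the constant.\<close>

lemma sum_Delta_Delta:
  fixes a x y M :: nat
  defines "g \<equiv> a + x + y"
  assumes fin: "finite U" "finite V" and UV: "U \<inter> V = {}" "U \<union> V = {1..a} \<union> {g<..g + M}"
  shows "(\<Sum>S | S \<subseteq> {a<..g} \<and> card S = y. Delta (S \<union> U) * Delta (S \<union> V)) =
    Delta U * Delta V * (\<Prod>j<y. selberg_factor a x y M j)"
proof -
  have "Delta (S \<union> U) * Delta (S \<union> V) = Delta U * Delta V * ((\<Prod>s\<in>S. \<Prod>t\<in>S - {s}. \<bar>real s ^ 2 - real t ^ 2\<bar>)
      * (\<Prod>s\<in>S. racah_weight a g (g + M) s))" if S: "S \<subseteq> {a<..g}" for S
  proof -
    have finS: "finite S" using S finite_subset by blast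
    have dis: "S \<inter> (U \<union> V) = {}" using S unfolding UV(2) by auto
    have w: "racah_weight a g (g + M) s = real s ^ 2 * (\<Prod>t\<in>U. \<bar>real s ^ 2 - real t ^ 2\<bar>) * (\<Prod>t\<in>V. \<bar>real s ^ 2 - real t ^ 2\<bar>)"
      if "s \<in> S" for s
    proof -
      have "racah_weight a g (g + M) s = real s ^ 2 * (\<Prod>t\<in>U \<union> V. \<bar>real s ^ 2 - real t ^ 2\<bar>)"
        unfolding UV(2) by (rule racah_weight_eq_prod) (use S that in auto)
      also have "(\<Prod>t\<in>U \<union> V. \<bar>real s ^ 2 - real t ^ 2\<bar>) =
         (\<Prod>t\<in>U. \<bar>real s ^ 2 - real t ^ 2\<bar>) * (\<Prod>t\<in>V. \<bar>real s ^ 2 - real t ^ 2\<bar>)"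
        by (rule prod.union_disjoint) (use fin UV in auto)
      finally show ?thesis by simp
    qed
    have "Delta (S \<union> U) * Delta (S \<union> V) = Delta U * Delta V * (Delta S * Delta S) *
       ((\<Prod>s\<in>S. \<Prod>t\<in>U. \<bar>real s ^ 2 - real t ^ 2\<bar>) * (\<Prod>s\<in>S. \<Prod>t\<in>V. \<bar>real s ^ 2 - real t ^ 2\<bar>))"
      using Delta_Un[OF finS fin(1)] Delta_Un[OF finS fin(2)] dis by (auto simp: Int_Un_distrib)
    also have "\<dots> = Delta U * Delta V * ((\<Prod>s\<in>S. \<Prod>t\<in>S - {s}. \<bar>real s ^ 2 - real t ^ 2\<bar>)
       * (\<Prod>s\<in>S. real s ^ 2 * (\<Prod>t\<in>U. \<bar>real s ^ 2 - real t ^ 2\<bar>) * (\<Prod>t\<in>V. \<bar>real s ^ 2 - real t ^ 2\<bar>)))"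
      unfolding Delta_square[OF finS] by (simp add: prod.distrib mult_ac)
    also have "(\<Prod>s\<in>S. real s ^ 2 * (\<Prod>t\<in>U. \<bar>real s ^ 2 - real t ^ 2\<bar>) * (\<Prod>t\<in>V. \<bar>real s ^ 2 - real t ^ 2\<bar>)) =
       (\<Prod>s\<in>S. racah_weight a g (g + M) s)"
      by (rule prod.cong) (use w in auto)
    finally show ?thesis .
  qed
  then have "(\<Sum>S | S \<subseteq> {a<..g} \<and> card S = y. Delta (S \<union> U) * Delta (S \<union> V)) = Delta U * Delta V *
     (\<Sum>S | S \<subseteq> {a<..g} \<and> card S = y. (\<Prod>s\<in>S. \<Prod>t\<in>S - {s}. \<bar>real s ^ 2 - real t ^ 2\<bar>)
      * (\<Prod>s\<in>S. racah_weight a g (g + M) s))"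
    unfolding sum_distrib_left by (intro sum.cong) auto
  then show ?thesis unfolding g_def racah_selberg .
qed

section \<open>Cutting and polygons\<close>

lemma up_in_triangles_in: "up i k \<in> triangles_in P \<longleftrightarrow>
   (of_int i + zigzag k, k) \<in> P \<and> (of_int i + zigzag k + 1, k) \<in> P \<and> (of_int i + zigzag k + 1/2, k + 1) \<in> P"
  by (auto simp: triangles_in_def) (auto simp: up_def up_triangle_def)

lemma dn_in_triangles_in: "dn i k \<in> triangles_in P \<longleftrightarrow>
   (of_int i + zigzag k, k) \<in> P \<and> (of_int i + zigzag k + 1, k) \<in> P \<and> (of_int i + zigzag k + 1/2, k - 1) \<in> P"
  by (auto simp: triangles_in_def) (auto simp: dn_def down_triangle_def)

lemma triangles_in_unit: "triangles_in P \<subseteq> unit_triangles"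
  by (auto simp: triangles_in_def)

lemma int_cases_parity:
  fixes k :: int
  obtains r where "k = 2 * r" | r where "k = 2 * r + 1"
  by (metis evenE oddE)

definition upper_polygon :: "nat \<Rightarrow> nat \<Rightarrow> point set" where
  "upper_polygon n L = {(u, k) | u k. 0 \<le> k \<and> k \<le> 2 * int n \<and> zigzag k \<le> u \<and> u \<le> real L - of_int k / 2}"

lemma upper_polygon_up: "up i k \<in> triangles_in (upper_polygon n L) \<longleftrightarrow> (i, k) \<in> half_ups n 0 L"
  by (cases k rule: int_cases_parity; simp add: up_in_triangles_in upper_polygon_def half_ups_def zigzag_def add_divide_distrib)
    (safe; linarith)+

lemma upper_polygon_dn: "dn i k \<in> triangles_in (upper_polygon n L) \<longleftrightarrow> (i, k) \<in> half_dns n 0 L"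
  by (cases k rule: int_cases_parity; simp add: dn_in_triangles_in upper_polygon_def half_dns_def zigzag_def add_divide_distrib diff_divide_distrib)
    (safe; linarith)+

text \<open>In the numbering from the zigzag the west side of a hole recedes by (k + 1) div 2 and
  the east side by k div 2. Both triangles at an edge lie in the hole together, except on its base
  line, where only the up-pointing one does.\<close>

definition in_hole :: "nat \<Rightarrow> nat \<Rightarrow> int \<Rightarrow> int \<Rightarrow> bool" where
  "in_hole p q i k \<longleftrightarrow> int p + (k + 1) div 2 \<le> i \<and> i < int q - k div 2"

lemma up_hole_up: "up i k \<in> up_hole p q \<longleftrightarrow> 0 \<le> k \<and> in_hole p q i k"
  by (cases k rule: int_cases_parity; simp add: up_in_triangles_in up_hole_def in_hole_def zigzag_def add_divide_distrib)
    (safe; linarith)+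

lemma up_hole_dn: "dn i k \<in> up_hole p q \<longleftrightarrow> 1 \<le> k \<and> in_hole p q i k"
  by (cases k rule: int_cases_parity; simp add: dn_in_triangles_in up_hole_def in_hole_def zigzag_def add_divide_distrib diff_divide_distrib)
    (safe; linarith)+

lemma triangles_in_flip:
  "up i k \<in> triangles_in {(u, - k) | u k. P u k} \<longleftrightarrow> dn i (- k) \<in> triangles_in {(u, k) | u k. P u k}"
  "dn i k \<in> triangles_in {(u, - k) | u k. P u k} \<longleftrightarrow> up i (- k) \<in> triangles_in {(u, k) | u k. P u k}"
proof -
  have flip: "(v, l) \<in> {(u, - k) | u k. P u k} \<longleftrightarrow> P v (- l)" for v l
    by (auto intro: exI[of _ "- l"])
  show "up i k \<in> triangles_in {(u, - k) | u k. P u k} \<longleftrightarrow> dn i (- k) \<in> triangles_in {(u, k) | u k. P u k}"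
    "dn i k \<in> triangles_in {(u, - k) | u k. P u k} \<longleftrightarrow> up i (- k) \<in> triangles_in {(u, k) | u k. P u k}"
    unfolding up_in_triangles_in dn_in_triangles_in flip by simp_all
qed

lemma down_hole_up: "up i k \<in> down_hole p q \<longleftrightarrow> 1 \<le> - k \<and> in_hole p q i (- k)"
  and down_hole_dn: "dn i k \<in> down_hole p q \<longleftrightarrow> 0 \<le> - k \<and> in_hole p q i (- k)"
  unfolding down_hole_def triangles_in_flip up_hole_up[symmetric] up_hole_dn[symmetric] up_hole_def by simp_all

definition lower_polygon :: "nat \<Rightarrow> nat \<Rightarrow> nat \<Rightarrow> point set" where
  "lower_polygon n L z = {(u, k) | u k. 0 \<le> k \<and> k \<le> 2 * int n \<and> zigzag k \<le> u \<and>
     u \<le> real L + of_int k / 2 \<and> u \<le> real (L + z) - of_int k / 2}"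

text \<open>The bend in the eastern boundary disappears when the base is lengthened to L + z: the
  missing corner is then one more triangular hole, with base from L to L + z.\<close>

lemma lower_polygon_up: "up i k \<in> triangles_in (lower_polygon n L z) \<longleftrightarrow>
    (i, k) \<in> half_ups n 0 (L + z) \<and> \<not> in_hole L (L + z) i k"
  by (cases k rule: int_cases_parity; simp add: up_in_triangles_in lower_polygon_def half_ups_def in_hole_def zigzag_def add_divide_distrib)
    (safe; linarith)+

lemma lower_polygon_dn: "dn i k \<in> triangles_in (lower_polygon n L z) \<longleftrightarrow>
    (i, k) \<in> half_dns n 0 (L + z) \<and> \<not> in_hole L (L + z) i k"
  by (cases k rule: int_cases_parity; simp add: dn_in_triangles_in lower_polygon_def half_dns_def in_hole_def zigzag_def add_divide_distrib diff_divide_distrib)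
    (safe; linarith)+

definition left_half :: "nat \<Rightarrow> point set" where
  "left_half a = {(u, k) | u k. 0 \<le> k \<and> u \<le> real a - of_int k / 2}"

lemma left_half_up: "up i k \<in> triangles_in (left_half a) \<longleftrightarrow> 0 \<le> k \<and> i < int a - k div 2"
  by (cases k rule: int_cases_parity; simp add: up_in_triangles_in left_half_def zigzag_def add_divide_distrib)
    (safe; linarith)+

lemma left_half_dn: "dn i k \<in> triangles_in (left_half a) \<longleftrightarrow> 1 \<le> k \<and> i < int a - k div 2"
  by (cases k rule: int_cases_parity; simp add: dn_in_triangles_in left_half_def zigzag_def add_divide_distrib diff_divide_distrib)
    (safe; linarith)+

section \<open>Cutting along the line, and holes as runs of dents\<close>

definition cut_row :: "int set \<Rightarrow> region set" where
  "cut_row S = (\<lambda>i. {up i 0, dn i 0}) ` S"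

text \<open>The triangles of a lozenge lie at edges on the same line or on consecutive lines, the
  up-pointing one lower. Given the ranges of the rows, a lozenge with one triangle on either side
  must therefore be vertical, on an edge of the line k = 0.\<close>

lemma num_tilings_cut:
  assumes fin: "finite I1" "finite J1" "finite I2" "finite J2"
    and I1: "\<And>i k. (i, k) \<in> I1 \<Longrightarrow> 0 \<le> k" and J1: "\<And>i k. (i, k) \<in> J1 \<Longrightarrow> 1 \<le> k"
    and I2: "\<And>i k. (i, k) \<in> I2 \<Longrightarrow> k \<le> - 1" and J2: "\<And>i k. (i, k) \<in> J2 \<Longrightarrow> k \<le> 0"
    and G: "\<And>i. i \<in> G \<longleftrightarrow> (i, 0) \<in> I1 \<and> (i, 0) \<in> J2"
  shows "num_tilings_reg (I1 \<union> I2) (J1 \<union> J2) = (\<Sum>S\<in>Pow G. num_tilings_reg (I1 - S \<times> {0}) J1 * num_tilings_reg I2 (J2 - S \<times> {0}))"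
proof -
  let ?E = "{d. is_lozenge d}"
  have inj: "inj (\<lambda>i. {up i 0, dn i 0})" by (auto simp: inj_def doubleton_eq_iff)
  have "num_tilings_reg (I1 \<union> I2) (J1 \<union> J2) = card (perfect_matchings ?E (reg I1 J1 \<union> reg I2 J2))"
    by (simp add: num_tilings_reg_def num_tilings_eq reg_Un)
  also have "\<dots> = (\<Sum>C\<in>Pow (cut_row G). card (perfect_matchings ?E (reg I1 J1 - \<Union>C))
      * card (perfect_matchings ?E (reg I2 J2 - \<Union>C)))"
  proof (rule card_perfect_matchings_cut)
    show "reg I1 J1 \<inter> reg I2 J2 = {}"
      using I1 I2 J1 J2 by (force elim!: reg_cases)
    show "{} \<notin> ?E" by (auto simp: is_lozenge_iff)
    show "cut_row G \<subseteq> ?E"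
    proof
      fix e assume "e \<in> cut_row G"
      then obtain i where "e = {up i 0, dn i 0}" by (auto simp: cut_row_def)
      moreover have "nbr i 0 i 0" by (simp add: nbr_def)
      ultimately show "e \<in> ?E" unfolding is_lozenge_iff by blast
    qed
    show "disjoint (cut_row G)" by (auto simp: cut_row_def disjoint_def)
    show "e \<subseteq> reg I1 J1 \<union> reg I2 J2 \<and> e \<inter> reg I1 J1 \<noteq> {} \<and> e \<inter> reg I2 J2 \<noteq> {}"
      if "e \<in> cut_row G" for e
    proof -
      obtain i where "i \<in> G" "e = {up i 0, dn i 0}" using \<open>e \<in> cut_row G\<close> by (auto simp: cut_row_def)
      then have "up i 0 \<in> e \<inter> reg I1 J1" "dn i 0 \<in> e \<inter> reg I2 J2" "e \<subseteq> reg I1 J1 \<union> reg I2 J2"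
        using G by auto
      then show ?thesis by blast
    qed
    show "e \<subseteq> reg I1 J1 \<or> e \<subseteq> reg I2 J2 \<or> e \<in> cut_row G"
      if e: "e \<in> ?E" "e \<subseteq> reg I1 J1 \<union> reg I2 J2" for e
    proof -
      obtain i k j l where d: "e = {up i k, dn j l}" and nbr: "nbr i k j l"
        using e(1) unfolding is_lozenge_iff mem_Collect_eq by blast
      have u: "(i, k) \<in> I1 \<or> (i, k) \<in> I2" and v: "(j, l) \<in> J1 \<or> (j, l) \<in> J2"
        using e(2) unfolding d by auto
      have lk: "l = k \<or> l = k + 1" using nbr by (auto simp: nbr_def)
      show ?thesis
      proof (cases "(i, k) \<in> I1")
        case True
        show ?thesis
        proof (cases "(j, l) \<in> J1")
          case True
          then show ?thesis using \<open>(i, k) \<in> I1\<close> by (simp add: d)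
        next
          case False
          then have "(j, l) \<in> J2" using v by simp
          then have "k = 0" "l = 0" using I1[OF True] J2[of j l] lk by auto
          moreover from this have "j = i" using nbr by (simp add: nbr_def)
          ultimately have "i \<in> G" "e = {up i 0, dn i 0}" using G True \<open>(j, l) \<in> J2\<close> d by auto
          then show ?thesis by (auto simp: cut_row_def)
        qed
      next
        case False
        then have "(i, k) \<in> I2" using u by simp
        moreover from this have "(j, l) \<in> J2" using v I2[of i k] J1[of j l] lk by auto
        ultimately show ?thesis by (simp add: d)
      qed
    qed
  qed (use fin in auto)
  also have "Pow (cut_row G) = cut_row ` Pow G"
    unfolding cut_row_def by (rule image_Pow_surj[OF refl, symmetric])
  also have "(\<Sum>C\<in>cut_row ` Pow G. card (perfect_matchings ?E (reg I1 J1 - \<Union>C))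
      * card (perfect_matchings ?E (reg I2 J2 - \<Union>C))) =
    (\<Sum>S\<in>Pow G. card (perfect_matchings ?E (reg I1 J1 - \<Union>(cut_row S)))
      * card (perfect_matchings ?E (reg I2 J2 - \<Union>(cut_row S))))"
  proof (subst sum.reindex)
    show "inj_on cut_row (Pow G)"
      unfolding cut_row_def using inj by (intro inj_onI) (simp add: inj_image_eq_iff)
  qed simp
  also have "\<dots> = (\<Sum>S\<in>Pow G. num_tilings_reg (I1 - S \<times> {0}) J1 * num_tilings_reg I2 (J2 - S \<times> {0}))"
  proof (rule sum.cong[OF refl])
    fix S assume "S \<in> Pow G"
    have U: "\<Union>(cut_row S) = reg (S \<times> {0}) (S \<times> {0})" by (auto simp: cut_row_def reg_def)
    have "J1 - S \<times> {0} = J1" "I2 - S \<times> {0} = I2" using J1 I2 by force+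
    then show "card (perfect_matchings ?E (reg I1 J1 - \<Union>(cut_row S))) * card (perfect_matchings ?E (reg I2 J2 - \<Union>(cut_row S)))
       = num_tilings_reg (I1 - S \<times> {0}) J1 * num_tilings_reg I2 (J2 - S \<times> {0})"
      unfolding U reg_diff by (simp add: num_tilings_reg_def num_tilings_eq)
  qed
  finally show ?thesis .
qed

text \<open>Here a is half the side of the half triangle cut off on the left; the pairs in \<open>P\<close> are the
  base intervals of the triangular holes.\<close>

definition removed :: "nat \<Rightarrow> (nat \<times> nat) set \<Rightarrow> int \<Rightarrow> int \<Rightarrow> bool" where
  "removed a P i k \<longleftrightarrow> 0 \<le> i \<and> i < int a - k div 2 \<or> (\<exists>(p, q)\<in>P. in_hole p q i k)"

text \<open>A hole has the effect of dents along its base, since its other triangles are then forced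
  to be matched among themselves. The bounds on \<open>P\<close> keep each hole inside the half
  hexagon.\<close>

lemma num_tilings_removed:
  assumes a: "a \<le> n" "n \<le> L" and P: "\<And>p q. (p, q) \<in> P \<Longrightarrow> q \<le> p + n \<and> q \<le> L"
  shows "num_tilings_reg ({(i, k)\<in>half_ups n 0 L. \<not> removed a P i k} - S \<times> {0}) {(i, k)\<in>half_dns n 0 L. \<not> removed a P i k} =
    num_tilings_reg (half_ups n 0 L - (S \<union> {i. removed a P i 0}) \<times> {0}) (half_dns n 0 L)"
proof -
  define T where "T k = {i. removed a P i k}" for k
  define I where "I = half_ups n 0 L - S \<times> {0}"
  have mem: "(i, l) \<in> half_ups n 0 L \<and> (i, l) \<in> half_dns n 0 L" if li: "l \<ge> 1" "i \<in> T l" for i l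
  proof -
    consider "0 \<le> i" "i < int a - l div 2" | p q where "(p, q) \<in> P" "in_hole p q i l"
      using li(2) by (auto simp: T_def removed_def)
    then show ?thesis
    proof cases
      case 1
      then show ?thesis using a li(1) by (auto simp: half_ups_def half_dns_def)
    next
      case 2
      then have "q \<le> p + n" "q \<le> L" "int p + (l + 1) div 2 \<le> i" "i < int q - l div 2"
        using P by (auto simp: in_hole_def)
      moreover from this have "l < int n"
        using li(1) by linarith
      ultimately show ?thesis using li(1) by (auto simp: half_ups_def half_dns_def)
    qed
  qed
  have closed: "i' \<in> T (l - 1)"
    if l: "l \<ge> 1" "i \<in> T l" and i': "i' \<in> {i, i + (if even l then 1 else - 1)}" "(i', l - 1) \<in> half_ups n 0 L" for i l i'
  proof -
    \<comment> \<open>At the zigzag the lower western neighbour can have index -1. It is outside the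
      half hexagon, so the half triangle on the left is closed under the neighbours that
      exist.\<close>
    have nn: "0 \<le> i'" using i'(2) by (auto simp: half_ups_def)
    consider "0 \<le> i" "i < int a - l div 2" | p q where "(p, q) \<in> P" "in_hole p q i l"
      using l(2) by (auto simp: T_def removed_def)
    then show ?thesis
    proof cases
      case 1
      have "i' < int a - (l - 1) div 2"
        using 1 i'(1) by (cases l rule: int_cases_parity) auto
      then show ?thesis using nn by (simp add: T_def removed_def)
    next
      case 2
      have "in_hole p q i' (l - 1)"
        using 2(2) i'(1) by (cases l rule: int_cases_parity) (auto simp: in_hole_def)
      then show ?thesis using 2(1) by (auto simp: T_def removed_def)
    qed
  qed
  have "num_tilings_reg (I - T 0 \<times> {0}) (half_dns n 0 L) =
     num_tilings_reg (I - {(i, k). 0 \<le> k \<and> i \<in> T k}) (half_dns n 0 L - {(i, k). 1 \<le> k \<and> i \<in> T k})"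
  proof (rule num_tilings_fill_holes)
    show "(i, l) \<in> I \<and> (i, l) \<in> half_dns n 0 L" if "l \<ge> 1" "i \<in> T l" for i l
      using mem[OF that] that(1) by (auto simp: I_def)
    show "i' \<in> T (l - 1)" if "l \<ge> 1" "i \<in> T l" "i' \<in> {i, i + (if even l then 1 else - 1)}" "(i', l - 1) \<in> I" for i l i'
      using closed[OF that(1-3)] that(4) by (auto simp: I_def)
  qed (auto simp: I_def)
  moreover have "I - T 0 \<times> {0} = half_ups n 0 L - (S \<union> {i. removed a P i 0}) \<times> {0}"
    by (auto simp: I_def T_def)
  moreover have "I - {(i, k). 0 \<le> k \<and> i \<in> T k} = {(i, k)\<in>half_ups n 0 L. \<not> removed a P i k} - S \<times> {0}"
    by (auto simp: I_def T_def half_ups_def)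
  moreover have "half_dns n 0 L - {(i, k). 1 \<le> k \<and> i \<in> T k} = {(i, k)\<in>half_dns n 0 L. \<not> removed a P i k}"
    by (auto simp: T_def half_dns_def)
  ultimately show ?thesis by simp
qed

section \<open>Holes and sequences\<close>

lemma removed_base:
  "{i. removed a P i 0} = edge ` ({1..a} \<union> (\<Union>(p, q)\<in>P. {p<..q}))"
proof (intro equalityI subsetI)
  fix i assume "i \<in> {i. removed a P i 0}"
  then consider "0 \<le> i" "i < int a" | p q where "(p, q) \<in> P" "int p \<le> i" "i < int q"
    by (auto simp: removed_def in_hole_def)
  then have "0 \<le> i \<and> nat (i + 1) \<in> {1..a} \<union> (\<Union>(p, q)\<in>P. {p<..q})"
  proof cases
    case (2 p q)
    then have "nat (i + 1) \<in> {p<..q}" by auto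
    moreover have "0 \<le> i" using 2(2) by linarith
    ultimately show ?thesis using 2(1) by blast
  qed auto
  then show "i \<in> edge ` ({1..a} \<union> (\<Union>(p, q)\<in>P. {p<..q}))"
    by (intro image_eqI[of _ _ "nat (i + 1)"]) (auto simp: edge_def)
next
  fix i assume "i \<in> edge ` ({1..a} \<union> (\<Union>(p, q)\<in>P. {p<..q}))"
  then consider s where "i = int s - 1" "s \<in> {1..a}" | p q s where "(p, q) \<in> P" "i = int s - 1" "s \<in> {p<..q}"
    by (auto simp: edge_def)
  then show "i \<in> {i. removed a P i 0}"
  proof cases
    case (2 p q s)
    then have "in_hole p q i 0" by (auto simp: in_hole_def)
    then show ?thesis using 2 by (auto simp: removed_def)
  qed (auto simp: removed_def)
qed

text \<open>This is the value \<open>Delta {1..n}\<close>, so that n dents at the west end leave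
  exactly one tiling.\<close>

definition odd_fact_prod :: "nat \<Rightarrow> real" where
  "odd_fact_prod n = (\<Prod>i<n. fact (2 * i + 1))"

lemma odd_fact_prod_nonzero [simp]: "odd_fact_prod n \<noteq> 0"
  by (simp add: odd_fact_prod_def del: fact_Suc)

lemma num_tilings_removed_product:
  assumes a: "a \<le> n" "n \<le> L" and P: "\<And>p q. (p, q) \<in> P \<Longrightarrow> q \<le> p + n \<and> q \<le> L"
    and S: "S \<subseteq> {1..L}" "n = 0 \<Longrightarrow> S = {}"
    and D: "D = {1..a} \<union> (\<Union>(p, q)\<in>P. {p<..q})"
  shows "real (num_tilings_reg ({(i, k)\<in>half_ups n 0 L. \<not> removed a P i k} - (edge ` S) \<times> {0})
      {(i, k)\<in>half_dns n 0 L. \<not> removed a P i k}) =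
    (if card (S \<union> D) = n then Delta (S \<union> D) / odd_fact_prod n else 0)"
proof -
  have DL: "D \<subseteq> {1..L}" using a P unfolding D by fastforce
  have D0: "D = {}" if "n = 0" using a P that unfolding D by fastforce
  have "edge ` S \<union> {i. removed a P i 0} = edge ` (S \<union> D)"
    unfolding removed_base D by (simp only: image_Un)
  moreover have "num_tilings_reg ({(i, k)\<in>half_ups n 0 L. \<not> removed a P i k} - (edge ` S) \<times> {0})
      {(i, k)\<in>half_dns n 0 L. \<not> removed a P i k} =
    num_tilings_reg (half_ups n 0 L - (edge ` S \<union> {i. removed a P i 0}) \<times> {0}) (half_dns n 0 L)"
    by (rule num_tilings_removed[OF a P])
  moreover have "real (num_tilings_reg (half_ups n 0 L - (edge ` (S \<union> D)) \<times> {0}) (half_dns n 0 L)) =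
    (if card (S \<union> D) = n then Delta (S \<union> D) / odd_fact_prod n else 0)"
    unfolding odd_fact_prod_def by (rule num_tilings_half_hexagon_product) (use a S DL D0 in auto)
  ultimately show ?thesis by simp
qed

section \<open>Blocks of positions cut out by partial sums\<close>

definition blocks :: "(nat \<Rightarrow> nat) \<Rightarrow> nat set \<Rightarrow> nat set" where
  "blocks P X = (\<Union>i\<in>X. {P (i - 1)<..P i})"

text \<open>The mirror image of \<open>blocks\<close>, measured from the east end L. In both, index
  0 gives an empty block, as 0 - 1 = 0 for naturals; so X can be the set of all even or all odd
  numbers.\<close>

definition rev_blocks :: "nat \<Rightarrow> (nat \<Rightarrow> nat) \<Rightarrow> nat set \<Rightarrow> nat set" where
  "rev_blocks L P X = (\<Union>i\<in>X. {L - P i<..L - P (i - 1)})"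

lemma block_disjoint:
  fixes P :: "nat \<Rightarrow> nat"
  assumes "mono P" "i \<noteq> j"
  shows "{P (i - 1)<..P i} \<inter> {P (j - 1)<..P j} = {}"
proof -
  have *: "{P (i - 1)<..P i} \<inter> {P (j - 1)<..P j} = {}" if "i < j" for i j
  proof -
    have "i \<le> j - 1" using that by simp
    then have "P i \<le> P (j - 1)" by (rule monoD[OF assms(1)])
    then show ?thesis by auto
  qed
  show ?thesis using *[of i j] *[of j i] assms(2) by (auto simp: neq_iff)
qed

lemma rev_block_disjoint:
  fixes P :: "nat \<Rightarrow> nat"
  assumes "mono P" "i \<noteq> j"
  shows "{L - P i<..L - P (i - 1)} \<inter> {L - P j<..L - P (j - 1)} = {}"
proof -
  have *: "{L - P i<..L - P (i - 1)} \<inter> {L - P j<..L - P (j - 1)} = {}" if "i < j" for i j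
  proof -
    have "i \<le> j - 1" using that by simp
    then have "P i \<le> P (j - 1)" by (rule monoD[OF assms(1)])
    then show ?thesis by auto
  qed
  show ?thesis using *[of i j] *[of j i] assms(2) by (auto simp: neq_iff)
qed

lemma blocks_disjoint:
  assumes "mono P" "X \<inter> Y = {}"
  shows "blocks P X \<inter> blocks P Y = {}" "rev_blocks L P X \<inter> rev_blocks L P Y = {}"
proof -
  have *: "i \<noteq> j" if "i \<in> X" "j \<in> Y" for i j using assms(2) that by auto
  show "blocks P X \<inter> blocks P Y = {}"
    unfolding blocks_def using block_disjoint[OF assms(1) *] by blast
  show "rev_blocks L P X \<inter> rev_blocks L P Y = {}"
    unfolding rev_blocks_def using rev_block_disjoint[OF assms(1) *] by blast
qed

lemma card_blocks:
  assumes "mono P" "finite X"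
  shows "card (blocks P X) = (\<Sum>i\<in>X. P i - P (i - 1))"
  unfolding blocks_def using assms block_disjoint[OF assms(1)]
  by (subst card_UN_disjoint) auto

lemma card_rev_blocks:
  assumes "mono P" "finite X" "\<And>i. i \<in> X \<Longrightarrow> P i \<le> L"
  shows "card (rev_blocks L P X) = (\<Sum>i\<in>X. P i - P (i - 1))"
proof -
  have "card (rev_blocks L P X) = (\<Sum>i\<in>X. card {L - P i<..L - P (i - 1)})"
    unfolding rev_blocks_def using assms(2) rev_block_disjoint[OF assms(1)]
    by (subst card_UN_disjoint) auto
  also have "\<dots> = (\<Sum>i\<in>X. P i - P (i - 1))"
  proof (rule sum.cong[OF refl])
    fix i assume i: "i \<in> X"
    have "P (i - 1) \<le> P i" using assms(1) by (simp add: monoD)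
    then show "card {L - P i<..L - P (i - 1)} = P i - P (i - 1)" using assms(3)[OF i] by simp
  qed
  finally show ?thesis .
qed

lemma blocks_interval:
  assumes "mono P"
  shows "blocks P {1..m} = {P 0<..P m}" "rev_blocks L P {1..m} = {L - P m<..L - P 0}"
proof -
  have "blocks P {1..m} = {P 0<..P m} \<and> rev_blocks L P {1..m} = {L - P m<..L - P 0}"
  proof (induction m)
    case 0
    then show ?case by (simp add: blocks_def rev_blocks_def)
  next
    case (Suc m)
    have "{1..Suc m} = insert (Suc m) {1..m}" by auto
    moreover have "P 0 \<le> P m" "P m \<le> P (Suc m)" using assms by (auto intro: monoD)
    ultimately show ?case using Suc by (auto simp: blocks_def rev_blocks_def)
  qed
  then show "blocks P {1..m} = {P 0<..P m}" "rev_blocks L P {1..m} = {L - P m<..L - P 0}" by auto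
qed

lemma partial_sum_0 [simp]: "partial_sum s 0 = 0"
  by (simp add: partial_sum_def)

lemma partial_sum_Suc: "partial_sum s (Suc k) = partial_sum s k + term_of s (Suc k)"
  by (simp add: partial_sum_def)

lemma mono_partial_sum: "mono (partial_sum s)"
  by (rule mono_iff_le_Suc[THEN iffD2]) (simp add: partial_sum_Suc)

lemma partial_sum_diff:
  assumes "i \<ge> 1"
  shows "partial_sum s i = partial_sum s (i - 1) + term_of s i"
  using assms partial_sum_Suc[of s "i - 1"] by simp

lemma partial_sum_full:
  assumes "k \<ge> length s"
  shows "partial_sum s k = sum_list s"
proof -
  have "partial_sum s k = (\<Sum>i\<in>{1..length s}. term_of s i)"
    unfolding partial_sum_def by (rule sum.mono_neutral_right) (use assms in \<open>auto simp: term_of_def\<close>)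
  also have "\<dots> = (\<Sum>i\<in>{0..<length s}. s ! i)"
    by (rule sum.reindex_bij_witness[of _ Suc "\<lambda>i. i - 1"]) (auto simp: term_of_def)
  finally show ?thesis by (simp add: sum_list_sum_nth)
qed

lemma partial_sum_le: "partial_sum s k \<le> sum_list s"
  using monoD[OF mono_partial_sum, of k "max k (length s)" s] partial_sum_full[of s "max k (length s)"] by simp

lemma odd_sum_plus_even_sum: "odd_sum s + even_sum s = sum_list s"
proof -
  have "{1..length s} = {i\<in>{1..length s}. odd i} \<union> {i\<in>{1..length s}. even i}" by auto
  then have "partial_sum s (length s) = (\<Sum>i\<in>{i\<in>{1..length s}. odd i} \<union> {i\<in>{1..length s}. even i}. term_of s i)"
    unfolding partial_sum_def by (rule arg_cong)
  also have "\<dots> = odd_sum s + even_sum s"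
    unfolding odd_sum_def even_sum_def by (rule sum.union_disjoint) auto
  finally show ?thesis using partial_sum_full[of s "length s"] by simp
qed

lemma term_of_le:
  assumes "i \<ge> 1"
  shows "even i \<Longrightarrow> term_of s i \<le> even_sum s" "odd i \<Longrightarrow> term_of s i \<le> odd_sum s"
proof -
  have "term_of s i \<le> (\<Sum>i\<in>{i\<in>{1..length s}. Q i}. term_of s i)" if "Q i" for Q
  proof (cases "i \<le> length s")
    case True
    then show ?thesis using assms that by (intro member_le_sum) auto
  next
    case False
    then show ?thesis by (simp add: term_of_def)
  qed
  from this[of even] this[of odd]
  show "even i \<Longrightarrow> term_of s i \<le> even_sum s" "odd i \<Longrightarrow> term_of s i \<le> odd_sum s"
    by (auto simp: even_sum_def odd_sum_def)
qed

text \<open>Indices past the end of the sequence give empty blocks. The bound \<open>m\<close> may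
  lie below the length as long as no index of \<open>X\<close> falls in between; this matters where
  two sequences are merged at a common term.\<close>

lemma blocks_trunc:
  assumes "\<And>i. i \<in> X \<Longrightarrow> i > m \<Longrightarrow> i > length s"
  shows "blocks (partial_sum s) X = blocks (partial_sum s) {i\<in>{1..m}. i \<in> X}"
    "rev_blocks L (partial_sum s) X = rev_blocks L (partial_sum s) {i\<in>{1..m}. i \<in> X}"
proof -
  have "partial_sum s i = partial_sum s (i - 1)" if "i \<in> X" "i \<notin> {1..m}" for i
  proof (cases "i = 0")
    case False
    then have "i > length s" using assms that by auto
    then have "term_of s i = 0" by (simp add: term_of_def)
    then show ?thesis using partial_sum_diff[of i s] False by simp
  qed simp
  then have "{partial_sum s (i - 1)<..partial_sum s i} = {}"
    "{L - partial_sum s i<..L - partial_sum s (i - 1)} = {}" if "i \<in> X" "i \<notin> {1..m}" for i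
    using that by auto
  then show "blocks (partial_sum s) X = blocks (partial_sum s) {i\<in>{1..m}. i \<in> X}"
    "rev_blocks L (partial_sum s) X = rev_blocks L (partial_sum s) {i\<in>{1..m}. i \<in> X}"
    unfolding blocks_def rev_blocks_def by blast+
qed

lemma card_parity_blocks:
  shows "card (blocks (partial_sum s) {i. even i}) = even_sum s"
    and "card (blocks (partial_sum s) {i. odd i}) = odd_sum s"
    and "sum_list s \<le> L \<Longrightarrow> card (rev_blocks L (partial_sum s) {i. even i}) = even_sum s"
    and "sum_list s \<le> L \<Longrightarrow> card (rev_blocks L (partial_sum s) {i. odd i}) = odd_sum s"
proof -
  have *: "(\<Sum>i\<in>{i\<in>{1..length s}. Q i}. partial_sum s i - partial_sum s (i - 1)) =
     (\<Sum>i\<in>{i\<in>{1..length s}. Q i}. term_of s i)" for Q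
    by (rule sum.cong[OF refl]) (use partial_sum_diff in force)
  have b: "card (blocks (partial_sum s) {i. Q i}) = (\<Sum>i\<in>{i\<in>{1..length s}. Q i}. term_of s i)" for Q
  proof -
    have "card (blocks (partial_sum s) {i. Q i}) = card (blocks (partial_sum s) {i\<in>{1..length s}. i \<in> {i. Q i}})"
      by (rule arg_cong[OF blocks_trunc(1)]) simp
    also have "\<dots> = (\<Sum>i\<in>{i\<in>{1..length s}. Q i}. partial_sum s i - partial_sum s (i - 1))"
      unfolding mem_Collect_eq by (rule card_blocks[OF mono_partial_sum]) simp
    finally show ?thesis unfolding * .
  qed
  have r: "card (rev_blocks L (partial_sum s) {i. Q i}) = (\<Sum>i\<in>{i\<in>{1..length s}. Q i}. term_of s i)"
    if "sum_list s \<le> L" for Q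
  proof -
    have "card (rev_blocks L (partial_sum s) {i. Q i}) = card (rev_blocks L (partial_sum s) {i\<in>{1..length s}. i \<in> {i. Q i}})"
      by (rule arg_cong[OF blocks_trunc(2)]) simp
    also have "\<dots> = (\<Sum>i\<in>{i\<in>{1..length s}. Q i}. partial_sum s i - partial_sum s (i - 1))"
      unfolding mem_Collect_eq
      by (rule card_rev_blocks[OF mono_partial_sum]) (use order_trans[OF partial_sum_le that] in simp_all)
    finally show ?thesis unfolding * .
  qed
  show "card (blocks (partial_sum s) {i. even i}) = even_sum s"
    "card (blocks (partial_sum s) {i. odd i}) = odd_sum s"
    "sum_list s \<le> L \<Longrightarrow> card (rev_blocks L (partial_sum s) {i. even i}) = even_sum s"
    "sum_list s \<le> L \<Longrightarrow> card (rev_blocks L (partial_sum s) {i. odd i}) = odd_sum s"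
    using b r by (simp_all add: even_sum_def odd_sum_def)
qed

text \<open>The quartered hexagon is a half hexagon with the even blocks as dents. Their number is
  half its height, so the case of value 0 never occurs.\<close>

lemma Q_eq: "real (Q t) = Delta (blocks (partial_sum t) {i. even i}) / odd_fact_prod (even_sum t)"
proof -
  define P where "P = (\<lambda>i. (partial_sum t (2 * i - 1), partial_sum t (2 * i))) ` {1..length t div 2}"
  define L where "L = odd_sum t + even_sum t"
  have "quartered_hexagon t = reg {(i, k)\<in>half_ups (even_sum t) 0 L. \<not> removed 0 P i k}
      {(i, k)\<in>half_dns (even_sum t) 0 L. \<not> removed 0 P i k}"
  proof (rule reg_eqI)
    show "quartered_hexagon t \<subseteq> unit_triangles"
      unfolding quartered_hexagon_def using triangles_in_unit by blast
    have q: "quartered_hexagon t = triangles_in (upper_polygon (even_sum t) L) -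
       (\<Union>i\<in>{1..length t div 2}. up_hole (partial_sum t (2*i - 1)) (partial_sum t (2*i)))"
      by (simp add: quartered_hexagon_def upper_polygon_def L_def)
    show "up i k \<in> quartered_hexagon t \<longleftrightarrow> (i, k) \<in> {(i, k)\<in>half_ups (even_sum t) 0 L. \<not> removed 0 P i k}" for i k
      unfolding q by (auto simp: upper_polygon_up up_hole_up removed_def P_def half_ups_def)
    show "dn i k \<in> quartered_hexagon t \<longleftrightarrow> (i, k) \<in> {(i, k)\<in>half_dns (even_sum t) 0 L. \<not> removed 0 P i k}" for i k
      unfolding q by (auto simp: upper_polygon_dn up_hole_dn removed_def P_def half_dns_def)
  qed
  then have "real (Q t) = real (num_tilings_reg ({(i, k)\<in>half_ups (even_sum t) 0 L. \<not> removed 0 P i k} - (edge ` {}) \<times> {0})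
      {(i, k)\<in>half_dns (even_sum t) 0 L. \<not> removed 0 P i k})"
    by (simp add: Q_def num_tilings_reg_def)
  also have "\<dots> = (if card ({} \<union> blocks (partial_sum t) {i. even i}) = even_sum t
     then Delta ({} \<union> blocks (partial_sum t) {i. even i}) / odd_fact_prod (even_sum t) else 0)"
  proof (rule num_tilings_removed_product)
    show "q \<le> p + even_sum t \<and> q \<le> L" if "(p, q) \<in> P" for p q
    proof -
      obtain i where i: "i \<ge> 1" "p = partial_sum t (2 * i - 1)" "q = partial_sum t (2 * i)"
        using \<open>(p, q) \<in> P\<close> by (auto simp: P_def)
      have "q = p + term_of t (2 * i)" using partial_sum_diff[of "2 * i" t] i by simp
      then show ?thesis using term_of_le(1)[of "2 * i" t] i partial_sum_le[of t "2 * i"]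
        by (simp add: L_def odd_sum_plus_even_sum)
    qed
    have "blocks (partial_sum t) {i. even i} = blocks (partial_sum t) {i\<in>{1..length t}. i \<in> {i. even i}}"
      by (rule blocks_trunc) simp
    also have "{i\<in>{1..length t}. i \<in> {i. even i}} = (\<lambda>i. 2 * i) ` {1..length t div 2}"
      by (auto elim!: evenE simp: image_iff)
    finally show "blocks (partial_sum t) {i. even i} = {1..0} \<union> (\<Union>(p, q)\<in>P. {p<..q})"
      by (simp add: blocks_def P_def)
  qed (auto simp: L_def)
  finally show ?thesis by (simp add: card_parity_blocks)
qed

section \<open>The sequences t^+ and t^- as merged sequences\<close>

lemma floor_idx_eq: "floor_idx m = 2 * ((m + 1) div 2)"
proof -
  have "\<lfloor>(real m + 1) / 2\<rfloor> = int ((m + 1) div 2)"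
    using floor_divide_of_nat_eq[of "m + 1" 2] by (simp add: add_ac)
  then show ?thesis by (simp add: floor_idx_def)
qed

lemma ceil_idx_eq:
  assumes "m \<ge> 1"
  shows "ceil_idx m = 2 * (m div 2)"
proof -
  have "\<lceil>(real m - 1) / 2\<rceil> = int (m div 2)"
  proof (cases "even m")
    case True
    then obtain r where "m = 2 * r" by blast
    then show ?thesis by (simp add: ceiling_eq_iff)
  next
    case False
    then obtain r where "m = 2 * r + 1" by (auto elim: oddE)
    then show ?thesis by simp
  qed
  then show ?thesis by (simp add: ceil_idx_def)
qed

text \<open>The common core of both sequences: a from the left, b from the right, and in the middle
  one term that contains the gap of width \<open>w\<close>. Apart from the parities of p and q, the
  two cases are alike.\<close>

definition merge :: "nat \<Rightarrow> nat \<Rightarrow> nat \<Rightarrow> nat list \<Rightarrow> nat list \<Rightarrow> nat list" where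
  "merge p q w a b = map (term_of a) [1..<p + 1] @ [term_of a (p + 1) + w + term_of b q] @ map (term_of b) (rev [1..<q])"

lemma length_merge: "q \<ge> 1 \<Longrightarrow> length (merge p q w a b) = p + q"
  by (simp add: merge_def)

lemma term_of_merge:
  assumes "q \<ge> 1"
  shows "1 \<le> i \<Longrightarrow> i \<le> p \<Longrightarrow> term_of (merge p q w a b) i = term_of a i"
    and "term_of (merge p q w a b) (p + 1) = term_of a (p + 1) + w + term_of b q"
    and "1 \<le> r \<Longrightarrow> r < q \<Longrightarrow> term_of (merge p q w a b) (p + 1 + r) = term_of b (q - r)"
proof -
  show "term_of (merge p q w a b) i = term_of a i" if "1 \<le> i" "i \<le> p"
    using that less_le_trans[OF diff_less, of 1 i p] assms length_merge[of q p w a b] by (simp add: term_of_def[of "merge p q w a b"]) (simp add: merge_def nth_append del: upt_Suc)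
  show "term_of (merge p q w a b) (p + 1) = term_of a (p + 1) + w + term_of b q"
    using assms length_merge[of q p w a b] by (simp add: term_of_def[of "merge p q w a b"]) (simp add: merge_def nth_append del: upt_Suc)
  show "term_of (merge p q w a b) (p + 1 + r) = term_of b (q - r)" if "1 \<le> r" "r < q"
    using that assms length_merge[of q p w a b]
    by (simp add: term_of_def[of "merge p q w a b"]) (simp add: merge_def nth_append rev_nth nth_Cons' Suc_diff_Suc del: upt_Suc)
qed

context
  fixes p q w L :: nat and a b :: "nat list"
  assumes q: "q \<ge> 1" and a: "length a \<le> p + 1" and b: "length b \<le> q"
    and L: "L = sum_list a + w + sum_list b"
begin

lemma partial_sum_merge_left: "i \<le> p \<Longrightarrow> partial_sum (merge p q w a b) i = partial_sum a i"
proof (induction i)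
  case (Suc i)
  then show ?case using term_of_merge(1)[OF q, of "Suc i" p w a b] by (simp add: partial_sum_Suc)
qed simp

lemma partial_sum_merge_right: "r < q \<Longrightarrow> partial_sum (merge p q w a b) (p + 1 + r) = L - partial_sum b (q - 1 - r)"
proof (induction r)
  case 0
  have "partial_sum a (Suc p) = sum_list a" "partial_sum b q = sum_list b"
    using a b by (simp_all add: partial_sum_full)
  then show ?case
    using partial_sum_merge_left[of p] term_of_merge(2)[OF q, of p w a b] partial_sum_diff[OF q, of b]
    by (simp add: partial_sum_Suc L)
next
  case (Suc r)
  have "partial_sum b (q - 1 - r) = partial_sum b (q - 1 - Suc r) + term_of b (q - Suc r)"
    using partial_sum_diff[of "q - 1 - r" b] Suc.prems by (simp add: diff_commute)
  moreover have "partial_sum b (q - 1 - r) \<le> L" using partial_sum_le[of b] by (simp add: L trans_le_add2)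
  ultimately show ?case
    using Suc term_of_merge(3)[OF q, of "Suc r" p w a b] by (simp add: partial_sum_Suc)
qed

text \<open>The term b_j has index p + 1 + q - j in the merged sequence. Since p + q is even, this
  index and j have opposite parity, so the selection from b is complementary to that from a. The
  alternating predicate \<open>par\<close> stands for either parity, and the middle term with the
  gap is not selected.\<close>

lemma blocks_merge:
  fixes par :: "nat \<Rightarrow> bool"
  assumes pq: "even (p + q)" and p: "\<not> par (p + 1)" and par: "\<And>i. par (Suc i) \<longleftrightarrow> \<not> par i"
  shows "blocks (partial_sum (merge p q w a b)) {i\<in>{1..p + q}. par i} =
    blocks (partial_sum a) {i. par i} \<union> rev_blocks L (partial_sum b) {j. \<not> par j}"
proof -
  let ?P = "partial_sum (merge p q w a b)"
  have Q2: "par (i + 2 * j) \<longleftrightarrow> par i" for i j by (induction j) (simp_all add: par)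
  have Qpar: "par i \<longleftrightarrow> par j" if "even (i + j)" for i j
  proof (cases "i \<le> j")
    case True
    then obtain d where "j = i + d" using le_Suc_ex by blast
    moreover from this have "even d" using that by presburger
    ultimately show ?thesis using Q2 by (auto elim: evenE)
  next
    case False
    then obtain d where "i = j + d" using le_Suc_ex[of j i] by auto
    moreover from this have "even d" using that by presburger
    ultimately show ?thesis using Q2 by (auto elim: evenE)
  qed
  have right: "{?P (p + 1 + (q - j) - 1)<..?P (p + 1 + (q - j))} = {L - partial_sum b j<..L - partial_sum b (j - 1)}"
    if "j \<in> {1..q - 1}" for j
  proof -
    have e: "p + 1 + (q - j) - 1 = p + 1 + (q - j - 1)" "q - 1 - (q - j) = j - 1" "q - 1 - (q - j - 1) = j"
      "q - j < q" "q - j - 1 < q" using that by auto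
    show ?thesis unfolding e(1) partial_sum_merge_right[OF e(4)] partial_sum_merge_right[OF e(5)] e(2,3) ..
  qed
  have "{i\<in>{1..p + q}. par i} = {i\<in>{1..p}. par i} \<union> (\<lambda>j. p + 1 + (q - j)) ` {j\<in>{1..q - 1}. \<not> par j}"
  proof (intro equalityI subsetI)
    fix i assume i: "i \<in> {i\<in>{1..p + q}. par i}"
    show "i \<in> {i\<in>{1..p}. par i} \<union> (\<lambda>j. p + 1 + (q - j)) ` {j\<in>{1..q - 1}. \<not> par j}"
    proof (cases "i \<le> p")
      case False
      then have "i \<ge> p + 2" using i p by (cases "i = p + 1") auto
      define j where "j = p + 1 + q - i"
      have "j \<in> {1..q - 1}" "i = p + 1 + (q - j)" using i \<open>i \<ge> p + 2\<close> by (auto simp: j_def)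
      moreover have "par (Suc j) \<longleftrightarrow> par i"
      proof (rule Qpar)
        have "Suc j + i = p + q + 2" using i by (auto simp: j_def)
        then show "even (Suc j + i)" using pq by simp
      qed
      then have "\<not> par j" using i by (simp add: par)
      ultimately show ?thesis by blast
    qed (use i in auto)
  next
    fix i assume i: "i \<in> {i\<in>{1..p}. par i} \<union> (\<lambda>j. p + 1 + (q - j)) ` {j\<in>{1..q - 1}. \<not> par j}"
    show "i \<in> {i\<in>{1..p + q}. par i}"
    proof (cases "i \<in> {i\<in>{1..p}. par i}")
      case False
      then obtain j where j: "j \<in> {1..q - 1}" "\<not> par j" "i = p + 1 + (q - j)" using i by blast
      have "par (Suc j) \<longleftrightarrow> par i"
      proof (rule Qpar)
        have "Suc j + i = p + q + 2" using j by auto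
        then show "even (Suc j + i)" using pq by simp
      qed
      then show ?thesis using j by (auto simp: par)
    qed auto
  qed
  then have "blocks ?P {i\<in>{1..p + q}. par i} = blocks ?P {i\<in>{1..p}. par i} \<union> blocks ?P ((\<lambda>j. p + 1 + (q - j)) ` {j\<in>{1..q - 1}. \<not> par j})"
    by (simp add: blocks_def)
  also have "blocks ?P {i\<in>{1..p}. par i} = blocks (partial_sum a) {i\<in>{1..p}. i \<in> {i. par i}}"
  proof -
    have "{?P (i - 1)<..?P i} = {partial_sum a (i - 1)<..partial_sum a i}" if "i \<in> {i\<in>{1..p}. par i}" for i
      using that partial_sum_merge_left[of i] partial_sum_merge_left[of "i - 1"] by auto
    then show ?thesis by (simp add: blocks_def)
  qed
  also have "\<dots> = blocks (partial_sum a) {i. par i}"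
  proof (rule blocks_trunc(1)[symmetric])
    show "i > length a" if "i \<in> {i. par i}" "i > p" for i
      using that a p by (cases "i = p + 1") auto
  qed
  also have "blocks ?P ((\<lambda>j. p + 1 + (q - j)) ` {j\<in>{1..q - 1}. \<not> par j}) = rev_blocks L (partial_sum b) {j\<in>{1..q - 1}. j \<in> {j. \<not> par j}}"
    unfolding blocks_def rev_blocks_def using right by simp
  also have "\<dots> = rev_blocks L (partial_sum b) {j. \<not> par j}"
  proof (rule blocks_trunc(2)[symmetric])
    \<comment> \<open>By parity the index q is not among those selected from b, so its share of the
      middle term is not lost by stopping at q - 1.\<close>
    have "par q" using Qpar[of q p] pq p by (simp add: par add.commute)
    then show "i > length b" if "i \<in> {j. \<not> par j}" "i > q - 1" for i
      using that b q by (cases "i = q") auto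
  qed
  finally show ?thesis .
qed

end

section \<open>Dent positions on the two sides of the line\<close>

definition upper_dents :: "nat \<Rightarrow> nat list \<Rightarrow> nat list \<Rightarrow> nat set" where
  "upper_dents L a b = blocks (partial_sum a) {i. even i} \<union> rev_blocks L (partial_sum b) {j. odd j}"

text \<open>The interval at the end is the base of the corner triangle that completes the lower part
  to a half hexagon. In both definitions x and y enter only through L.\<close>

definition lower_dents :: "nat \<Rightarrow> nat \<Rightarrow> nat list \<Rightarrow> nat list \<Rightarrow> nat set" where
  "lower_dents L z a b = blocks (partial_sum a) {i. odd i} \<union> rev_blocks L (partial_sum b) {j. even j} \<union> {L<..L + z}"

lemma blocks_subset: "blocks (partial_sum s) X \<subseteq> {0<..sum_list s}"
proof
  fix t assume "t \<in> blocks (partial_sum s) X"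
  then obtain i where "partial_sum s (i - 1) < t" "t \<le> partial_sum s i" by (auto simp: blocks_def)
  then show "t \<in> {0<..sum_list s}" using partial_sum_le[of s i] by auto
qed

lemma rev_blocks_subset: "rev_blocks L (partial_sum s) X \<subseteq> {L - sum_list s<..L}"
proof
  fix t assume "t \<in> rev_blocks L (partial_sum s) X"
  then obtain i where "L - partial_sum s i < t" "t \<le> L - partial_sum s (i - 1)" by (auto simp: rev_blocks_def)
  then show "t \<in> {L - sum_list s<..L}" using diff_le_mono2[OF partial_sum_le[of s i], of L] by auto
qed

lemma blocks_parity_Un:
  "blocks (partial_sum s) {i. even i} \<union> blocks (partial_sum s) {i. odd i} = {0<..sum_list s}"
  "rev_blocks L (partial_sum s) {i. even i} \<union> rev_blocks L (partial_sum s) {i. odd i} = {L - sum_list s<..L}"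
proof -
  have *: "{i::nat. even i} \<union> {i. odd i} = UNIV" by auto
  have t: "{i\<in>{1..length s}. i \<in> UNIV} = {1..length s}" by auto
  have "blocks (partial_sum s) {i. even i} \<union> blocks (partial_sum s) {i. odd i} = blocks (partial_sum s) UNIV"
    unfolding blocks_def UN_Un[symmetric] * ..
  also have "\<dots> = blocks (partial_sum s) {i\<in>{1..length s}. i \<in> UNIV}"
    by (rule blocks_trunc(1)) simp
  also have "\<dots> = {0<..sum_list s}"
    unfolding t blocks_interval(1)[OF mono_partial_sum] by (simp add: partial_sum_full)
  finally show "blocks (partial_sum s) {i. even i} \<union> blocks (partial_sum s) {i. odd i} = {0<..sum_list s}" .
  have "rev_blocks L (partial_sum s) {i. even i} \<union> rev_blocks L (partial_sum s) {i. odd i} = rev_blocks L (partial_sum s) UNIV"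
    unfolding rev_blocks_def UN_Un[symmetric] * ..
  also have "\<dots> = rev_blocks L (partial_sum s) {i\<in>{1..length s}. i \<in> UNIV}"
    by (rule blocks_trunc(2)) simp
  also have "\<dots> = {L - sum_list s<..L}"
    unfolding t blocks_interval(2)[OF mono_partial_sum] by (simp add: partial_sum_full)
  finally show "rev_blocks L (partial_sum s) {i. even i} \<union> rev_blocks L (partial_sum s) {i. odd i} = {L - sum_list s<..L}" .
qed

text \<open>The cardinalities determine the number of crossing lozenges: each half hexagon needs as
  many dents as half its height, which is y more than its holes supply.\<close>

lemma dents_partition:
  assumes L: "L = sum_list a + w + sum_list b"
  shows "upper_dents L a b \<inter> lower_dents L z a b = {}"
    and "upper_dents L a b \<union> lower_dents L z a b = {1..sum_list a} \<union> {sum_list a + w<..L + z}"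
    and "finite (upper_dents L a b)" "finite (lower_dents L z a b)"
    and "card (upper_dents L a b) = even_sum a + odd_sum b"
    and "card (lower_dents L z a b) = odd_sum a + even_sum b + z"
proof -
  let ?A = "\<lambda>Q. blocks (partial_sum a) {i. Q i}" and ?B = "\<lambda>Q. rev_blocks L (partial_sum b) {i. Q i}"
  have A: "?A Q \<subseteq> {0<..sum_list a}" and B: "?B Q \<subseteq> {sum_list a + w<..L}" for Q
    using blocks_subset[of a] rev_blocks_subset[of L b] by (auto simp: L)
  have finA: "finite (?A Q)" and finB: "finite (?B Q)" for Q
    by (rule finite_subset[OF A], simp) (rule finite_subset[OF B], simp)
  have disA: "?A even \<inter> ?A odd = {}" by (rule blocks_disjoint(1)[OF mono_partial_sum]) auto
  have disB: "?B odd \<inter> ?B even = {}" by (rule blocks_disjoint(2)[OF mono_partial_sum]) auto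
  have "{0<..sum_list a} \<inter> {sum_list a + w<..L} = {}" by auto
  then have disAB: "?A Q \<inter> ?B Q' = {}" for Q Q' using A[of Q] B[of Q'] by blast
  have "{0<..sum_list a} \<inter> {L<..L + z} = {}" "{sum_list a + w<..L} \<inter> {L<..L + z} = {}" by (auto simp: L)
  then have disZ: "?A Q \<inter> {L<..L + z} = {}" "?B Q \<inter> {L<..L + z} = {}" for Q
    using A[of Q] B[of Q] by blast+
  show "upper_dents L a b \<inter> lower_dents L z a b = {}"
    unfolding upper_dents_def lower_dents_def
    by (simp add: Int_Un_distrib Int_Un_distrib2 disA disB disAB disZ) (simp add: Int_commute disAB)
  show fin: "finite (upper_dents L a b)" "finite (lower_dents L z a b)"
    using finA finB by (simp_all add: upper_dents_def lower_dents_def)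
  have "upper_dents L a b \<union> lower_dents L z a b = {0<..sum_list a} \<union> {L - sum_list b<..L} \<union> {L<..L + z}"
    unfolding upper_dents_def lower_dents_def blocks_parity_Un(1)[symmetric] blocks_parity_Un(2)[symmetric] by (simp only: Un_ac)
  also have "\<dots> = {1..sum_list a} \<union> {sum_list a + w<..L + z}" by (auto simp: L)
  finally show "upper_dents L a b \<union> lower_dents L z a b = {1..sum_list a} \<union> {sum_list a + w<..L + z}" .
  have bL: "sum_list b \<le> L" by (simp add: L)
  show "card (upper_dents L a b) = even_sum a + odd_sum b"
    unfolding upper_dents_def using card_Un_disjoint[OF finA finB disAB[of even odd]]
    by (simp add: card_parity_blocks bL)
  have "card (?A odd \<union> ?B even \<union> {L<..L + z}) = card (?A odd \<union> ?B even) + card {L<..L + z}"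
    by (rule card_Un_disjoint) (simp_all add: finA finB disZ Int_Un_distrib2)
  then show "card (lower_dents L z a b) = odd_sum a + even_sum b + z"
    unfolding lower_dents_def using card_Un_disjoint[OF finA finB disAB[of odd even]]
    by (simp add: card_parity_blocks bL)
qed

lemma t_plus_merge:
  "t_plus x y a b = merge (ceil_idx (seq_length a)) (floor_idx (seq_length b)) (x + y) a b"
  by (simp add: t_plus_def merge_def Let_def)

text \<open>The leading 0 moves every index by one, so that the even blocks of t^- are the odd
  blocks of the merged sequence, apart from the block of \<open>z\<close>.\<close>

lemma t_minus_merge:
  assumes "floor_idx (seq_length a) = p + 1"
  shows "t_minus x y z a b = 0 # merge p (ceil_idx (seq_length b) + 1) (x + y) a b @ [z]"
  using assms by (simp add: t_minus_def merge_def Let_def)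

lemma seq_length: "seq_length s \<ge> 1" "length s \<le> seq_length s"
  by (cases s; simp add: seq_length_def)+

lemma blocks_t_plus:
  "blocks (partial_sum (t_plus x y a b)) {i. even i} = upper_dents (sum_list a + (x + y) + sum_list b) a b"
proof -
  define p q where "p = ceil_idx (seq_length a)" and "q = floor_idx (seq_length b)"
  have p: "even p" "length a \<le> p + 1"
    using seq_length[of a] by (auto simp: p_def ceil_idx_eq)
  have q: "even q" "q \<ge> 1" "length b \<le> q"
    using seq_length[of b] by (auto simp: q_def floor_idx_eq)
  let ?t = "merge p q (x + y) a b"
  have "blocks (partial_sum ?t) {i. even i} = blocks (partial_sum ?t) {i\<in>{1..p + q}. i \<in> {i. even i}}"
    by (rule blocks_trunc) (simp add: length_merge[OF q(2)])
  also have "\<dots> = blocks (partial_sum ?t) {i\<in>{1..p + q}. even i}" by simp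
  also have "\<dots> = blocks (partial_sum a) {i. even i} \<union> rev_blocks (sum_list a + (x + y) + sum_list b) (partial_sum b) {j. \<not> even j}"
    by (rule blocks_merge) (use p q in auto)
  finally show ?thesis by (simp add: t_plus_merge upper_dents_def p_def q_def)
qed

lemma partial_sum_Cons: "partial_sum (c # s) (Suc i) = c + partial_sum s i"
proof (induction i)
  case 0
  then show ?case by (simp add: partial_sum_Suc term_of_def)
next
  case (Suc i)
  have "term_of (c # s) (Suc (Suc i)) = term_of s (Suc i)" by (simp add: term_of_def)
  then show ?case using Suc by (simp add: partial_sum_Suc[of _ "Suc i"] partial_sum_Suc[of s])
qed

lemma partial_sum_append: "i \<le> length s \<Longrightarrow> partial_sum (s @ t) i = partial_sum s i"
  by (induction i) (simp_all add: partial_sum_Suc term_of_def nth_append)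

lemma blocks_t_minus:
  "blocks (partial_sum (t_minus x y z a b)) {i. even i} = lower_dents (sum_list a + (x + y) + sum_list b) z a b"
proof -
  define p q where "p = floor_idx (seq_length a) - 1" and "q = ceil_idx (seq_length b) + 1"
  have p: "floor_idx (seq_length a) = p + 1" "odd p" "length a \<le> p + 1"
    using seq_length[of a] by (auto simp: p_def floor_idx_eq)
  have q: "odd q" "q \<ge> 1" "length b \<le> q"
    using seq_length[of b] by (auto simp: q_def ceil_idx_eq)
  let ?t = "merge p q (x + y) a b" and ?L = "sum_list a + (x + y) + sum_list b"
  let ?s = "0 # ?t @ [z]"
  have len: "length ?t = p + q" by (rule length_merge[OF q(2)])
  have tot: "partial_sum ?t (p + q) = ?L"
    using partial_sum_merge_right[OF q(2) p(3) q(3) refl, of "q - 1" "x + y"] q by simp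
  have ps: "partial_sum ?s (Suc i) = partial_sum ?t i" if "i \<le> p + q" for i
    using that by (simp add: partial_sum_Cons partial_sum_append len)
  have ps': "partial_sum ?s (Suc (Suc (p + q))) = ?L + z"
  proof -
    have "term_of (?t @ [z]) (Suc (p + q)) = z" by (simp add: term_of_def nth_append len)
    then show ?thesis
      by (simp only: partial_sum_Cons partial_sum_Suc[of "?t @ [z]"]) (simp add: partial_sum_append len tot)
  qed
  have "blocks (partial_sum ?s) {i. even i} = blocks (partial_sum ?s) {i\<in>{1..p + q + 2}. i \<in> {i. even i}}"
    by (rule blocks_trunc) (simp add: len)
  \<comment> \<open>Since p and q are odd, the index p + q + 2 of \<open>z\<close> is even, and
    every other even index here is the successor of an odd index of the merged sequence.\<close>
  also have "{i\<in>{1..p + q + 2}. i \<in> {i. even i}} = insert (Suc (Suc (p + q))) (Suc ` {i\<in>{1..p + q}. odd i})"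
  proof (intro equalityI subsetI)
    fix i assume i: "i \<in> {i\<in>{1..p + q + 2}. i \<in> {i. even i}}"
    show "i \<in> insert (Suc (Suc (p + q))) (Suc ` {i\<in>{1..p + q}. odd i})"
    proof (cases "i = Suc (Suc (p + q))")
      case False
      have "i \<noteq> Suc (p + q)" using i p(2) q(1) by auto
      then have "i - 1 \<in> {i\<in>{1..p + q}. odd i}" "i = Suc (i - 1)" using i False by (auto elim!: evenE)
      then show ?thesis by blast
    qed simp
  qed (use p(2) q(1) in auto)
  also have "blocks (partial_sum ?s) (insert (Suc (Suc (p + q))) (Suc ` {i\<in>{1..p + q}. odd i})) =
     {?L<..?L + z} \<union> blocks (partial_sum ?t) {i\<in>{1..p + q}. odd i}"
  proof -
    have "{partial_sum ?s (Suc i - 1)<..partial_sum ?s (Suc i)} = {partial_sum ?t (i - 1)<..partial_sum ?t i}"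
      if "i \<in> {i\<in>{1..p + q}. odd i}" for i
      using ps[of i] ps[of "i - 1"] that by auto
    moreover have "{partial_sum ?s (Suc (Suc (p + q)) - 1)<..partial_sum ?s (Suc (Suc (p + q)))} = {?L<..?L + z}"
      using ps[of "p + q"] ps' tot by simp
    ultimately show ?thesis unfolding blocks_def by (simp only: UN_insert UN_simps image_image) auto
  qed
  also have "blocks (partial_sum ?t) {i\<in>{1..p + q}. odd i} =
     blocks (partial_sum a) {i. odd i} \<union> rev_blocks ?L (partial_sum b) {j. \<not> odd j}"
    by (rule blocks_merge) (use p q in auto)
  finally show ?thesis
    unfolding t_minus_merge[OF p(1)] q_def lower_dents_def by (auto simp: Un_ac)
qed

lemma Q_t_plus:
  "real (Q (t_plus x y a b)) =
     Delta (upper_dents (R1_L x y a b) a b) / odd_fact_prod (even_sum a + odd_sum b)"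
proof -
  have L: "R1_L x y a b = sum_list a + (x + y) + sum_list b" by (simp add: R1_L_def)
  have "even_sum (t_plus x y a b) = card (blocks (partial_sum (t_plus x y a b)) {i. even i})"
    by (simp add: card_parity_blocks)
  then show ?thesis unfolding Q_eq blocks_t_plus L by (simp add: dents_partition[OF refl])
qed

lemma Q_t_minus:
  "real (Q (t_minus x y z a b)) =
     Delta (lower_dents (R1_L x y a b) z a b) / odd_fact_prod (odd_sum a + even_sum b + z)"
proof -
  have L: "R1_L x y a b = sum_list a + (x + y) + sum_list b" by (simp add: R1_L_def)
  have "even_sum (t_minus x y z a b) = card (blocks (partial_sum (t_minus x y z a b)) {i. even i})"
    by (simp add: card_parity_blocks)
  then show ?thesis unfolding Q_eq blocks_t_minus L by (simp add: dents_partition[OF refl])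
qed

section \<open>The halved hexagon with ferns removed\<close>

definition flip_index :: "(int \<times> int) set \<Rightarrow> (int \<times> int) set" where
  "flip_index X = (\<lambda>(i, k). (i, - k)) ` X"

lemma mem_flip_index [simp]: "(i, k) \<in> flip_index X \<longleftrightarrow> (i, - k) \<in> X"
  by (force simp: flip_index_def)

definition upper_intervals :: "nat \<Rightarrow> nat list \<Rightarrow> nat list \<Rightarrow> (nat \<times> nat) set" where
  "upper_intervals L a b =
     (\<lambda>i. (partial_sum a (i - 1), partial_sum a i)) ` {i\<in>{2..length a}. even i}
     \<union> (\<lambda>j. (L - partial_sum b j, L - partial_sum b (j - 1))) ` {j\<in>{1..length b}. odd j}"

text \<open>The first term of a is absent because its half triangle is treated separately in
  \<open>removed\<close>; the last pair is the base of the corner triangle.\<close>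

definition lower_intervals :: "nat \<Rightarrow> nat \<Rightarrow> nat list \<Rightarrow> nat list \<Rightarrow> (nat \<times> nat) set" where
  "lower_intervals L z a b =
     (\<lambda>i. (partial_sum a (i - 1), partial_sum a i)) ` {i\<in>{2..length a}. odd i}
     \<union> (\<lambda>j. (L - partial_sum b j, L - partial_sum b (j - 1))) ` {j\<in>{1..length b}. even j}
     \<union> {(L, L + z)}"

lemma UN_intervals:
  "(\<Union>(p, q)\<in>(\<lambda>i. (P (i - 1), P i)) ` X. {p<..q}) = blocks P X"
  "(\<Union>(p, q)\<in>(\<lambda>j. (L - P j, L - P (j - 1))) ` X. {p<..q}) = rev_blocks L P X"
  by (simp_all add: blocks_def rev_blocks_def)

lemma upper_dents_intervals:
  "upper_dents L a b = {1..0} \<union> (\<Union>(p, q)\<in>upper_intervals L a b. {p<..q})"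
proof -
  have "{i\<in>{1..length a}. i \<in> {i. even i}} = {i\<in>{2..length a}. even i}" by (auto elim!: evenE)
  then have 1: "blocks (partial_sum a) {i. even i} = blocks (partial_sum a) {i\<in>{2..length a}. even i}"
    using blocks_trunc(1)[of "{i. even i}" "length a" a] by simp
  have 2: "rev_blocks L (partial_sum b) {i. odd i} = rev_blocks L (partial_sum b) {i\<in>{1..length b}. i \<in> {i. odd i}}"
    by (rule blocks_trunc(2)) simp
  show ?thesis
    unfolding upper_dents_def upper_intervals_def UN_Un UN_intervals 1 2 by simp
qed

lemma lower_dents_intervals:
  "lower_dents L z a b = {1..term_of a 1} \<union> (\<Union>(p, q)\<in>lower_intervals L z a b. {p<..q})"
proof -
  have 1: "blocks (partial_sum a) {i. odd i} = {1..term_of a 1} \<union> blocks (partial_sum a) {i\<in>{2..length a}. odd i}"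
  proof (cases "a = []")
    case True
    then have "blocks (partial_sum a) {i. odd i} = {}"
      using blocks_subset[of a "{i. odd i}"] by simp
    then show ?thesis using True by (simp add: term_of_def blocks_def)
  next
    case False
    then have "length a \<ge> 1" by (cases a) auto
    then have e: "{i\<in>{1..length a}. i \<in> {i. odd i}} = insert 1 {i\<in>{2..length a}. odd i}"
    proof -
      have "{1..length a} = insert 1 {2..length a}" using \<open>length a \<ge> 1\<close> by auto
      then show ?thesis by auto
    qed
    have "blocks (partial_sum a) {i. odd i} = blocks (partial_sum a) {i\<in>{1..length a}. i \<in> {i. odd i}}"
      by (rule blocks_trunc(1)) simp
    also have "\<dots> = {partial_sum a 0<..partial_sum a 1} \<union> blocks (partial_sum a) {i\<in>{2..length a}. odd i}"
      unfolding e by (simp add: blocks_def)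
    also have "{partial_sum a 0<..partial_sum a 1} = {1..term_of a 1}"
      using partial_sum_diff[of 1 a] by auto
    finally show ?thesis .
  qed
  have 2: "rev_blocks L (partial_sum b) {i. even i} = rev_blocks L (partial_sum b) {i\<in>{1..length b}. i \<in> {i. even i}}"
    by (rule blocks_trunc(2)) simp
  show ?thesis
    unfolding lower_dents_def lower_intervals_def UN_Un UN_intervals 1 2 by auto
qed

text \<open>The lower part is described in reflected coordinates, where it too is a half hexagon
  with holes standing on its base; up-pointing and down-pointing triangles change roles there. Holes
  of one side contain no triangle of the other side.\<close>

lemma R1_eq_reg:
  fixes x y z :: nat and a b :: "nat list"
  defines "L \<equiv> R1_L x y a b"
  defines "n1 \<equiv> y + even_sum a + odd_sum b" and "n2 \<equiv> y + z + odd_sum a + even_sum b"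
  shows "R1 x y z a b = reg
     ({(i, k)\<in>half_ups n1 0 L. \<not> removed 0 (upper_intervals L a b) i k} \<union>
      flip_index {(i, k)\<in>half_dns n2 0 (L + z). \<not> removed (term_of a 1) (lower_intervals L z a b) i k})
     ({(i, k)\<in>half_dns n1 0 L. \<not> removed 0 (upper_intervals L a b) i k} \<union>
      flip_index {(i, k)\<in>half_ups n2 0 (L + z). \<not> removed (term_of a 1) (lower_intervals L z a b) i k})"
proof (rule reg_eqI)
  have flip: "{(u, - k) | u k. 0 \<le> k \<and> k \<le> 2 * int n2 \<and> zigzag k \<le> u \<and> u \<le> real L + of_int k / 2 \<and>
      u \<le> real (L + z) - of_int k / 2} = {(u, - k) | u k. (u, k) \<in> lower_polygon n2 L z}"
    "{(u, - k) | u k. 0 \<le> k \<and> u \<le> real (term_of a 1) - of_int k / 2} = {(u, - k) | u k. (u, k) \<in> left_half (term_of a 1)}"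
    by (simp_all add: lower_polygon_def left_half_def)
  have R1: "R1 x y z a b = (triangles_in (upper_polygon n1 L) \<union>
       (triangles_in {(u, - k) | u k. (u, k) \<in> lower_polygon n2 L z} -
        triangles_in {(u, - k) | u k. (u, k) \<in> left_half (term_of a 1)}))
     - (\<Union>i\<in>{2..length a}. (if even i then up_hole else down_hole) (partial_sum a (i - 1)) (partial_sum a i))
     - (\<Union>j\<in>{1..length b}. (if odd j then up_hole else down_hole) (L - partial_sum b j) (L - partial_sum b (j - 1)))"
    unfolding R1_def R1_upper_def R1_lower_def upper_polygon_def L_def[symmetric] n1_def[symmetric] n2_def[symmetric] flip ..
  show "R1 x y z a b \<subseteq> unit_triangles"
    unfolding R1 using triangles_in_unit by blast
  have bex: "(\<exists>(p, q)\<in>(\<lambda>j. (f j, g j)) ` {j\<in>X. c j}. in_hole p q i k) \<longleftrightarrow> (\<exists>j\<in>X. c j \<and> in_hole (f j) (g j) i k)"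
    for f g :: "nat \<Rightarrow> nat" and X c i k by auto
  \<comment> \<open>With offset 0 and k nonnegative the half triangle in \<open>removed\<close> is
    empty, as it must be above the line.\<close>
  have rem1: "removed 0 (upper_intervals L a b) i k \<longleftrightarrow>
      (\<exists>j\<in>{2..length a}. even j \<and> in_hole (partial_sum a (j - 1)) (partial_sum a j) i k) \<or>
      (\<exists>j\<in>{1..length b}. odd j \<and> in_hole (L - partial_sum b j) (L - partial_sum b (j - 1)) i k)" if "0 \<le> k" for i k
  proof -
    have "\<not> (0 \<le> i \<and> i < int 0 - k div 2)" using that pos_imp_zdiv_nonneg_iff[of 2 k] by auto
    then show ?thesis unfolding removed_def upper_intervals_def bex_Un bex by blast
  qed
  have rem2: "removed (term_of a 1) (lower_intervals L z a b) i k \<longleftrightarrow> i < int (term_of a 1) - k div 2 \<or>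
      (\<exists>j\<in>{2..length a}. odd j \<and> in_hole (partial_sum a (j - 1)) (partial_sum a j) i k) \<or>
      (\<exists>j\<in>{1..length b}. even j \<and> in_hole (L - partial_sum b j) (L - partial_sum b (j - 1)) i k) \<or>
      in_hole L (L + z) i k" if "0 \<le> i" for i k
  proof -
    have "(\<exists>(p, q)\<in>{(L, L + z)}. in_hole p q i k) \<longleftrightarrow> in_hole L (L + z) i k" by simp
    then show ?thesis unfolding removed_def lower_intervals_def bex_Un bex using that by blast
  qed
  have up_if: "up i k \<in> (if c then up_hole else down_hole) p q \<longleftrightarrow>
      c \<and> 0 \<le> k \<and> in_hole p q i k \<or> \<not> c \<and> 1 \<le> - k \<and> in_hole p q i (- k)" for i k c p q
    by (simp add: up_hole_up down_hole_up)
  have dn_if: "dn i k \<in> (if c then up_hole else down_hole) p q \<longleftrightarrow>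
      c \<and> 1 \<le> k \<and> in_hole p q i k \<or> \<not> c \<and> 0 \<le> - k \<and> in_hole p q i (- k)" for i k c p q
    by (simp add: up_hole_dn down_hole_dn)
  have low_up: "up i k \<in> triangles_in {(u, - k) | u k. (u, k) \<in> P} \<longleftrightarrow> dn i (- k) \<in> triangles_in P" for i k P
    using triangles_in_flip(1)[of i k "\<lambda>u k. (u, k) \<in> P"] by simp
  have low_dn: "dn i k \<in> triangles_in {(u, - k) | u k. (u, k) \<in> P} \<longleftrightarrow> up i (- k) \<in> triangles_in P" for i k P
    using triangles_in_flip(2)[of i k "\<lambda>u k. (u, k) \<in> P"] by simp
  have hu: "0 \<le> i \<and> 0 \<le> k" if "(i, k) \<in> half_ups n 0 M" for i k n M using that by (simp add: half_ups_def)
  have hd: "0 \<le> i \<and> 1 \<le> k" if "(i, k) \<in> half_dns n 0 M" for i k n M using that by (simp add: half_dns_def)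
  have mem: "(i, k) \<in> {(i, k)\<in>X. \<not> P i k} \<union> flip_index {(i, k)\<in>Y. \<not> P' i k} \<longleftrightarrow>
      (i, k) \<in> X \<and> \<not> P i k \<or> (i, - k) \<in> Y \<and> \<not> P' i (- k)" for i k X Y P P'
    by simp
  show "up i k \<in> R1 x y z a b \<longleftrightarrow> (i, k) \<in>
     ({(i, k)\<in>half_ups n1 0 L. \<not> removed 0 (upper_intervals L a b) i k} \<union>
      flip_index {(i, k)\<in>half_dns n2 0 (L + z). \<not> removed (term_of a 1) (lower_intervals L z a b) i k})" for i k
  proof (cases "0 \<le> k")
    case True
    have no: "(i, - k) \<in> half_dns n2 0 (L + z) \<longleftrightarrow> False" using hd[of i "- k"] True by auto
    have k: "0 \<le> k \<longleftrightarrow> True" "1 \<le> - k \<longleftrightarrow> False" using True by auto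
    show ?thesis
      unfolding R1 Diff_iff Un_iff UN_iff up_if low_up upper_polygon_up lower_polygon_dn left_half_dn
        mem[unfolded Un_iff] no rem1[OF True] k by blast
  next
    case False
    have no: "(i, k) \<in> half_ups n1 0 L \<longleftrightarrow> False" using hu[of i k] False by auto
    have k: "0 \<le> k \<longleftrightarrow> False" "1 \<le> - k \<longleftrightarrow> True" using False by auto
    show ?thesis
    proof (cases "(i, - k) \<in> half_dns n2 0 (L + z)")
      case True
      then have "0 \<le> i" using hd by blast
      then show ?thesis
        unfolding R1 Diff_iff Un_iff UN_iff up_if low_up upper_polygon_up lower_polygon_dn left_half_dn
          mem[unfolded Un_iff] no rem2[OF \<open>0 \<le> i\<close>] k by blast
    next
      case False
      then show ?thesis
        unfolding R1 Diff_iff Un_iff UN_iff up_if low_up upper_polygon_up lower_polygon_dn left_half_dn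
          mem[unfolded Un_iff] no k by blast
    qed
  qed
  show "dn i k \<in> R1 x y z a b \<longleftrightarrow> (i, k) \<in>
     ({(i, k)\<in>half_dns n1 0 L. \<not> removed 0 (upper_intervals L a b) i k} \<union>
      flip_index {(i, k)\<in>half_ups n2 0 (L + z). \<not> removed (term_of a 1) (lower_intervals L z a b) i k})" for i k
  proof (cases "1 \<le> k")
    case True
    then have "0 \<le> k" by simp
    have no: "(i, - k) \<in> half_ups n2 0 (L + z) \<longleftrightarrow> False" using hu[of i "- k"] True by auto
    have k: "1 \<le> k \<longleftrightarrow> True" "0 \<le> - k \<longleftrightarrow> False" using True by auto
    show ?thesis
      unfolding R1 Diff_iff Un_iff UN_iff dn_if low_dn upper_polygon_dn lower_polygon_up left_half_up
        mem[unfolded Un_iff] no rem1[OF \<open>0 \<le> k\<close>] k by blast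
  next
    case False
    have no: "(i, k) \<in> half_dns n1 0 L \<longleftrightarrow> False" using hd[of i k] False by auto
    have k: "1 \<le> k \<longleftrightarrow> False" "0 \<le> - k \<longleftrightarrow> True" using False by auto
    show ?thesis
    proof (cases "(i, - k) \<in> half_ups n2 0 (L + z)")
      case True
      then have "0 \<le> i" using hu by blast
      then show ?thesis
        unfolding R1 Diff_iff Un_iff UN_iff dn_if low_dn upper_polygon_dn lower_polygon_up left_half_up
          mem[unfolded Un_iff] no rem2[OF \<open>0 \<le> i\<close>] k by blast
    next
      case False
      then show ?thesis
        unfolding R1 Diff_iff Un_iff UN_iff dn_if low_dn upper_polygon_dn lower_polygon_up left_half_up
          mem[unfolded Un_iff] no k by blast
    qed
  qed
qed

lemma mem_edge_interval: "i \<in> edge ` {1..m} \<longleftrightarrow> 0 \<le> i \<and> i < int m"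
proof
  assume "0 \<le> i \<and> i < int m"
  then show "i \<in> edge ` {1..m}" by (intro image_eqI[of _ _ "nat (i + 1)"]) (auto simp: edge_def)
qed (auto simp: edge_def)

text \<open>The base of the lower half hexagon has L + z edges, so the interval east of the gap has
  length M = b + z. The denominators are the two Weyl denominators, for half heights that exceed the
  dent counts by y.\<close>

lemma num_tilings_R1:
  fixes x y z :: nat and a b :: "nat list"
  defines "L \<equiv> R1_L x y a b"
  shows "real (num_tilings (R1 x y z a b)) =
     Delta (upper_dents L a b) * Delta (lower_dents L z a b) *
     (\<Prod>j<y. selberg_factor (sum_list a) x y (sum_list b + z) j)
     / (odd_fact_prod (y + even_sum a + odd_sum b) * odd_fact_prod (y + z + odd_sum a + even_sum b))"
proof -
  define n1 n2 where "n1 = y + even_sum a + odd_sum b" and "n2 = y + z + odd_sum a + even_sum b"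
  define g where "g = sum_list a + x + y"
  define U V where "U = upper_dents L a b" and "V = lower_dents L z a b"
  define I1 J1 where "I1 = {(i, k)\<in>half_ups n1 0 L. \<not> removed 0 (upper_intervals L a b) i k}"
    and "J1 = {(i, k)\<in>half_dns n1 0 L. \<not> removed 0 (upper_intervals L a b) i k}"
  define I2 J2 where "I2 = {(i, k)\<in>half_ups n2 0 (L + z). \<not> removed (term_of a 1) (lower_intervals L z a b) i k}"
    and "J2 = {(i, k)\<in>half_dns n2 0 (L + z). \<not> removed (term_of a 1) (lower_intervals L z a b) i k}"
  have fin: "finite I1" "finite J1" "finite I2" "finite J2"
    unfolding I1_def J1_def I2_def J2_def by (auto intro: finite_subset[OF _ finite_half_ups] finite_subset[OF _ finite_half_dns])
  have L: "L = sum_list a + (x + y) + sum_list b" by (simp add: L_def R1_L_def)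
  note dents = dents_partition(1,2)[OF L, of z, folded U_def V_def] dents_partition(3)[OF L, folded U_def]
    dents_partition(4)[OF L, of z, folded V_def] dents_partition(5)[OF L, folded U_def]
    dents_partition(6)[OF L, of z, folded V_def]
  have g: "sum_list a + (x + y) = g" "g + (sum_list b + z) = L + z" by (simp_all add: g_def L)
  have oe: "odd_sum a + even_sum a = sum_list a" "odd_sum b + even_sum b = sum_list b"
    by (rule odd_sum_plus_even_sum)+
  have nL: "n1 \<le> L" "n2 \<le> L + z" using oe by (auto simp: n1_def n2_def L)
  \<comment> \<open>A part of height 0 has no triangles on the line, so nothing can cross. In this
    case also y = 0, and only the empty set is wanted.\<close>
  define G where "G = (if n1 > 0 \<and> n2 > 0 then {sum_list a<..g} else {})"
  have U: "U = {1..0} \<union> (\<Union>(p, q)\<in>upper_intervals L a b. {p<..q})"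
    unfolding U_def by (rule upper_dents_intervals)
  have V: "V = {1..term_of a 1} \<union> (\<Union>(p, q)\<in>lower_intervals L z a b. {p<..q})"
    unfolding V_def by (rule lower_dents_intervals)
  have psL: "partial_sum a i \<le> L" "partial_sum b i \<le> L" for i
    using partial_sum_le[of a i] partial_sum_le[of b i] by (simp_all add: L)
  have ia: "partial_sum a i = partial_sum a (i - 1) + term_of a i" if "i \<ge> 2" for i
    using partial_sum_diff[of i a] that by simp
  have ib: "L - partial_sum b (j - 1) \<le> L - partial_sum b j + term_of b j" if "j \<ge> 1" for j
    using partial_sum_diff[OF that, of b] by simp
  have PU: "q \<le> p + n1 \<and> q \<le> L" if "(p, q) \<in> upper_intervals L a b" for p q
  proof -
    consider i where "i \<ge> 2" "even i" "p = partial_sum a (i - 1)" "q = partial_sum a i"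
      | j where "j \<ge> 1" "odd j" "p = L - partial_sum b j" "q = L - partial_sum b (j - 1)"
      using \<open>(p, q) \<in> upper_intervals L a b\<close> by (auto simp: upper_intervals_def)
    then show ?thesis
    proof cases
      case (1 i)
      then show ?thesis using ia[of i] psL(1)[of i] term_of_le(1)[of i a] by (simp add: n1_def)
    next
      case (2 j)
      then show ?thesis using ib[of j] term_of_le(2)[of j b] by (simp add: n1_def)
    qed
  qed
  have PV: "q \<le> p + n2 \<and> q \<le> L + z" if "(p, q) \<in> lower_intervals L z a b" for p q
  proof -
    consider i where "i \<ge> 2" "odd i" "p = partial_sum a (i - 1)" "q = partial_sum a i"
      | j where "j \<ge> 1" "even j" "p = L - partial_sum b j" "q = L - partial_sum b (j - 1)"
      | "p = L" "q = L + z"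
      using \<open>(p, q) \<in> lower_intervals L z a b\<close> by (auto simp: lower_intervals_def)
    then show ?thesis
    proof cases
      case (1 i)
      then show ?thesis using ia[of i] psL(1)[of i] term_of_le(2)[of i a] by (simp add: n2_def)
    next
      case (2 j)
      then show ?thesis using ib[of j] term_of_le(1)[of j b] by (simp add: n2_def)
    next
      case 3
      then show ?thesis by (simp add: n2_def)
    qed
  qed
  have a1: "term_of a 1 \<le> n2" using term_of_le(2)[of 1 a] by (simp add: n2_def)
  have UV_mem: "s \<in> {1..L} - U - V \<longleftrightarrow> s \<in> {sum_list a<..g}" for s
  proof -
    have "s \<notin> U \<and> s \<notin> V \<longleftrightarrow> s \<notin> {1..sum_list a} \<union> {g<..L + z}"
      using dents(2) unfolding g(1) by blast
    then show ?thesis using g(2) by auto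
  qed
  have base1: "(i, 0) \<in> I1 \<longleftrightarrow> n1 > 0 \<and> i \<in> edge ` ({1..L} - U)" for i
  proof -
    have "removed 0 (upper_intervals L a b) i 0 \<longleftrightarrow> i \<in> edge ` U"
      using removed_base[of 0 "upper_intervals L a b"] unfolding U by blast
    moreover have "(i, 0) \<in> half_ups n1 0 L \<longleftrightarrow> n1 > 0 \<and> i \<in> edge ` {1..L}"
      unfolding mem_edge_interval by (simp add: half_ups_def)
    ultimately show ?thesis
      unfolding image_set_diff[OF inj_edge] by (auto simp: I1_def)
  qed
  have base2: "(i, 0) \<in> I2 \<longleftrightarrow> n2 > 0 \<and> i \<in> edge ` ({1..L + z} - V)" for i
  proof -
    have "removed (term_of a 1) (lower_intervals L z a b) i 0 \<longleftrightarrow> i \<in> edge ` V"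
      using removed_base[of "term_of a 1" "lower_intervals L z a b"] unfolding V by blast
    moreover have "(i, 0) \<in> half_ups n2 0 (L + z) \<longleftrightarrow> n2 > 0 \<and> i \<in> edge ` {1..L + z}"
      unfolding mem_edge_interval by (simp add: half_ups_def)
    ultimately show ?thesis
      unfolding image_set_diff[OF inj_edge] by (auto simp: I2_def)
  qed
  have G_iff: "i \<in> edge ` G \<longleftrightarrow> (i, 0) \<in> I1 \<and> (i, 0) \<in> flip_index I2" for i
  proof -
    have "edge ` ({1..L} - U) \<inter> edge ` ({1..L + z} - V) = edge ` (({1..L} - U) \<inter> ({1..L + z} - V))"
      by (rule image_Int[OF inj_edge, symmetric])
    also have "({1..L} - U) \<inter> ({1..L + z} - V) = {1..L} - U - V" by auto
    also have "\<dots> = {sum_list a<..g}" using UV_mem by blast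
    finally show ?thesis using base1[of i] base2[of i] by (auto simp: G_def)
  qed
  have R1: "num_tilings (R1 x y z a b) = num_tilings_reg (I1 \<union> flip_index J2) (J1 \<union> flip_index I2)"
    unfolding num_tilings_reg_def I1_def J1_def I2_def J2_def n1_def n2_def L_def by (subst R1_eq_reg) (rule refl)
  also have "\<dots> = (\<Sum>S\<in>Pow (edge ` G). num_tilings_reg (I1 - S \<times> {0}) J1 * num_tilings_reg (flip_index J2) (flip_index I2 - S \<times> {0}))"
  proof (rule num_tilings_cut)
    show "0 \<le> k" if "(i, k) \<in> I1" for i k using that by (simp add: I1_def half_ups_def)
    show "1 \<le> k" if "(i, k) \<in> J1" for i k using that by (simp add: J1_def half_dns_def)
    show "k \<le> - 1" if "(i, k) \<in> flip_index J2" for i k using that by (simp add: J2_def half_dns_def)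
    show "k \<le> 0" if "(i, k) \<in> flip_index I2" for i k using that by (simp add: I2_def half_ups_def)
    show "finite (flip_index J2)" "finite (flip_index I2)" using fin by (simp_all add: flip_index_def)
    show "i \<in> edge ` G \<longleftrightarrow> (i, 0) \<in> I1 \<and> (i, 0) \<in> flip_index I2" for i by (rule G_iff)
  qed (rule fin)+
  \<comment> \<open>Reflection keeps the edges on the line in place, so the same S is removed from
    the base of the reflected lower part.\<close>
  also have "\<dots> = (\<Sum>S\<in>Pow (edge ` G). num_tilings_reg (I1 - S \<times> {0}) J1 * num_tilings_reg (I2 - S \<times> {0}) J2)"
  proof (rule sum.cong[OF refl])
    fix S
    have "flip_index (flip_index I2 - S \<times> {0}) = I2 - S \<times> {0}" "flip_index (flip_index J2) = J2"
      by (rule Set.set_eqI, simp only: split_paired_all, simp)+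
    then show "num_tilings_reg (I1 - S \<times> {0}) J1 * num_tilings_reg (flip_index J2) (flip_index I2 - S \<times> {0}) = num_tilings_reg (I1 - S \<times> {0}) J1 * num_tilings_reg (I2 - S \<times> {0}) J2"
      using num_tilings_reflect[of "flip_index J2" "flip_index I2 - S \<times> {0}"] by (simp flip: flip_index_def)
  qed
  also have "\<dots> = (\<Sum>S\<in>Pow G. num_tilings_reg (I1 - (edge ` S) \<times> {0}) J1 * num_tilings_reg (I2 - (edge ` S) \<times> {0}) J2)"
  proof -
    have "Pow (edge ` G) = (`) edge ` Pow G" by (rule image_Pow_surj[OF refl, symmetric])
    moreover have "inj_on ((`) edge) (Pow G)"
      using inj_edge by (intro inj_onI) (simp add: inj_image_eq_iff)
    ultimately show ?thesis by (simp only: sum.reindex o_def)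
  qed
  finally have "real (num_tilings (R1 x y z a b)) =
     (\<Sum>S\<in>Pow G. real (num_tilings_reg (I1 - (edge ` S) \<times> {0}) J1) * real (num_tilings_reg (I2 - (edge ` S) \<times> {0}) J2))"
    by (simp only: of_nat_sum of_nat_mult)
  also have "\<dots> = (\<Sum>S\<in>Pow G. if card S = y then Delta (S \<union> U) * Delta (S \<union> V) / (odd_fact_prod n1 * odd_fact_prod n2) else 0)"
  proof (rule sum.cong[OF refl])
    fix S assume "S \<in> Pow G"
    then have S: "S \<subseteq> {sum_list a<..g}" "n1 = 0 \<or> n2 = 0 \<Longrightarrow> S = {}" by (auto simp: G_def split: if_splits)
    have finS: "finite S" using S finite_subset by blast
    have "S \<subseteq> {1..L} - U - V" using S(1) UV_mem by blast
    moreover have "{1..L} \<subseteq> {1..L + z}" by auto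
    ultimately have SL: "S \<subseteq> {1..L}" "S \<subseteq> {1..L + z}" "S \<inter> U = {}" "S \<inter> V = {}" by blast+
    have "card (S \<union> U) = card S + card U" "card (S \<union> V) = card S + card V"
      using finS dents SL by (simp_all add: card_Un_disjoint)
    then have c: "card (S \<union> U) = n1 \<longleftrightarrow> card S = y" "card (S \<union> V) = n2 \<longleftrightarrow> card S = y"
      using dents by (auto simp: n1_def n2_def)
    have "real (num_tilings_reg (I1 - (edge ` S) \<times> {0}) J1) = (if card (S \<union> U) = n1 then Delta (S \<union> U) / odd_fact_prod n1 else 0)"
      unfolding I1_def J1_def by (rule num_tilings_removed_product) (use nL PU SL S U in auto)
    moreover have "real (num_tilings_reg (I2 - (edge ` S) \<times> {0}) J2) = (if card (S \<union> V) = n2 then Delta (S \<union> V) / odd_fact_prod n2 else 0)"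
      unfolding I2_def J2_def by (rule num_tilings_removed_product) (use nL PV SL S V a1 in auto)
    ultimately show "real (num_tilings_reg (I1 - (edge ` S) \<times> {0}) J1) * real (num_tilings_reg (I2 - (edge ` S) \<times> {0}) J2) =
      (if card S = y then Delta (S \<union> U) * Delta (S \<union> V) / (odd_fact_prod n1 * odd_fact_prod n2) else 0)"
      using c by simp
  qed
  \<comment> \<open>Sets of another size contribute 0. If G is empty because a part has height 0,
    then y = 0 and the empty set is the only one on both sides.\<close>
  also have "\<dots> = (\<Sum>S | S \<subseteq> {sum_list a<..g} \<and> card S = y. Delta (S \<union> U) * Delta (S \<union> V) / (odd_fact_prod n1 * odd_fact_prod n2))"
  proof (rule sum.mono_neutral_cong_right)
    show "finite (Pow G)" by (simp add: G_def)
    show "{S. S \<subseteq> {sum_list a<..g} \<and> card S = y} \<subseteq> Pow G"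
    proof
      fix S assume S: "S \<in> {S. S \<subseteq> {sum_list a<..g} \<and> card S = y}"
      then have "finite S" using finite_subset by blast
      show "S \<in> Pow G"
      proof (cases "n1 > 0 \<and> n2 > 0")
        case False
        then have "y = 0" by (auto simp: n1_def n2_def)
        then have "S = {}" using S \<open>finite S\<close> by auto
        then show ?thesis by simp
      qed (use S in \<open>auto simp: G_def\<close>)
    qed
    show "\<forall>S\<in>Pow G - {S. S \<subseteq> {sum_list a<..g} \<and> card S = y}.
       (if card S = y then Delta (S \<union> U) * Delta (S \<union> V) / (odd_fact_prod n1 * odd_fact_prod n2) else 0) = 0"
      by (auto simp: G_def split: if_splits)
  qed auto
  also have "\<dots> = Delta U * Delta V * (\<Prod>j<y. selberg_factor (sum_list a) x y (sum_list b + z) j) / (odd_fact_prod n1 * odd_fact_prod n2)"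
  proof -
    have "U \<union> V = {1..sum_list a} \<union> {sum_list a + x + y<..sum_list a + x + y + (sum_list b + z)}"
      using dents(2) unfolding g(1) g(2)[symmetric] g_def .
    from sum_Delta_Delta[OF dents(3,4,1) this] show ?thesis
      unfolding g_def sum_divide_distrib[symmetric] by (simp only:)
  qed
  finally show ?thesis unfolding U_def V_def n1_def n2_def .
qed

theorem theorem2p8:
  fixes x y z :: nat and a b :: "nat list"
  shows
    "let sa = sum_list a; sb = sum_list b;
         oa = odd_sum a; ea = even_sum a; ob = odd_sum b; eb = even_sum b;
         C = (Tprod (real x + 1) (int (2*sa + sb + 2*y + z)) y
                * Vprod (real (2*x + 2*sa + 3)) (int (sb + 2*y + z) - 1) y)
             / (Tprod 1 (int (2*sa + sb + 2*y + z)) y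
                * Vprod (real (2*sa + 3)) (int (sb + 2*y + z) - 1) y)
     in num_tilings (R1 y 0 z a b) \<noteq> 0 \<and>
        real (num_tilings (R1 x y z a b))
          = real (num_tilings (R1 (x + y) 0 z a b)) * real (num_tilings (R1 0 y z a b))
              / real (num_tilings (R1 y 0 z a b)) * C \<and>
        real (num_tilings (R1 x y z a b))
          = 2 powi (- int y) * real (Q (t_plus x y a b)) * real (Q (t_minus x y z a b))
            * ((H2 (2*ea + 2*ob + 1) * H2 (2*oa + 2*eb + 2*z + 1))
               / (H2 (2*ea + 2*ob + 2*y + 1) * H2 (2*oa + 2*eb + 2*y + 2*z + 1)))
            * ((H (2*sa + sb + 2*y + z + 1) * H (sb + y + z))
               / (H (2*sa + sb + y + z + 1) * H (sb + z)))
            * C"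
proof -
  define sa sb M where "sa = sum_list a" and "sb = sum_list b" and "M = sum_list b + z"
  define n1 n2 where "n1 = even_sum a + odd_sum b" and "n2 = odd_sum a + even_sum b + z"
  define C where "C = TV_ratio sa x y M"
  define F where "F w = (\<Prod>j<y. selberg_factor sa w y M j)" for w
  define P where "P v = Delta (upper_dents (R1_L v y a b) a b) * Delta (lower_dents (R1_L v y a b) z a b)" for v
  \<comment> \<open>Moving y into x keeps the base length, and the dents depend on x and y through
    that length alone.\<close>
  have L: "R1_L (x + y) 0 a b = R1_L x y a b" "R1_L y 0 a b = R1_L 0 y a b"
    by (simp_all add: R1_L_def)
  have n: "y + even_sum a + odd_sum b = n1 + y" "y + z + odd_sum a + even_sum b = n2 + y"
    "0 + even_sum a + odd_sum b = n1" "0 + z + odd_sum a + even_sum b = n2"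
    by (simp_all add: n1_def n2_def)
  \<comment> \<open>For y = 0 the product of the \<open>selberg_factor\<close> is empty, and only
    the Weyl products remain.\<close>
  have M1: "real (num_tilings (R1 x y z a b)) = P x * F x / (odd_fact_prod (n1 + y) * odd_fact_prod (n2 + y))"
    and M2: "real (num_tilings (R1 (x + y) 0 z a b)) = P x / (odd_fact_prod n1 * odd_fact_prod n2)"
    and M3: "real (num_tilings (R1 0 y z a b)) = P 0 * F 0 / (odd_fact_prod (n1 + y) * odd_fact_prod (n2 + y))"
    and M4: "real (num_tilings (R1 y 0 z a b)) = P 0 / (odd_fact_prod n1 * odd_fact_prod n2)"
    unfolding num_tilings_R1 L n P_def F_def sa_def M_def by simp_all
  \<comment> \<open>Positions are at least 1, so the Weyl products are positive; this also gives the
    nonvanishing of the denominator claimed in the theorem.\<close>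
  have "P 0 \<noteq> 0"
  proof -
    have L0: "R1_L 0 y a b = sum_list a + y + sum_list b" by (simp add: R1_L_def)
    have "0 \<notin> upper_dents (R1_L 0 y a b) a b \<union> lower_dents (R1_L 0 y a b) z a b"
      unfolding dents_partition(2)[OF L0] by simp
    then show ?thesis
      unfolding P_def using Delta_pos dents_partition(3,4)[OF L0] by (simp add: less_imp_neq[symmetric])
  qed
  define K where "K = 2 powi (- int y) * (H (2 * sa + M + 2 * y + 1) * H (M + y) / (H (2 * sa + M + y + 1) * H M))"
  \<comment> \<open>All dependence on x sits in \<open>C\<close>, which is 1 at x = 0. Hence the
    count for x = 0 supplies exactly \<open>K\<close>.\<close>
  have F: "F x = K * C" "F 0 = K"
    unfolding F_def prod_selberg_factor K_def C_def TV_ratio_0 by simp_all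
  have Qs: "real (Q (t_plus x y a b)) * real (Q (t_minus x y z a b)) = P x / (odd_fact_prod n1 * odd_fact_prod n2)"
    unfolding Q_t_plus Q_t_minus P_def n1_def n2_def by simp
  have H2: "H2 (2 * even_sum a + 2 * odd_sum b + 1) = odd_fact_prod n1"
    "H2 (2 * odd_sum a + 2 * even_sum b + 2 * z + 1) = odd_fact_prod n2"
    "H2 (2 * even_sum a + 2 * odd_sum b + 2 * y + 1) = odd_fact_prod (n1 + y)"
    "H2 (2 * odd_sum a + 2 * even_sum b + 2 * y + 2 * z + 1) = odd_fact_prod (n2 + y)"
    unfolding odd_fact_prod_def H2_odd[symmetric] n1_def n2_def
    by (rule arg_cong[where f = H2], simp)+
  have idx: "2 * sum_list a + sum_list b + 2 * y + z = 2 * sa + M + 2 * y" "sum_list b + 2 * y + z = M + 2 * y"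
    "sum_list b + y + z = M + y" "2 * sum_list a + sum_list b + y + z = 2 * sa + M + y" "sum_list b + z = M"
    "2 * x + 2 * sum_list a + 3 = 2 * x + 2 * sa + 3" "2 * sum_list a + 3 = 2 * sa + 3"
    by (simp_all add: sa_def M_def)
  have eq1: "real (num_tilings (R1 x y z a b)) = real (num_tilings (R1 (x + y) 0 z a b)) * real (num_tilings (R1 0 y z a b))
       / real (num_tilings (R1 y 0 z a b)) * C"
    unfolding M1 M2 M3 M4 F using \<open>P 0 \<noteq> 0\<close> by simp
  have eq2: "real (num_tilings (R1 x y z a b)) =
      2 powi (- int y) * real (Q (t_plus x y a b)) * real (Q (t_minus x y z a b))
      * (odd_fact_prod n1 * odd_fact_prod n2 / (odd_fact_prod (n1 + y) * odd_fact_prod (n2 + y)))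
      * (H (2 * sa + M + 2 * y + 1) * H (M + y) / (H (2 * sa + M + y + 1) * H M)) * C"
  proof -
    define h where "h = H (2 * sa + M + 2 * y + 1) * H (M + y) / (H (2 * sa + M + y + 1) * H M)"
    have "2 powi (- int y) * real (Q (t_plus x y a b)) * real (Q (t_minus x y z a b)) =
        2 powi (- int y) * (P x / (odd_fact_prod n1 * odd_fact_prod n2))"
      unfolding mult.assoc Qs ..
    then show ?thesis unfolding M1 F K_def h_def[symmetric] by (simp add: mult_ac)
  qed
  have "real (num_tilings (R1 y 0 z a b)) \<noteq> 0"
    unfolding M4 using \<open>P 0 \<noteq> 0\<close> by simp
  then have "num_tilings (R1 y 0 z a b) \<noteq> 0" by (metis of_nat_0)
  then show ?thesis
    unfolding Let_def H2 idx TV_ratio_def[symmetric] C_def[symmetric] using eq1 eq2 by blast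
qed

end
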